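(* Let $\mathbb H_2$ be the tree with vertex set $\{1,\dots,7\}$ and edge set $\{12,23,24,46,56,67\}$ (a path on five vertices with a pendant vertex attached to its second and fourth vertex). The problem $\mathbb H_2$-Induced Minor is solvable in polynomial time.
   Context: All graphs are finite and simple. A graph $G$ contains $H$ as an induced minor if $H$ can be obtained from $G$ by vertex deletions and edge contractions. The problem $H$-Induced Minor takes a graph $G$ as input and asks whether $G$ contains $H$ as an induced minor. *)

theory Defs
  imports "Graph_Theory.Graph_Theory" "HOL-Computational_Algebra.Polynomial"
begin

section \<open>Induced minors\<close>

text \<open>
  Finite simple graphs are rendered by the locale \<^locale>\<open>pair_graph\<close>: finite, irreflexive,
  symmetric digraphs without parallel arcs; an undirected edge \<open>uv\<close> is the pair of
  arcs \<open>(u, v)\<close>, \<open>(v, u)\<close>.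
\<close>

definition delete_vertex :: "'a pair_pre_digraph \<Rightarrow> 'a \<Rightarrow> 'a pair_pre_digraph" where
  "delete_vertex G v =
     \<lparr> pverts = pverts G - {v}, parcs = {(x, y) \<in> parcs G. x \<noteq> v \<and> y \<noteq> v} \<rparr>"

text \<open>
  The vertex resulting from the contraction of \<open>uv\<close> reuses the name \<open>u\<close>. The loop that the
  contracted edge would become is dropped, and parallel edges are identified since the arcs
  form a set.
\<close>

definition contract_edge :: "'a pair_pre_digraph \<Rightarrow> 'a \<Rightarrow> 'a \<Rightarrow> 'a pair_pre_digraph" where
  "contract_edge G u v = (let f = id(v := u) in
     \<lparr> pverts = pverts G - {v}, parcs = {(f x, f y) | x y. (x, y) \<in> parcs G \<and> f x \<noteq> f y} \<rparr>)"

inductive induced_minor_step :: "'a pair_pre_digraph \<Rightarrow> 'a pair_pre_digraph \<Rightarrow> bool" where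
  delete: "v \<in> pverts G \<Longrightarrow> induced_minor_step G (delete_vertex G v)"
| contract: "(u, v) \<in> parcs G \<Longrightarrow> induced_minor_step G (contract_edge G u v)"

definition contains_induced_minor :: "'a pair_pre_digraph \<Rightarrow> 'b pair_pre_digraph \<Rightarrow> bool" where
  "contains_induced_minor G H \<longleftrightarrow>
     (\<exists>G'. induced_minor_step\<^sup>*\<^sup>* G G' \<and> digraph_iso (with_proj G') (with_proj H))"

definition H2_edges :: "(nat \<times> nat) set" where
  "H2_edges = {(1,2), (2,3), (2,4), (4,6), (5,6), (6,7)}"

definition H2 :: "nat pair_pre_digraph" where
  "H2 = \<lparr> pverts = {1..7}, parcs = H2_edges \<union> H2_edges\<inverse> \<rparr>"

lemma pair_graph_H2: "pair_graph H2"
  by unfold_locales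
    (auto simp: H2_def H2_edges_def symmetric_def sym_def)

lemma pair_graph_induced_minor_step:
  assumes "induced_minor_step G G'" and "pair_graph G"
  shows "pair_graph G'"
proof -
  interpret pair_graph G by fact
  have s: "(y, x) \<in> parcs G" if "(x, y) \<in> parcs G" for x y
    using pair_sym_arcs that by (auto simp: symmetric_def sym_def)
  from assms(1) show ?thesis
  proof cases
    case (delete v)
    have "finite (parcs G')"
      by (rule finite_subset[OF _ pair_finite_arcs]) (auto simp: delete delete_vertex_def)
    then show ?thesis
      using pair_finite_verts s
      by unfold_locales
        (auto simp: delete delete_vertex_def symmetric_def sym_def pair_no_loops
          dest: in_arcsD1 in_arcsD2 pair_no_loops)
  next
    case (contract u v)
    have "u \<noteq> v" "u \<in> pverts G" using contract pair_no_loops in_arcsD1 by force+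
    let ?f = "id(v := u)"
    have "finite (parcs G')"
      by (rule finite_subset[OF _ finite_imageI[OF pair_finite_arcs, of "map_prod ?f ?f"]])
        (force simp: contract contract_edge_def)
    then show ?thesis
      using pair_finite_verts s \<open>u \<noteq> v\<close> \<open>u \<in> pverts G\<close>
      by unfold_locales
        (auto simp: contract contract_edge_def symmetric_def sym_def Let_def
          dest: in_arcsD1 in_arcsD2 split: if_splits; blast)+
  qed
qed


section \<open>Polynomial-time solvability\<close>

text \<open>
  The machine model is the random access machine of Cook and Reckhow with uniform cost:
  each instruction costs one time unit. Registers hold natural numbers, and subtraction is
  truncated. There is no multiplication, hence within \<open>t\<close> steps the bit length of
  register contents grows only by \<open>O(t)\<close>, and polynomial time on this machine coincides with
  polynomial time on deterministic Turing machines.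

  The input is a read-only bit string; \<open>READ r i\<close> puts into register \<open>r\<close> the input
  bit at the (0-based) position held by register \<open>i\<close>. \<open>LOAD\<close> and \<open>STORE\<close> are the indirect accesses
  \<open>X\<^sub>r := X[X\<^sub>i]\<close> and \<open>X[X\<^sub>i] := X\<^sub>r\<close>, and \<open>JPOS r l\<close> jumps to instruction \<open>l\<close> if register
  \<open>r\<close> is positive.
\<close>

datatype instr =
    SET nat nat
  | ADD nat nat nat
  | SUB nat nat nat
  | READ nat nat
  | LOAD nat nat
  | STORE nat nat
  | JPOS nat nat

type_synonym config = "nat \<times> (nat \<Rightarrow> nat)"

fun exec_instr :: "bool list \<Rightarrow> instr \<Rightarrow> config \<Rightarrow> config" where
  "exec_instr w (SET r c) (pc, X) = (Suc pc, X(r := c))"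
| "exec_instr w (ADD r i j) (pc, X) = (Suc pc, X(r := X i + X j))"
| "exec_instr w (SUB r i j) (pc, X) = (Suc pc, X(r := X i - X j))"
| "exec_instr w (READ r i) (pc, X) =
     (Suc pc, X(r := (if X i < length w \<and> w ! X i then 1 else 0)))"
| "exec_instr w (LOAD r i) (pc, X) = (Suc pc, X(r := X (X i)))"
| "exec_instr w (STORE i r) (pc, X) = (Suc pc, X(X i := X r))"
| "exec_instr w (JPOS r l) (pc, X) = (if X r > 0 then l else Suc pc, X)"

definition halted :: "instr list \<Rightarrow> config \<Rightarrow> bool" where
  "halted P c \<longleftrightarrow> length P \<le> fst c"

definition ram_step :: "instr list \<Rightarrow> bool list \<Rightarrow> config \<Rightarrow> config" where
  "ram_step P w c = (if halted P c then c else exec_instr w (P ! fst c) c)"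

text \<open>Register 0 initially holds the length of the input; all other registers hold 0.\<close>

definition initial_config :: "bool list \<Rightarrow> config" where
  "initial_config w = (0, (\<lambda>_. 0)(0 := length w))"

text \<open>Upon halting, register 0 holds the answer: nonzero for yes, zero for no.\<close>

definition answers_within :: "instr list \<Rightarrow> bool list \<Rightarrow> nat \<Rightarrow> bool \<Rightarrow> bool" where
  "answers_within P w T b \<longleftrightarrow>
     (\<exists>t\<le>T. let c = (ram_step P w ^^ t) (initial_config w)
            in halted P c \<and> (snd c 0 \<noteq> 0 \<longleftrightarrow> b))"

text \<open>
  A decision problem is given by its set of instances, their encoding as bit strings and the
  property to be decided. Strings that encode no instance are not inputs of the problem.
\<close>

definition solvable_in_polynomial_time ::
    "'i set \<Rightarrow> ('i \<Rightarrow> bool list) \<Rightarrow> ('i \<Rightarrow> bool) \<Rightarrow> bool" where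
  "solvable_in_polynomial_time Inst enc Q \<longleftrightarrow>
     (\<exists>(P :: instr list) (p :: nat poly). \<forall>I\<in>Inst.
        answers_within P (enc I) (poly p (length (enc I))) (Q I))"

text \<open>
  The instances are all finite simple graphs whose vertices are natural numbers, which covers
  every finite graph up to isomorphism. A graph is encoded by its adjacency matrix, row by row,
  with the vertices in increasing order; the encoding of a graph on \<open>n\<close> vertices has length
  \<open>n\<^sup>2\<close>.
\<close>

definition adjacency_matrix :: "nat pair_pre_digraph \<Rightarrow> bool list" where
  "adjacency_matrix G = (let vs = sorted_list_of_set (pverts G)
     in [(u, v) \<in> parcs G. u \<leftarrow> vs, v \<leftarrow> vs])"

definition induced_minor_problem_in_polynomial_time :: "'b pair_pre_digraph \<Rightarrow> bool" where
  "induced_minor_problem_in_polynomial_time H \<longleftrightarrow>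
     solvable_in_polynomial_time {G :: nat pair_pre_digraph. pair_graph G} adjacency_matrix
       (\<lambda>G. contains_induced_minor G H)"

end

theory Submission
  imports Defs
begin

text \<open>
  Shrinking the branch sets of an induced minor model of \<open>\<H>\<^sub>2\<close> shows that \<open>G\<close> contains it iff there are
  pairwise nonadjacent vertices \<open>a, b, c, d, v\<close> and nonadjacent connected sets \<open>X\<close>, \<open>Y\<close> such that \<open>X\<close>
  has neighbours \<open>a, b, v\<close> but not \<open>c, d\<close>, and \<open>Y\<close> has neighbours \<open>c, d, v\<close> but not \<open>a, b\<close>.
  If \<open>Y\<close> has at most three vertices, it can be guessed, and \<open>X\<close> can be replaced by a component of
  what remains after deleting \<open>a, b, v\<close> and the closed neighbourhood of \<open>Y \<union> {c, d}\<close>. If no model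
  has a side that small, then in a model with \<open>|X| + |Y|\<close> minimum \<open>X\<close> is an induced path whose ends
  are the only neighbours of \<open>a\<close> and \<open>b\<close>, and \<open>Y\<close> is one for \<open>c\<close> and \<open>d\<close>: the other
  possibilities can be rearranged so that a side becomes small. Guess the first two vertices \<open>x\<^sub>0, x\<^sub>1\<close>
  and the last vertex of \<open>X\<close>, the ends of \<open>Y\<close>, and delete all other vertices of the closed
  neighbourhood of \<open>{a, b, c, d, x\<^sub>0}\<close>. Then \<open>X\<close> and \<open>Y\<close> lie in different components: a
  vertex \<open>w\<close> adjacent to both would give the smaller model with centre \<open>w\<close>, leaf \<open>x\<^sub>0\<close> and side
  \<open>X - {x\<^sub>0}\<close>, and a longer connection that enters \<open>Y\<close> next to \<open>y\<close> through \<open>w\<close> would give a model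
  with side \<open>{w, y}\<close> whose leaves are the two neighbours of \<open>y\<close> on the path.

  Hence a bounded number of guessed vertices and finitely many reachability tests decide the
  problem, that is, it is definable in first-order logic with reachability, and every such property
  is decided by nested loops in polynomial time.
\<close>

section \<open>Connected sets\<close>

text \<open>The obstacle is that \<open>X\<close> and \<open>Y\<close> are unbounded, so they must
  reappear as components of a graph that boundedly many guesses determine. A deletion strong enough
  to keep the sides apart would also damage them. Hence the guesses form two sets: \<open>F\<close>,
  whose closed neighbourhood is deleted, and \<open>W\<close>, which is exempt. For long sides
  \<open>W\<close> lists the vertices of \<open>X\<close> and \<open>Y\<close> that the deletion
  would destroy; for a short side \<open>W\<close> is that side and \<open>F\<close> adds its two
  leaves. Both choices stay within five vertices, so a single criterion serves both cases. The
  criterion asks the two components to form a model themselves; a positive answer is therefore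
  always correct, and the work lies in showing that some guess succeeds. The vertex
  \<open>x 0\<close> belongs to \<open>F\<close> for the sake of the exchange that makes
  \<open>x 0\<close> a leaf: a new centre \<open>w\<close> must be nonadjacent to \<open>x 0\<close>
  and must keep its contact with \<open>X - {x 0}\<close>.\<close>

definition conn :: "'a rel \<Rightarrow> 'a set \<Rightarrow> bool" where
  "conn E X \<longleftrightarrow> X \<noteq> {} \<and> (\<forall>x\<in>X. \<forall>y\<in>X. (x, y) \<in> (Restr E X)\<^sup>*)"

text \<open>The guard \<open>x \<in> S\<close> makes the component of a vertex outside
  \<open>S\<close> empty; the reflexive closure alone would contain \<open>x\<close>.
  \<open>Reach\<close> inherits this convention.\<close>

definition component :: "'a rel \<Rightarrow> 'a set \<Rightarrow> 'a \<Rightarrow> 'a set" where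
  "component E S x = {z. x \<in> S \<and> (x, z) \<in> (Restr E S)\<^sup>*}"

definition apart :: "'a rel \<Rightarrow> 'a set \<Rightarrow> 'a set \<Rightarrow> bool" where
  "apart E A B \<longleftrightarrow> (\<forall>x\<in>A. \<forall>y\<in>B. x \<noteq> y \<and> (x, y) \<notin> E)"

definition touch :: "'a rel \<Rightarrow> 'a set \<Rightarrow> 'a set \<Rightarrow> bool" where
  "touch E A B \<longleftrightarrow> (\<exists>x\<in>A. \<exists>y\<in>B. (x, y) \<in> E)"

lemma component_subset: "component E S x \<subseteq> S"
proof
  fix z assume "z \<in> component E S x"
  then have "(x, z) \<in> (Restr E S)\<^sup>*" "x \<in> S" by (auto simp: component_def)
  then show "z \<in> S" by (induction rule: rtrancl_induct) auto
qed

lemma component_refl: "x \<in> S \<Longrightarrow> x \<in> component E S x"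
  by (auto simp: component_def)

lemma component_closed:
  assumes "z \<in> component E S x" "(z, w) \<in> E" "w \<in> S"
  shows "w \<in> component E S x"
proof -
  have "(z, w) \<in> Restr E S" using assms component_subset[of E S x] by auto
  then show ?thesis using assms(1) by (auto simp: component_def intro: rtrancl_into_rtrancl)
qed

text \<open>Some step of a walk from \<open>x\<close> to \<open>y\<close> leaves \<open>A\<close>.
  Later arguments about the place where a connection leaves a region use this edge and never a whole
  walk.\<close>

lemma conn_boundary:
  assumes "conn E K" "x \<in> K" "x \<in> A" "y \<in> K" "y \<notin> A"
  obtains u w where "u \<in> K" "u \<in> A" "w \<in> K" "w \<notin> A" "(u, w) \<in> E"
proof -
  have "(x, y) \<in> (Restr E K)\<^sup>*" using assms by (auto simp: conn_def)
  then have "y \<notin> A \<longrightarrow> (\<exists>u w. u \<in> K \<and> u \<in> A \<and> w \<in> K \<and> w \<notin> A \<and> (u, w) \<in> E)"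
    by (induction rule: rtrancl_induct) (use assms in auto)
  then show ?thesis using assms that by blast
qed

lemma conn_subset_component:
  assumes "conn E K" "K \<subseteq> S" "x \<in> K" "x \<in> component E S r"
  shows "K \<subseteq> component E S r"
proof (rule ccontr)
  assume "\<not> K \<subseteq> component E S r"
  then obtain y where "y \<in> K" "y \<notin> component E S r" by auto
  then obtain u w where "u \<in> component E S r" "w \<in> K" "w \<notin> component E S r" "(u, w) \<in> E"
    using conn_boundary[OF assms(1,3,4)] by metis
  then show False using component_closed assms(2) by fastforce
qed

lemma conn_component:
  assumes "sym E" "x \<in> S"
  shows "conn E (component E S x)"
proof -
  let ?C = "component E S x"
  \<comment> \<open>Every vertex on a walk from \<open>x\<close> inside \<open>S\<close> lies in the
    component itself, so the walk never leaves it.\<close>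
  have reach: "(x, z) \<in> (Restr E ?C)\<^sup>*" if "z \<in> ?C" for z
  proof -
    have "(x, z) \<in> (Restr E S)\<^sup>*" using that by (auto simp: component_def)
    then show ?thesis
    proof (induction rule: rtrancl_induct)
      case (step y z)
      have "y \<in> ?C" using step(1) assms by (auto simp: component_def)
      then have "(y, z) \<in> Restr E ?C" using step(2) component_closed by fastforce
      then show ?case using step(3) by (meson rtrancl.rtrancl_into_rtrancl)
    qed auto
  qed
  have "sym ((Restr E ?C)\<^sup>*)" using assms(1) by (intro sym_rtrancl) (auto simp: sym_def)
  then have "(y, z) \<in> (Restr E ?C)\<^sup>*" if "y \<in> ?C" "z \<in> ?C" for y z
    using reach[OF that(1)] reach[OF that(2)] by (meson rtrancl_trans symD)
  then show ?thesis using component_refl[OF assms(2)] by (auto simp: conn_def)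
qed

lemma conn_singleton [simp]: "conn E {x}"
  by (auto simp: conn_def)

lemma conn_Un:
  assumes "sym E" "conn E A" "conn E B" "touch E A B"
  shows "conn E (A \<union> B)"
proof -
  let ?R = "(Restr E (A \<union> B))\<^sup>*"
  obtain u w where uw: "u \<in> A" "w \<in> B" "(u, w) \<in> E" using assms(4) by (auto simp: touch_def)
  have "(Restr E A)\<^sup>* \<subseteq> ?R" "(Restr E B)\<^sup>* \<subseteq> ?R" by (intro rtrancl_mono; auto)+
  then have A: "(x, u) \<in> ?R" "(u, x) \<in> ?R" if "x \<in> A" for x
    using assms(2) uw that by (auto simp: conn_def)
  have B: "(x, w) \<in> ?R" "(w, x) \<in> ?R" if "x \<in> B" for x
    using assms(3) uw that \<open>(Restr E B)\<^sup>* \<subseteq> ?R\<close> by (auto simp: conn_def)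
  have "(u, w) \<in> ?R" "(w, u) \<in> ?R" using uw assms(1) by (auto dest: symD)
  then have "(x, u) \<in> ?R \<and> (u, x) \<in> ?R" if "x \<in> A \<union> B" for x
    using A B that by (meson UnE rtrancl_trans)
  then show ?thesis using assms(2) unfolding conn_def by (meson Un_empty rtrancl_trans)
qed

lemma conn_insert:
  assumes "sym E" "conn E A" "touch E {x} A"
  shows "conn E (insert x A)"
  using conn_Un[of E "{x}" A] assms by simp

text \<open>Enlarge \<open>C\<close> one vertex at a time; the last vertex added to reach \<open>X\<close> is not a cut vertex.\<close>
lemma ex_noncut_vertex:
  assumes "sym E" "finite X" "conn E X" "conn E C" "C \<subset> X"
  obtains w where "w \<in> X" "w \<notin> C" "conn E (X - {w})"
proof -
  define P where "P D \<longleftrightarrow> C \<subseteq> D \<and> D \<subset> X \<and> conn E D" for D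
  have "P C" using assms by (auto simp: P_def)
  moreover have "\<forall>D. P D \<longrightarrow> card D < card X + 1"
    using assms(2) by (auto simp: P_def le_imp_less_Suc card_mono)
  ultimately obtain D where D: "P D" "\<And>D'. P D' \<Longrightarrow> card D' \<le> card D"
    using ex_has_greatest_nat[of P C card "card X + 1"] by (metis less_imp_le)
  have "D \<noteq> {}" "D \<subset> X" using D(1) by (auto simp: P_def conn_def)
  then obtain x y where "x \<in> X" "x \<in> D" "y \<in> X" "y \<notin> D" by blast
  then obtain u w where uw: "u \<in> D" "w \<in> X" "w \<notin> D" "(u, w) \<in> E"
    using conn_boundary[OF assms(3)] by metis
  have "conn E (insert w D)"
    using uw D(1) assms(1) by (intro conn_insert) (auto simp: P_def touch_def dest: symD)
  moreover have "card D < card (insert w D)"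
    using uw D(1) assms(2) by (auto simp: P_def finite_subset card_insert_if)
  ultimately have "\<not> insert w D \<subset> X"
    using D(1) D(2)[of "insert w D"] by (auto simp: P_def)
  then have "X - {w} = D" using uw D(1) by (auto simp: P_def)
  then show ?thesis using that[of w] uw D(1) by (auto simp: P_def)
qed

section \<open>Induced paths\<close>

definition induced_path :: "'a rel \<Rightarrow> (nat \<Rightarrow> 'a) \<Rightarrow> nat \<Rightarrow> bool" where
  "induced_path E x k \<longleftrightarrow> inj_on x {..<k} \<and>
     (\<forall>i<k. \<forall>j<k. (x i, x j) \<in> E \<longleftrightarrow> j = Suc i \<or> i = Suc j)"

lemma induced_path_eq_iff:
  "induced_path E x k \<Longrightarrow> i < k \<Longrightarrow> j < k \<Longrightarrow> x i = x j \<longleftrightarrow> i = j"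
  by (auto simp: induced_path_def inj_on_def)

lemma induced_path_adj_iff:
  "induced_path E x k \<Longrightarrow> i < k \<Longrightarrow> j < k \<Longrightarrow> (x i, x j) \<in> E \<longleftrightarrow> j = Suc i \<or> i = Suc j"
  by (auto simp: induced_path_def)

lemma conn_induced_path:
  assumes "sym E" "induced_path E x k" "i < j" "j \<le> k"
  shows "conn E (x ` {i..<j})"
  using assms(3,4)
proof (induction j)
  case (Suc j)
  show ?case
  proof (cases "i = j")
    case False
    then have "conn E (insert (x j) (x ` {i..<j}))"
      using Suc assms by (intro conn_insert)
        (auto simp: touch_def induced_path_adj_iff intro!: bexI[of _ "j - 1"])
    moreover have "insert (x j) (x ` {i..<j}) = x ` {i..<Suc j}"
      using Suc.prems by (auto simp: atLeastLessThanSuc)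
    ultimately show ?thesis by simp
  qed auto
qed auto

lemma induced_path_rev:
  assumes "induced_path E x k"
  shows "induced_path E (\<lambda>i. x (k - 1 - i)) k"
  unfolding induced_path_def
proof (intro conjI allI impI inj_onI)
  fix i j assume "i \<in> {..<k}" "j \<in> {..<k}" "x (k - 1 - i) = x (k - 1 - j)"
  then show "i = j" using induced_path_eq_iff[OF assms, of "k - 1 - i" "k - 1 - j"] by auto
next
  fix i j assume "i < k" "j < k"
  then have "k - 1 - i < k" "k - 1 - j < k"
    and "k - 1 - j = Suc (k - 1 - i) \<longleftrightarrow> i = Suc j" "k - 1 - i = Suc (k - 1 - j) \<longleftrightarrow> j = Suc i"
    by linarith+
  then show "(x (k - 1 - i), x (k - 1 - j)) \<in> E \<longleftrightarrow> j = Suc i \<or> i = Suc j"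
    using induced_path_adj_iff[OF assms, of "k - 1 - i" "k - 1 - j"] by blast
qed

text \<open>A shortest walk inside \<open>X\<close> is an induced path, because a repeated vertex or
  a chord would give a shortcut. \<open>k\<close> counts vertices and exceeds the length of the walk
  by one.\<close>

lemma ex_induced_path:
  assumes "conn E X" "sym E" "irrefl E" "p \<in> X" "q \<in> X"
  obtains x k where "induced_path E x k" "x ` {..<k} \<subseteq> X" "0 < k" "x 0 = p" "x (k - 1) = q"
proof -
  let ?R = "Restr E X"
  define n where "n = (LEAST n. (p, q) \<in> ?R ^^ n)"
  have "\<exists>n. (p, q) \<in> ?R ^^ n" using assms by (auto simp: conn_def rtrancl_is_UN_relpow)
  then have n: "(p, q) \<in> ?R ^^ n" unfolding n_def by (rule LeastI_ex)
  have least: "n \<le> m" if "(p, q) \<in> ?R ^^ m" for m unfolding n_def using that by (rule Least_le)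
  obtain x where x: "x 0 = p" "x n = q" "\<And>i. i < n \<Longrightarrow> (x i, x (Suc i)) \<in> ?R"
    using n by (auto simp: relpow_fun_conv)
  have seg: "(x i, x (i + m)) \<in> ?R ^^ m" if "i + m \<le> n" for i m
    unfolding relpow_fun_conv using that x(3)
    by (intro exI[of _ "\<lambda>l. x (i + l)"]) auto
  have mem: "x i \<in> X" if "i \<le> n" for i
    using that x(1) assms(4) x(3)[of "i - 1"] by (cases i) auto
  have short: "j \<le> i + m" if "(x i, x j) \<in> ?R ^^ m" "i \<le> j" "j \<le> n" for i j m
  proof -
    have "(p, x i) \<in> ?R ^^ i" using seg[of 0 i] that x(1) by auto
    moreover have "(x j, q) \<in> ?R ^^ (n - j)" using seg[of j "n - j"] that x(2) by auto
    ultimately have "(p, q) \<in> ?R ^^ (i + m + (n - j))" using that(1) by (auto simp: relpow_add)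
    then show ?thesis using least that by force
  qed
  have ne: "x i \<noteq> x j" if "i < j" "j \<le> n" for i j
    using short[of i j 0] that by auto
  have ad: "(x i, x j) \<in> E \<longleftrightarrow> j = Suc i" if "i < j" "j \<le> n" for i j
    using short[of i j 1] that mem[of i] mem[of j] x(3)[of i] by auto
  have "induced_path E x (Suc n)" unfolding induced_path_def
  proof (intro conjI allI impI)
    show "inj_on x {..<Suc n}" using ne by (auto simp: inj_on_def less_Suc_eq_le) (metis linorder_neqE_nat)
    fix i j assume ij: "i < Suc n" "j < Suc n"
    consider "i < j" | "i = j" | "j < i" by linarith
    then show "(x i, x j) \<in> E \<longleftrightarrow> j = Suc i \<or> i = Suc j"
      by cases (use ij ad[of i j] ad[of j i] assms(2,3) in \<open>auto simp: irrefl_def dest: symD\<close>)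
  qed
  moreover have "x ` {..<Suc n} \<subseteq> X" using mem by auto
  ultimately show ?thesis using that[of x "Suc n"] x by simp
qed

section \<open>Models of \<open>\<H>\<^sub>2\<close>\<close>

locale simple_graph =
  fixes V :: "'a set" and E :: "'a rel"
  assumes finite_V: "finite V" and E_subset: "E \<subseteq> V \<times> V"
    and sym_E: "sym E" and irrefl_E: "irrefl E"
begin

lemma adj_sym: "(x, y) \<in> E \<Longrightarrow> (y, x) \<in> E"
  using sym_E by (rule symD)

lemma adj_commute: "(x, y) \<in> E \<longleftrightarrow> (y, x) \<in> E"
  using adj_sym by blast

lemma not_adj_self [simp]: "(x, x) \<notin> E"
  using irrefl_E by (simp add: irrefl_def)

text \<open>The leaves 1, 3, 5, 7 and the middle vertex 4 are represented by the single vertices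
  \<open>a, b, c, d, v\<close>, the branching vertices 2 and 6 by \<open>X\<close> and
  \<open>Y\<close>. Each pair of single vertices occurs in one order only; symmetry of
  \<open>E\<close> gives the other. Where a vertex touches a set, disjointness is a separate clause,
  since \<open>apart\<close> does not apply.\<close>

definition model where
  "model a b c d v X Y \<longleftrightarrow> X \<subseteq> V \<and> Y \<subseteq> V \<and> conn E X \<and> conn E Y \<and> apart E X Y \<and>
     apart E {a} {b, c, d, v} \<and> apart E {b} {c, d, v} \<and> apart E {c} {d, v} \<and> apart E {d} {v} \<and>
     apart E {c, d} X \<and> apart E {a, b} Y \<and> {a, b, v} \<inter> X = {} \<and> {c, d, v} \<inter> Y = {} \<and>
     touch E {a} X \<and> touch E {b} X \<and> touch E {v} X \<and>
     touch E {c} Y \<and> touch E {d} Y \<and> touch E {v} Y"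

lemma apart_sym: "apart E A B \<longleftrightarrow> apart E B A"
  unfolding apart_def using adj_sym by blast

lemma model_swap_leaves:
  assumes "model a b c d v X Y"
  shows "model b a c d v X Y"
proof -
  have "apart E {b} {a, c, d, v}" "apart E {a} {c, d, v}" "apart E {b, a} Y" "{b, a, v} \<inter> X = {}"
    using assms adj_commute[of b a] by (auto simp: model_def apart_def)
  then show ?thesis using assms unfolding model_def by simp
qed

lemma model_swap_sides:
  assumes "model a b c d v X Y"
  shows "model c d a b v Y X"
proof -
  have "apart E {a} {b, c, d, v}" "apart E {b} {c, d, v}" "apart E {c} {d, v}" "apart E {d} {v}"
    using assms by (simp_all add: model_def)
  then have "apart E {c} {d, a, b, v} \<and> apart E {d} {a, b, v} \<and> apart E {a} {b, v} \<and> apart E {b} {v}"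
    using adj_commute[of a c] adj_commute[of a d] adj_commute[of b c] adj_commute[of b d]
    by (auto simp: apart_def)
  then show ?thesis using assms apart_sym[of X Y] by (simp add: model_def)
qed

lemma finite_model:
  assumes "model a b c d v X Y"
  shows "finite X" "finite Y"
  using assms by (auto simp: model_def intro: finite_subset[OF _ finite_V])

lemma touch_noncut:
  assumes "conn E X" "p \<in> X" "X \<noteq> {p}"
  shows "touch E {p} (X - {p})"
proof -
  obtain y where "y \<in> X" "y \<notin> {p}" using assms by auto
  then obtain u w where "u \<in> {p}" "w \<in> X" "w \<notin> {p}" "(u, w) \<in> E"
    using conn_boundary[OF assms(1,2) insertI1] by metis
  then show ?thesis by (auto simp: touch_def)
qed

text \<open>The exchange used against minimality: \<open>p\<close> leaves \<open>X\<close> and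
  replaces the leaf \<open>a\<close>, while \<open>w\<close> replaces the centre \<open>v\<close>
  (\<open>w = v\<close> is allowed). As a former member of \<open>X\<close>, \<open>p\<close> is
  away from \<open>c\<close>, \<open>d\<close> and \<open>Y\<close>; connectedness of
  \<open>X\<close> gives its contact with the rest.\<close>

lemma model_shrink_leaf:
  assumes m: "model a b c d v X Y" and p: "p \<in> X" "conn E (X - {p})" "X \<noteq> {p}"
    and "apart E {p} {b, w}" "apart E {w} {b, c, d}" "w \<notin> X" "w \<notin> Y"
    and "touch E {b} (X - {p})" "touch E {w} (X - {p})" "touch E {w} Y"
  shows "model p b c d w (X - {p}) Y"
proof -
  have "touch E {p} (X - {p})" using touch_noncut m p by (auto simp: model_def)
  moreover have "apart E {p} {c, d}"
    using m p(1) adj_commute[of p c] adj_commute[of p d] by (auto simp: model_def apart_def)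
  then have "apart E {p} {b, c, d, w}"
    using assms(5) by (auto simp: apart_def)
  moreover have "apart E {b} {c, d, w} \<and> apart E {c} {d, w} \<and> apart E {d} {w}"
    using m assms(6) adj_commute[of w b] adj_commute[of w c] adj_commute[of w d]
    by (auto simp: model_def apart_def)
  moreover have "apart E (X - {p}) Y" "apart E {c, d} (X - {p})" "apart E {p, b} Y"
    using m p(1) by (auto simp: model_def apart_def)
  moreover have "{p, b, w} \<inter> (X - {p}) = {}" "{c, d, w} \<inter> Y = {}" "X - {p} \<subseteq> V"
    using m assms(7,8) by (auto simp: model_def)
  ultimately show ?thesis using m p(2) assms(9-) by (simp add: model_def)
qed

section \<open>The criterion with boundedly many guesses\<close>

definition free_set where
  "free_set W F L = (W \<union> {z \<in> V. apart E F {z}}) - L"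

text \<open>\<open>W\<close> and \<open>F\<close> are nonempty so that each can be listed, with
  repetitions, by exactly five variables of a formula.\<close>

definition criterion where
  "criterion \<longleftrightarrow> (\<exists>a b c d v x y W F. W \<subseteq> V \<and> F \<subseteq> V \<and> W \<noteq> {} \<and> F \<noteq> {} \<and> card W \<le> 5 \<and> card F \<le> 5 \<and>
     (let S = free_set W F {a, b, c, d, v} in x \<in> S \<and> y \<in> S \<and> y \<notin> component E S x \<and>
       model a b c d v (component E S x) (component E S y)))"

lemma component_apart:
  assumes "y \<notin> component E S x" "y \<in> S"
  shows "apart E (component E S x) (component E S y)"
proof -
  have "z \<notin> component E S x" if "z \<in> component E S y" for z
  proof
    assume "z \<in> component E S x"
    then have "component E S y \<subseteq> component E S x"
      using conn_subset_component[OF conn_component[OF sym_E assms(2)] component_subset] that by blast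
    then show False using assms component_refl[OF assms(2)] by blast
  qed
  then show ?thesis unfolding apart_def
    using component_closed[of _ E S x] component_subset[of E S y] by blast
qed

text \<open>Replacing \<open>X\<close> and \<open>Y\<close> by the components containing them keeps
  all contacts. What the enlargement could destroy is assumed: the components are different, and
  each avoids the leaves of the other side.\<close>

lemma model_component:
  assumes m: "model a b c d v X Y" and S: "X \<subseteq> S" "Y \<subseteq> S" "S \<subseteq> V" "{a, b, c, d, v} \<inter> S = {}"
    and xy: "x \<in> X" "y \<in> Y" "y \<notin> component E S x"
    and "apart E {c, d} (component E S x)" "apart E {a, b} (component E S y)"
  shows "model a b c d v (component E S x) (component E S y)"
proof -
  have x: "x \<in> component E S x" "y \<in> component E S y" using xy S by (auto intro: component_refl)
  have sub: "X \<subseteq> component E S x" "Y \<subseteq> component E S y"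
    using conn_subset_component[OF _ S(1) xy(1) x(1)] conn_subset_component[OF _ S(2) xy(2) x(2)] m
    by (auto simp: model_def)
  have t: "touch E {s} B" if "touch E {s} A" "A \<subseteq> B" for s A B
    using that by (auto simp: touch_def)
  have "conn E (component E S x)" "conn E (component E S y)"
    using conn_component[OF sym_E] xy S by auto
  moreover have "apart E (component E S x) (component E S y)"
    using component_apart xy S by blast
  moreover have "component E S x \<subseteq> S" "component E S y \<subseteq> S" by (rule component_subset)+
  moreover have "apart E {a} {b, c, d, v} \<and> apart E {b} {c, d, v} \<and> apart E {c} {d, v} \<and> apart E {d} {v}"
    using m by (simp add: model_def)
  moreover have "touch E {a} (component E S x) \<and> touch E {b} (component E S x) \<and> touch E {v} (component E S x)"
    "touch E {c} (component E S y) \<and> touch E {d} (component E S y) \<and> touch E {v} (component E S y)"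
    using m t[OF _ sub(1)] t[OF _ sub(2)] by (simp_all add: model_def)
  moreover have "component E S x \<subseteq> V" "component E S y \<subseteq> V"
    "{a, b, v} \<inter> component E S x = {}" "{c, d, v} \<inter> component E S y = {}"
    using calculation(4,5) S by auto
  ultimately show ?thesis using assms(9,10) unfolding model_def by simp
qed

lemma model_in_V:
  assumes "model a b c d v X Y"
  shows "{a, b, c, d, v} \<subseteq> V"
  using assms E_subset by (auto simp: model_def touch_def)

text \<open>Exempting \<open>Y\<close> and deleting the rest of the closed neighbourhood of
  \<open>{c, d} \<union> Y\<close> cuts \<open>Y\<close> off: its component cannot grow beyond
  \<open>Y\<close>, and all other surviving vertices are nonadjacent to \<open>c\<close> and
  \<open>d\<close>.\<close>

lemma criterion_if_small:
  assumes m: "model a b c d v X Y" and small: "card Y \<le> 3"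
  shows criterion
proof -
  define F where "F = {c, d} \<union> Y"
  define S where "S = free_set Y F {a, b, c, d, v}"
  obtain x y where xy: "x \<in> X" "y \<in> Y" using m by (auto simp: model_def conn_def)
  have XS: "X \<subseteq> S" "Y \<subseteq> S" "S \<subseteq> V" "{a, b, c, d, v} \<inter> S = {}"
    using m unfolding S_def F_def free_set_def model_def apart_def by (auto dest: adj_sym)
  have cl: "w \<in> Y" if "u \<in> Y" "(u, w) \<in> E" "w \<in> S" for u w
    using that by (auto simp: S_def F_def free_set_def apart_def)
  have Yc: "component E S y \<subseteq> Y"
  proof
    fix z assume "z \<in> component E S y"
    then have "(y, z) \<in> (Restr E S)\<^sup>*" by (auto simp: component_def)
    then show "z \<in> Y" by (induction rule: rtrancl_induct) (use cl xy in auto)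
  qed
  have Xc: "component E S x \<inter> Y = {}"
  proof (rule ccontr)
    assume "component E S x \<inter> Y \<noteq> {}"
    then obtain z where z: "z \<in> Y" "z \<in> component E S x" by auto
    have "x \<notin> Y" "x \<in> component E S x" using m xy XS by (auto simp: model_def apart_def intro: component_refl)
    then obtain u w where "u \<in> component E S x" "u \<in> Y" "w \<in> component E S x" "w \<notin> Y" "(u, w) \<in> E"
      using conn_boundary[OF conn_component[OF sym_E, of x S] z(2,1), of x] xy XS by blast
    then show False using cl[of u w] component_subset[of E S x] by auto
  qed
  have "apart E {c, d} (component E S x)"
    using Xc component_subset[of E S x] by (auto simp: S_def F_def free_set_def apart_def)
  moreover have "apart E {a, b} (component E S y)"
    using Yc m by (auto simp: model_def apart_def)
  ultimately have "model a b c d v (component E S x) (component E S y)"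
    using model_component[OF m XS xy] Xc xy by blast
  moreover have "card F \<le> 5"
    using small card_Un_le[of "{c, d}" Y] card_insert_le_m1[of 2 "{d}" c] unfolding F_def by simp
  moreover have "Y \<subseteq> V" "F \<subseteq> V" "Y \<noteq> {}" "F \<noteq> {}"
    using m model_in_V[OF m] xy unfolding F_def by (auto simp: model_def)
  moreover have "card Y \<le> 5" "x \<in> S" "y \<in> S" "y \<notin> component E S x" using small xy XS Xc by auto
  ultimately show ?thesis unfolding criterion_def Let_def S_def by (intro exI conjI)
qed


lemma touch_path_segment:
  assumes "induced_path E x k" "0 < i" "i < k"
  shows "touch E {x i} (x ` {..<i})"
  using assms induced_path_adj_iff[OF assms(1), of i "i - 1"]
  by (auto simp: touch_def intro!: bexI[of _ "i - 1"])

text \<open>The remaining case of a minimal model: \<open>X\<close> is a path from the only neighbour of \<open>v\<close> to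
  the only neighbour of \<open>b\<close>. Let \<open>x i\<close> be the first neighbour of \<open>a\<close>. Then either at most three
  vertices of \<open>X\<close> follow, or \<open>{a, q}\<close> with \<open>q\<close> the end of the path can serve as a branching bag.\<close>
lemma model_leaf_fan:
  assumes m: "model a b c d v X Y"
    and path: "induced_path E x k" "X = x ` {..<k}" "3 < k"
    and v: "\<And>i. i < k \<Longrightarrow> (v, x i) \<in> E \<longleftrightarrow> i = 0"
    and b: "\<And>i. i < k \<Longrightarrow> (b, x i) \<in> E \<longleftrightarrow> i = k - 1"
    and a: "(a, x (k - 1)) \<in> E"
  obtains a' b' c' d' v' X' Y' where "model a' b' c' d' v' X' Y'" "card X' \<le> 3"
proof -
  \<comment> \<open>The opposite side of the new models: the old centre \<open>v\<close> joins
    \<open>Y\<close> and brings along an initial piece of the path.\<close>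
  define Z where "Z j = insert v Y \<union> x ` {..<j}" for j
  note m' = m[unfolded model_def]
  note xadj = induced_path_adj_iff[OF path(1)] and xeq = induced_path_eq_iff[OF path(1)]
  have mem: "x i \<in> X" if "i < k" for i using path that by auto
  have out: "x i \<noteq> a" "x i \<noteq> b" "x i \<noteq> c" "x i \<noteq> d" "x i \<noteq> v" "x i \<notin> Y"
      "(x i, c) \<notin> E" "(x i, d) \<notin> E" "(c, x i) \<notin> E" "(d, x i) \<notin> E" if "i < k" for i
    using m' mem[OF that] adj_commute[of "x i"] by (auto simp: apart_def)
  note nout = out(1-5)[THEN not_sym]
  have outY: "y \<noteq> x i" "(x i, y) \<notin> E" "(y, x i) \<notin> E" if "i < k" "y \<in> Y" for i y
    using m' mem[OF that(1)] that(2) adj_commute[of "x i"] by (auto simp: apart_def)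
  have abY: "(a, y) \<notin> E" "(b, y) \<notin> E" "(y, a) \<notin> E" "(y, b) \<notin> E" "a \<noteq> y" "b \<noteq> y" "c \<noteq> y" "d \<noteq> y" "v \<noteq> y" if "y \<in> Y" for y
    using m' that adj_commute[of y] by (auto simp: apart_def)
  have notY: "a \<notin> Y" "b \<notin> Y" "c \<notin> Y" "d \<notin> Y" "v \<notin> Y" using abY by blast+
  have lv: "a \<noteq> b" "a \<noteq> c" "a \<noteq> d" "a \<noteq> v" "b \<noteq> c" "b \<noteq> d" "b \<noteq> v" "c \<noteq> d" "c \<noteq> v" "d \<noteq> v"
    "(a, b) \<notin> E" "(a, c) \<notin> E" "(a, d) \<notin> E" "(a, v) \<notin> E" "(b, c) \<notin> E" "(b, d) \<notin> E" "(b, v) \<notin> E"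
    "(c, d) \<notin> E" "(c, v) \<notin> E" "(d, v) \<notin> E"
    "(b, a) \<notin> E" "(c, a) \<notin> E" "(d, a) \<notin> E" "(v, a) \<notin> E" "(c, b) \<notin> E" "(d, b) \<notin> E" "(v, b) \<notin> E"
    "(d, c) \<notin> E" "(v, c) \<notin> E" "(v, d) \<notin> E"
    using m' adj_commute by (auto simp: apart_def)
  have vx: "(x i, v) \<in> E \<longleftrightarrow> i = 0" "(x i, b) \<in> E \<longleftrightarrow> i = k - 1" if "i < k" for i
    using v b that adj_commute by auto
  have "conn E (insert v Y)"
    using m' by (intro conn_insert sym_E) auto
  have Zconn: "conn E (Z j)" if "j \<le> k" for j
  proof (cases "j = 0")
    case True then show ?thesis using \<open>conn E (insert v Y)\<close> by (simp add: Z_def)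
  next
    case False
    then have "conn E (x ` {..<j})"
      using conn_induced_path[OF sym_E path(1), of 0 j] that by (simp add: atLeast0LessThan)
    moreover have "touch E (insert v Y) (x ` {..<j})"
      using False v[of 0] path(3) by (auto simp: touch_def)
    ultimately show ?thesis
      unfolding Z_def using conn_Un[OF sym_E \<open>conn E (insert v Y)\<close>] by blast
  qed
  have Ztouch: "touch E {x j} (Z j)" if "j < k" for j
  proof (cases "j = 0")
    case True then show ?thesis using vx(1)[of 0] path(3) by (auto simp: touch_def Z_def)
  next
    case False
    then show ?thesis using touch_path_segment[OF path(1) _ that] by (auto simp: touch_def Z_def)
  qed
  have ZV: "Z j \<subseteq> V" if "j \<le> k" for j
    using model_in_V[OF m] m' mem that by (auto simp: Z_def)
  have Zcd: "touch E {c} (Z j)" "touch E {d} (Z j)" for j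
    using m' by (auto simp: touch_def Z_def)
  define i where "i = (LEAST i. (a, x i) \<in> E)"
  have ai: "(a, x i) \<in> E" unfolding i_def using a by (rule LeastI)
  have "i \<le> k - 1" unfolding i_def using a by (rule Least_le)
  then have ik: "i < k" using path(3) by simp
  have first: "(a, x j) \<notin> E" "(x j, a) \<notin> E" if "j < i" for j
    using not_less_Least[of j "\<lambda>i. (a, x i) \<in> E"] that adj_commute unfolding i_def by auto
  show ?thesis
  proof (cases "k \<le> i + 3")
    case True
    \<comment> \<open>The vertex before the first neighbour of \<open>a\<close> becomes the centre,
      and the path from that neighbour on, at most three vertices, becomes the side. The predecessor
      exists because \<open>k > 3\<close>.\<close>
    then obtain l where l: "i = Suc l" using path(3) by (cases i) auto
    then have lk: "l < k" "l < i" "l \<noteq> k - 1" using ik by auto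
    let ?X = "x ` {i..<k}"
    have "card ?X \<le> 3" using True card_image_le[of "{i..<k}" x] by simp
    moreover have "model a b c d (x l) ?X (Z l)"
    proof -
      have "touch E {a} ?X" "touch E {b} ?X"
        using ai b[of "k - 1"] ik by (auto simp: touch_def)
      moreover have "touch E {x l} ?X"
        using xadj[OF lk(1) ik] ik l by (auto simp: touch_def intro!: bexI[of _ i])
      moreover have "conn E ?X" using conn_induced_path[OF sym_E path(1) ik] by simp
      moreover have "apart E {x j} (Z l)" if j: "i \<le> j" "j < k" for j
      proof -
        have "x j \<noteq> x l' \<and> (x j, x l') \<notin> E" if "l' < l" for l'
        proof -
          have "j \<noteq> l'" "l' \<noteq> Suc j" "j \<noteq> Suc l'" "l' < k" using that j l by linarith+
          then show ?thesis using xadj[OF j(2)] xeq[OF j(2)] by blast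
        qed
        moreover have "x j \<noteq> v" "(x j, v) \<notin> E" using j l vx out nout by auto
        ultimately show ?thesis using j outY by (auto simp: apart_def Z_def)
      qed
      then have "apart E ?X (Z l)" by (auto simp: apart_def)
      moreover have "apart E {a} {b, c, d, x l}" "apart E {b} {c, d, x l}" "apart E {c} {d, x l}" "apart E {d} {x l}"
        using lv first[OF lk(2)] b[OF lk(1)] lk(3) out[OF lk(1)] by (auto simp: apart_def)
      moreover have "apart E {c, d} ?X" using out nout by (auto simp: apart_def)
      moreover have "a \<noteq> x l' \<and> b \<noteq> x l' \<and> (a, x l') \<notin> E \<and> (b, x l') \<notin> E" if "l' < l" for l'
      proof -
        have "l' < i" "l' < k" "l' \<noteq> k - 1" using that lk by linarith+
        then show ?thesis using first[of l'] b[of l'] out[of l'] by auto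
      qed
      then have "apart E {a, b} (Z l)"
        using abY notY lv by (auto simp: apart_def Z_def)
      moreover have "x l \<noteq> x j" if "i \<le> j" "j < k" for j
        using xeq[OF lk(1) that(2)] lk(2) that(1) by auto
      then have "{a, b, x l} \<inter> ?X = {}" using out nout by (auto simp: image_iff)
      moreover have "c \<noteq> x l' \<and> d \<noteq> x l' \<and> x l \<noteq> x l'" if "l' < l" for l'
      proof -
        have "l' < k" using that lk by linarith
        then show ?thesis using xeq[OF lk(1), of l'] that out[of l'] by auto
      qed
      then have "{c, d, x l} \<inter> Z l = {}"
        using out[OF lk(1)] lv abY notY by (auto simp: Z_def)
      moreover have "?X \<subseteq> V" using m' mem by auto
      moreover have "touch E {x l} (Z l)" "conn E (Z l)" "Z l \<subseteq> V"
        using Ztouch Zconn ZV lk by auto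
      ultimately show ?thesis using Zcd by (simp add: model_def)
    qed
    ultimately show ?thesis using that by blast
  next
    case False
    \<comment> \<open>The new side is \<open>{a, q}\<close>, with leaves \<open>b\<close> and the
      predecessor \<open>p\<close> of \<open>q\<close>, and with centre \<open>x i\<close>. As
      \<open>i + 3 < k\<close>, the vertices up to \<open>x i\<close> are nonadjacent to
      \<open>p\<close> and \<open>q\<close>.\<close>
    define q p where "q = x (k - 1)" and "p = x (k - 2)"
    have lt: "k - 1 < k" "k - 2 < k" "k - 2 \<noteq> k - 1" "k - 1 = Suc (k - 2)" using path(3) by auto
    note out1 = out[OF lt(1), folded q_def] outY[OF lt(1), folded q_def]
      and out2 = out[OF lt(2), folded p_def] outY[OF lt(2), folded p_def]
      and b' = b[OF lt(1), folded q_def] b[OF lt(2), folded p_def]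
    have far: "x j \<noteq> p" "x j \<noteq> q" "(x j, p) \<notin> E" "(x j, q) \<notin> E" "(p, x j) \<notin> E" "(q, x j) \<notin> E"
      "(b, x j) \<notin> E" "b \<noteq> x j" if "j \<le> i" for j
    proof -
      have j: "j < k" "j \<noteq> k - 1" "j \<noteq> k - 2" "k - 1 \<noteq> Suc j" "k - 2 \<noteq> Suc j" "j \<noteq> Suc (k - 1)" "j \<noteq> Suc (k - 2)"
        using that ik False by linarith+
      show "x j \<noteq> p" "x j \<noteq> q" "(x j, p) \<notin> E" "(x j, q) \<notin> E" "(p, x j) \<notin> E" "(q, x j) \<notin> E"
        "(b, x j) \<notin> E" "b \<noteq> x j"
        using j xadj[OF j(1) lt(1)] xadj[OF j(1) lt(2)] xeq[OF j(1) lt(1)] xeq[OF j(1) lt(2)]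
          xadj[OF lt(1) j(1)] xadj[OF lt(2) j(1)] b[OF j(1)] out(2)[OF j(1)] by (auto simp: q_def p_def)
    qed
    have pq: "(p, q) \<in> E" "p \<noteq> q" "(b, p) \<notin> E" "(p, b) \<notin> E" "(b, q) \<in> E" "(p, v) \<notin> E" "(q, v) \<notin> E"
      using xadj[OF lt(2,1)] xeq[OF lt(2,1)] lt b' vx[OF lt(2)] vx[OF lt(1)] path(3) by (auto simp: q_def p_def)
    have img: "a \<notin> x ` {..<i}" "b \<notin> x ` {..<i}" "c \<notin> x ` {..<i}" "d \<notin> x ` {..<i}" "v \<notin> x ` {..<i}"
    proof -
      have "x ` {..<i} \<subseteq> X" using mem ik by auto
      moreover have "a \<notin> X" "b \<notin> X" "c \<notin> X" "d \<notin> X" "v \<notin> X" using m' by (auto simp: apart_def)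
      ultimately show "a \<notin> x ` {..<i}" "b \<notin> x ` {..<i}" "c \<notin> x ` {..<i}" "d \<notin> x ` {..<i}" "v \<notin> x ` {..<i}"
        by blast+
    qed
    have "card {a, q} \<le> 3" by (simp add: card_insert_if)
    moreover have "model p b c d (x i) {a, q} (Z i)"
    proof -
      have "touch E {p} {a, q}" "touch E {b} {a, q}" "touch E {x i} {a, q}"
        using ai adj_commute[of a] pq by (auto simp: touch_def)
      moreover have "conn E {a, q}" using a by (intro conn_insert[OF sym_E conn_singleton]) (auto simp: touch_def q_def)
      moreover have "apart E {a, q} (Z i)"
      proof -
        have "apart E {a, q} Y" "apart E {a, q} {v}" "apart E {a} (x ` {..<i})"
          using out1 pq(7) abY notY lv first img by (auto simp: apart_def)
        moreover have "apart E {q} (x ` {..<i})"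
          using far(6) far(2)[THEN not_sym] by (simp add: apart_def)
        ultimately show ?thesis by (simp add: apart_def Z_def ball_Un)
      qed
      moreover have "apart E {p} {b, c, d, x i}"
        using pq far[of i] out2 by (auto simp: apart_def)
      moreover have "apart E {b} {c, d, x i}" "apart E {c} {d, x i}" "apart E {d} {x i}"
        using lv far[of i] out[OF ik] by (auto simp: apart_def)
      moreover have "apart E {c, d} {a, q}" using lv out1 by (auto simp: apart_def)
      moreover have "apart E {p, b} Y" "apart E {p, b} {v}"
        using abY out2 lv pq by (auto simp: apart_def)
      then have "apart E {p, b} (Z i)"
        using far(5,7,8) far(1)[THEN not_sym] by (simp add: apart_def Z_def ball_Un)
      moreover have "{p, b, x i} \<inter> {a, q} = {}"
        using out2 out1 out[OF ik] lv far[of i] pq by auto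
      moreover have "x i \<noteq> x l" if "l < i" for l using xeq[OF ik, of l] ik that by auto
      then have "{c, d, x i} \<inter> Z i = {}"
        using out[OF ik] lv abY notY img by (auto simp: Z_def)
      moreover have "{a, q} \<subseteq> V" using model_in_V[OF m] m' mem lt by (auto simp: q_def)
      moreover have "touch E {x i} (Z i)" "conn E (Z i)" "Z i \<subseteq> V"
        using Ztouch Zconn ZV ik by auto
      ultimately show ?thesis using Zcd by (simp add: model_def)
    qed
    ultimately show ?thesis using that by blast
  qed
qed


section \<open>Models of minimum total size\<close>

definition nbs where "nbs s X = {u \<in> X. (s, u) \<in> E}"

text \<open>The minimum ranges over all models, including those with other leaves and another
  centre, so that exchanges of these vertices can contradict it.\<close>

definition minimal_model where
  "minimal_model a b c d v X Y \<longleftrightarrow> model a b c d v X Y \<and>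
     (\<forall>a' b' c' d' v' X' Y'. model a' b' c' d' v' X' Y' \<longrightarrow> card X + card Y \<le> card X' + card Y')"

lemma minimal_model_swap_sides: "minimal_model a b c d v X Y \<Longrightarrow> minimal_model c d a b v Y X"
  unfolding minimal_model_def using model_swap_sides by (metis add.commute)

lemma minimal_model_swap_leaves: "minimal_model a b c d v X Y \<Longrightarrow> minimal_model b a c d v X Y"
  unfolding minimal_model_def using model_swap_leaves by blast

lemma minimal_no_smaller_side:
  assumes "minimal_model a b c d v X Y" "p \<in> X"
  shows "\<not> model a' b' c' d' v' (X - {p}) Y"
proof
  assume "model a' b' c' d' v' (X - {p}) Y"
  then have "card X + card Y \<le> card (X - {p}) + card Y"
    using assms(1) unfolding minimal_model_def by blast
  moreover have "card (X - {p}) < card X"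
    using assms finite_model(1) by (intro card_Diff1_less) (auto simp: minimal_model_def)
  ultimately show False by simp
qed

text \<open>Otherwise \<open>X - {w}\<close> would still touch each of \<open>a\<close>,
  \<open>b\<close>, \<open>v\<close> and give a smaller model.\<close>

lemma minimal_noncut:
  assumes mm: "minimal_model a b c d v X Y" and w: "w \<in> X" "conn E (X - {w})"
  obtains s where "s \<in> {a, b, v}" "nbs s X = {w}"
proof -
  have m: "model a b c d v X Y" using mm by (simp add: minimal_model_def)
  have "touch E {s} (X - {w})" if "touch E {s} X" "nbs s X \<noteq> {w}" for s
    using that by (fastforce simp: touch_def nbs_def)
  moreover have "\<not> (touch E {a} (X - {w}) \<and> touch E {b} (X - {w}) \<and> touch E {v} (X - {w}))"
  proof
    assume t: "touch E {a} (X - {w}) \<and> touch E {b} (X - {w}) \<and> touch E {v} (X - {w})"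
    have "apart E (X - {w}) Y" "apart E {c, d} (X - {w})" "{a, b, v} \<inter> (X - {w}) = {}" "X - {w} \<subseteq> V"
      using m by (auto simp: model_def apart_def)
    then have "model a b c d v (X - {w}) Y" using m w t by (simp add: model_def)
    then show False using minimal_no_smaller_side[OF mm w(1)] by blast
  qed
  moreover have "touch E {a} X" "touch E {b} X" "touch E {v} X" using m by (simp_all add: model_def)
  ultimately show ?thesis using that[of a] that[of b] that[of v] by blast
qed

text \<open>The vertex \<open>p\<close> can be split off as a leaf in place of \<open>a\<close>: the
  vertices \<open>b\<close> and \<open>v\<close> are attached elsewhere, so they are nonadjacent to
  \<open>p\<close> and keep their contact with \<open>X - {p}\<close>.\<close>

lemma minimal_not_all_unique:
  assumes mm: "minimal_model a b c d v X Y"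
    and "nbs a X = {p}" "nbs b X = {q}" "nbs v X = {r}" "p \<noteq> q" "p \<noteq> r" "conn E (X - {p})"
  shows False
proof -
  have m: "model a b c d v X Y" using mm by (simp add: minimal_model_def)
  have p: "p \<in> X" "q \<in> X" "r \<in> X" "(b, q) \<in> E" "(v, r) \<in> E" "(b, p) \<notin> E" "(v, p) \<notin> E"
    using assms(2-6) by (auto simp: nbs_def)
  have "model p b c d v (X - {p}) Y"
  proof (rule model_shrink_leaf[OF m p(1) assms(7)])
    show "X \<noteq> {p}" using p assms by auto
    show "apart E {p} {b, v}" "apart E {v} {b, c, d}" "v \<notin> X" "v \<notin> Y"
      using p m adj_commute by (auto simp: model_def apart_def)
    show "touch E {b} (X - {p})" "touch E {v} (X - {p})" using p assms(5,6) by (auto simp: touch_def)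
    show "touch E {v} Y" using m by (simp add: model_def)
  qed
  then show False using minimal_no_smaller_side[OF mm p(1)] by blast
qed

text \<open>By \<open>minimal_noncut\<close>, a noncut vertex is the only neighbour in
  \<open>X\<close> of one of \<open>a\<close>, \<open>b\<close>, \<open>v\<close>. There are two
  noncut vertices; if an induced path between them missed part of \<open>X\<close>, there would be a
  third one off the path, and all of \<open>a\<close>, \<open>b\<close>, \<open>v\<close> would have
  private neighbours, against \<open>minimal_not_all_unique\<close>.\<close>

lemma minimal_path:
  assumes mm: "minimal_model a b c d v X Y" and "2 \<le> card X"
  obtains x k s t where "induced_path E x k" "X = x ` {..<k}" "s \<in> {a, b, v}" "t \<in> {a, b, v}" "s \<noteq> t"
    "nbs s X = {x 0}" "nbs t X = {x (k - 1)}" "conn E (X - {x 0})" "conn E (X - {x (k - 1)})"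
proof -
  have m: "model a b c d v X Y" using mm by (simp add: minimal_model_def)
  have X: "conn E X" "finite X" using m finite_model[OF m] by (auto simp: model_def)
  obtain x0 where x0: "x0 \<in> X" using X by (auto simp: conn_def)
  have ne: "X \<noteq> {z}" for z using assms(2) by auto
  then have "{x0} \<subset> X" using x0 by auto
  then obtain p where p: "p \<in> X" "conn E (X - {p})"
    using ex_noncut_vertex[OF sym_E X(2,1) conn_singleton] by metis
  then have "{p} \<subset> X" using ne by auto
  \<comment> \<open>Growing from the connected set \<open>{p}\<close> yields a noncut vertex
    different from \<open>p\<close>.\<close>
  then obtain q where q: "q \<in> X" "q \<noteq> p" "conn E (X - {q})"
    using ex_noncut_vertex[OF sym_E X(2,1) conn_singleton] by (metis singletonI)
  obtain s where s: "s \<in> {a, b, v}" "nbs s X = {p}" using minimal_noncut[OF mm p] .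
  obtain t where t: "t \<in> {a, b, v}" "nbs t X = {q}" using minimal_noncut[OF mm q(1,3)] .
  obtain x k where x: "induced_path E x k" "x ` {..<k} \<subseteq> X" "0 < k" "x 0 = p" "x (k - 1) = q"
    using ex_induced_path[OF X(1) sym_E irrefl_E p(1) q(1)] .
  have "X = x ` {..<k}"
  proof (rule ccontr)
    assume "X \<noteq> x ` {..<k}"
    moreover have "conn E (x ` {..<k})"
      using conn_induced_path[OF sym_E x(1), of 0 k] x(3) by (simp add: atLeast0LessThan)
    ultimately obtain r where r: "r \<in> X" "r \<notin> x ` {..<k}" "conn E (X - {r})"
      using ex_noncut_vertex[OF sym_E X(2,1)] x(2) by (metis psubsetI)
    then have ne: "r \<noteq> p" "r \<noteq> q" using x(3-5) by force+
    obtain u where u: "u \<in> {a, b, v}" "nbs u X = {r}" using minimal_noncut[OF mm r(1,3)] .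
    have "s \<noteq> t" "s \<noteq> u" "t \<noteq> u" using s t u ne q(2) by auto
    then have "{a, b, v} = {s, t, u}" using s(1) t(1) u(1) by auto
    moreover have "\<exists>z. nbs w X = {z} \<and> conn E (X - {z})" if "w \<in> {s, t, u}" for w
      using that s t u p q r by auto
    moreover have "nbs w X \<noteq> nbs w' X" if "w \<in> {s, t, u}" "w' \<in> {s, t, u}" "w \<noteq> w'" for w w'
      using that s t u ne q(2) by auto
    moreover have "a \<noteq> b" "a \<noteq> v" using m by (auto simp: model_def apart_def)
    ultimately obtain za zb zv where "nbs a X = {za}" "nbs b X = {zb}" "nbs v X = {zv}"
      "conn E (X - {za})" "za \<noteq> zb" "za \<noteq> zv"
      by (metis insertI1 insertI2)
    then show False using minimal_not_all_unique[OF mm] by blast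
  qed
  moreover have "s \<noteq> t" using s t q by auto
  ultimately show ?thesis using that[of x k s t] x s t p q by simp
qed

text \<open>What remains after \<open>minimal_path\<close> is to exclude that one end of the path is
  the private neighbour of the centre \<open>v\<close>. In that case the other end is private to one
  leaf, and the other leaf leads to \<open>model_leaf_fan\<close>, hence to a side that is too
  small.\<close>

lemma minimal_path_leaves:
  assumes mm: "minimal_model a b c d v X Y"
    and big: "\<And>a b c d v X Y. model a b c d v X Y \<Longrightarrow> 3 < card X"
  obtains x k where "induced_path E x k" "X = x ` {..<k}" "3 < k" "nbs a X = {x 0}" "nbs b X = {x (k - 1)}"
proof -
  have m: "model a b c d v X Y" using mm by (simp add: minimal_model_def)
  have no_fan: False if mm: "minimal_model a b c d v X Y"
    and x: "induced_path E x k" "X = x ` {..<k}" "nbs v X = {x 0}" "nbs b X = {x (k - 1)}" "conn E (X - {x (k - 1)})"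
    for a b x k
  proof -
    let ?q = "x (k - 1)"
    have m: "model a b c d v X Y" using mm by (simp add: minimal_model_def)
    have k: "3 < k" using big[OF m] x(1,2) by (simp add: induced_path_def card_image)
    have nv: "(v, u) \<in> E \<longleftrightarrow> u = x 0" and nb: "(b, u) \<in> E \<longleftrightarrow> u = ?q" if "u \<in> X" for u
      using x(3,4) that by (auto simp: nbs_def)
    have q: "?q \<in> X" "x 0 \<in> X" "x 0 \<noteq> ?q" "(b, ?q) \<in> E" "(v, x 0) \<in> E" "(v, ?q) \<notin> E" "(b, x 0) \<notin> E"
    proof -
      show q: "?q \<in> X" "x 0 \<in> X" "x 0 \<noteq> ?q"
        using k x(2) induced_path_eq_iff[OF x(1), of 0 "k - 1"] by auto
      show "(b, ?q) \<in> E" "(v, x 0) \<in> E" "(v, ?q) \<notin> E" "(b, x 0) \<notin> E"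
        using nv[OF q(1)] nv[OF q(2)] nb[OF q(1)] nb[OF q(2)] q(3) by auto
    qed
    have "(a, ?q) \<in> E"
    proof (rule ccontr)
      assume na: "(a, ?q) \<notin> E"
      \<comment> \<open>If \<open>a\<close> misses the end \<open>?q\<close>, that vertex can be
        split off and replace the leaf \<open>b\<close>. The leaves are swapped because
        \<open>model_shrink_leaf\<close> replaces the first one.\<close>
      have "model ?q a c d v (X - {?q}) Y"
      proof (rule model_shrink_leaf[OF model_swap_leaves[OF m] q(1) x(5)])
        show "X \<noteq> {?q}" using q by auto
        show "apart E {?q} {a, v}" "apart E {v} {a, c, d}" "v \<notin> X" "v \<notin> Y"
          using q na m adj_commute by (auto simp: model_def apart_def)
        show "touch E {a} (X - {?q})" using na m by (auto simp: model_def touch_def)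
        show "touch E {v} (X - {?q})" using q by (auto simp: touch_def)
        show "touch E {v} Y" using m by (simp add: model_def)
      qed
      then show False using minimal_no_smaller_side[OF mm q(1)] by blast
    qed
    moreover have "(v, x i) \<in> E \<longleftrightarrow> i = 0" "(b, x i) \<in> E \<longleftrightarrow> i = k - 1" if "i < k" for i
    proof -
      have "x i \<in> X" using that x(2) by auto
      then show "(v, x i) \<in> E \<longleftrightarrow> i = 0" "(b, x i) \<in> E \<longleftrightarrow> i = k - 1"
        using induced_path_eq_iff[OF x(1) that] k nv nb by auto
    qed
    ultimately show False
      using model_leaf_fan[OF m x(1,2) k] big by (metis not_less)
  qed
  have two: "2 \<le> card X" using big[OF m] by simp
  obtain x k s t where x: "induced_path E x k" "X = x ` {..<k}"
    and st: "s \<in> {a, b, v}" "t \<in> {a, b, v}" "s \<noteq> t"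
    "nbs s X = {x 0}" "nbs t X = {x (k - 1)}" "conn E (X - {x 0})" "conn E (X - {x (k - 1)})"
    using minimal_path[OF mm two] .
  have k: "3 < k" using big[OF m] x by (simp add: induced_path_def card_image)
  \<comment> \<open>The reversed path serves the cases in which the two ends belong to the vertices
    in the opposite order.\<close>
  define y where "y i = x (k - 1 - i)" for i
  have y: "induced_path E y k" using induced_path_rev[OF x(1)] by (simp add: y_def[abs_def])
  have y0: "y 0 = x (k - 1)" "y (k - 1) = x 0" using k by (auto simp: y_def)
  have "(\<lambda>i. k - 1 - i) ` {..<k} = {..<k}"
  proof
    show "{..<k} \<subseteq> (\<lambda>i. k - 1 - i) ` {..<k}"
    proof
      fix i assume "i \<in> {..<k}"
      then show "i \<in> (\<lambda>i. k - 1 - i) ` {..<k}" by (intro image_eqI[of _ _ "k - 1 - i"]) auto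
    qed
  qed (use k in auto)
  moreover have "y ` {..<k} = x ` (\<lambda>i. k - 1 - i) ` {..<k}" by (simp add: y_def image_image)
  ultimately have yX: "X = y ` {..<k}" using x(2) by simp
  note mm' = minimal_model_swap_leaves[OF mm]
  consider "s = a" "t = b" | "s = b" "t = a" | "s = v" "t = b" | "s = v" "t = a" | "s = b" "t = v" | "s = a" "t = v"
    using st(1-3) by auto
  then show ?thesis
  proof cases
    case 1 then show ?thesis using that[OF x k] st by auto
  next
    case 2 then show ?thesis using that[OF y yX k] st y0 by auto
  next
    case 3 then show ?thesis using no_fan[OF mm x] st by auto
  next
    case 4 then show ?thesis using no_fan[OF mm' x] st by auto
  next
    case 5 then show ?thesis using no_fan[OF mm y yX] st y0 by auto
  next
    case 6 then show ?thesis using no_fan[OF mm' y yX] st y0 by auto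
  qed
qed


text \<open>The components that are found may be larger than \<open>X\<close> and \<open>Y\<close>.
  Two facts carry the proof: the deletion spares \<open>X\<close> and \<open>Y\<close> entirely, and
  \<open>S\<close> contains no connection between them.\<close>

lemma criterion_if_model:
  assumes "model a0 b0 c0 d0 v0 X0 Y0"
  shows criterion
proof (rule ccontr)
  assume no: "\<not> criterion"
  then have bigY: "3 < card Y" if "model a b c d v X Y" for a b c d v X Y
    using criterion_if_small that by (meson not_less)
  then have bigX: "3 < card X" if "model a b c d v X Y" for a b c d v X Y
    using model_swap_sides that by blast
  define sz where "sz = (\<lambda>(a :: 'a, b :: 'a, c :: 'a, d :: 'a, v :: 'a, X :: 'a set, Y :: 'a set). card X + card Y)"
  obtain t where t: "(\<lambda>(a, b, c, d, v, X, Y). model a b c d v X Y) t"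
    "\<And>t'. (\<lambda>(a, b, c, d, v, X, Y). model a b c d v X Y) t' \<Longrightarrow> sz t \<le> sz t'"
    using ex_has_least_nat[of "\<lambda>(a, b, c, d, v, X, Y). model a b c d v X Y" "(a0, b0, c0, d0, v0, X0, Y0)" sz] assms
    by blast
  obtain a b c d v X Y where "t = (a, b, c, d, v, X, Y)" by (cases t)
  then have mm: "minimal_model a b c d v X Y"
    using t(1) t(2)[of "(a', b', c', d', v', X', Y')" for a' b' c' d' v' X' Y']
    by (auto simp: minimal_model_def sz_def)
  then have m: "model a b c d v X Y" by (simp add: minimal_model_def)
  note m' = m[unfolded model_def]
  obtain x k where x: "induced_path E x k" "X = x ` {..<k}" "3 < k" "nbs a X = {x 0}" "nbs b X = {x (k - 1)}"
    using minimal_path_leaves[OF mm bigX] .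
  obtain y l where y: "induced_path E y l" "Y = y ` {..<l}" "3 < l" "nbs c Y = {y 0}" "nbs d Y = {y (l - 1)}"
    using minimal_path_leaves[OF minimal_model_swap_sides[OF mm] bigX] .
  have na: "(a, u) \<in> E \<longleftrightarrow> u = x 0" and nb: "(b, u) \<in> E \<longleftrightarrow> u = x (k - 1)" if "u \<in> X" for u
    using x(4,5) that by (auto simp: nbs_def)
  have nc: "(c, u) \<in> E \<longleftrightarrow> u = y 0" and nd: "(d, u) \<in> E \<longleftrightarrow> u = y (l - 1)" if "u \<in> Y" for u
    using y(4,5) that by (auto simp: nbs_def)
  have xX: "x i \<in> X" if "i < k" for i using x(2) that by auto
  have yY: "y i \<in> Y" if "i < l" for i using y(2) that by auto
  \<comment> \<open>\<open>W\<close> consists of the vertices of \<open>X\<close> and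
    \<open>Y\<close> in the closed neighbourhood of \<open>F\<close>: \<open>x 0\<close> itself,
    which is also the contact of \<open>a\<close>, its successor \<open>x 1\<close>, and the
    contacts \<open>x (k - 1)\<close>, \<open>y 0\<close>, \<open>y (l - 1)\<close> of
    \<open>b\<close>, \<open>c\<close>, \<open>d\<close>.\<close>
  define F W S where "F = {a, b, c, d, x 0}" and "W = {x 0, x 1, x (k - 1), y 0, y (l - 1)}"
    and "S = free_set W F {a, b, c, d, v}"
  have ends: "x 0 \<in> X" "x 1 \<in> X" "x (k - 1) \<in> X" "y 0 \<in> Y" "y (l - 1) \<in> Y"
    using x(3) y(3) by (auto intro!: xX yY)
  have lvX: "s \<notin> X" "s \<notin> Y" if "s \<in> {a, b, c, d, v}" for s
    using m' that by (auto simp: apart_def)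
  have XY: "p \<noteq> q \<and> (p, q) \<notin> E \<and> (q, p) \<notin> E" if "p \<in> X" "q \<in> Y" for p q
    using m' that adj_commute[of q p] by (auto simp: apart_def)
  have abY: "(a, u) \<notin> E" "(b, u) \<notin> E" "(u, a) \<notin> E" "(u, b) \<notin> E" if "u \<in> Y" for u
    using m' that adj_commute[of u] by (auto simp: apart_def)
  have cdX: "(c, u) \<notin> E" "(d, u) \<notin> E" "(u, c) \<notin> E" "(u, d) \<notin> E" if "u \<in> X" for u
    using m' that adj_commute[of u] by (auto simp: apart_def)
  have lvs: "apart E {a} {b, c, d, v}" "apart E {b} {c, d, v}" "apart E {c} {d, v}" "apart E {d} {v}"
    using m' by simp_all
  have X1: "conn E (X - {x 0})"
  proof -
    have "X - {x 0} = x ` {1..<k}"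
    proof -
      have "{..<k} = insert 0 {1..<k}" using x(3) by auto
      then have "X = insert (x 0) (x ` {1..<k})" using x(2) by (metis image_insert)
      moreover have "x j \<noteq> x 0" if "1 \<le> j" "j < k" for j
        using induced_path_eq_iff[OF x(1), of j 0] that x(3) by auto
      then have "x 0 \<notin> x ` {1..<k}" by fastforce
      ultimately show ?thesis by auto
    qed
    then show ?thesis using conn_induced_path[OF sym_E x(1), of 1 k] x(3) by simp
  qed
  have S: "X \<subseteq> S" "Y \<subseteq> S" "S \<subseteq> V" "{a, b, c, d, v} \<inter> S = {}"
  proof -
    have "u \<in> W \<or> apart E F {u}" if "u \<in> X" for u
    proof (cases "u \<in> W")
      case False
      then have "u \<noteq> x 0" "u \<noteq> x 1" "u \<noteq> x (k - 1)" by (auto simp: W_def)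
      moreover obtain i where i: "u = x i" "i < k" using \<open>u \<in> X\<close> x(2) by auto
      ultimately have "(x 0, u) \<notin> E" using induced_path_adj_iff[OF x(1), of 0 i] x(3) by (cases i) auto
      then show ?thesis
        using lvX[of a] lvX[of b] lvX[of c] lvX[of d] that na nb cdX \<open>u \<noteq> x 0\<close> \<open>u \<noteq> x (k - 1)\<close>
        by (auto simp: F_def apart_def)
    qed simp
    moreover have "u \<in> W \<or> apart E F {u}" if "u \<in> Y" for u
    proof (cases "u \<in> W")
      case False
      then have "u \<noteq> y 0" "u \<noteq> y (l - 1)" by (auto simp: W_def)
      then show ?thesis
        using lvX[of a] lvX[of b] lvX[of c] lvX[of d] that nc nd abY XY[OF ends(1)]
        by (auto simp: F_def apart_def)
    qed simp
    moreover have "X \<subseteq> V" "Y \<subseteq> V" using m' by simp_all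
    ultimately show "X \<subseteq> S" "Y \<subseteq> S" using lvX by (auto simp: S_def free_set_def)
    show "S \<subseteq> V" using ends m' by (auto simp: S_def free_set_def W_def)
    show "{a, b, c, d, v} \<inter> S = {}" by (auto simp: S_def free_set_def)
  qed
  have free: "apart E F {w}" if "w \<in> S" "w \<notin> X" "w \<notin> Y" for w
    using that ends by (auto simp: S_def free_set_def W_def)
  have freeD: "w \<noteq> f \<and> (f, w) \<notin> E \<and> (w, f) \<notin> E" if "w \<in> S" "w \<notin> X" "w \<notin> Y" "f \<in> F" for w f
    using free[OF that(1-3)] that(4) adj_commute[of w f] by (auto simp: apart_def)
  have Sneq: "w \<notin> {a, b, c, d, v}" if "w \<in> S" for w using that S(4) by blast
  have sep: "y 0 \<notin> component E S (x 0)"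
  proof
    assume reach: "y 0 \<in> component E S (x 0)"
    \<comment> \<open>A connection from \<open>X\<close> to \<open>Y\<close> has to leave the part
      \<open>C\<close> that \<open>X\<close> reaches inside \<open>S\<close> without coming next to
      \<open>Y\<close>. The vertex \<open>w\<close> just outside \<open>C\<close> is then a
      neighbour of \<open>Y\<close>.\<close>
    define T where "T = {z \<in> S. apart E Y {z}}"
    have XT: "X \<subseteq> T" using S(1) XY by (auto simp: T_def apart_def)
    define C where "C = component E T (x 0)"
    have xT: "x 0 \<in> T" using XT ends by auto
    then have xC: "x 0 \<in> C" unfolding C_def by (rule component_refl)
    have C: "conn E C" "C \<subseteq> T" "X \<subseteq> C"
      unfolding C_def using conn_component[OF sym_E xT] component_subset[of E T "x 0"]
        conn_subset_component[OF _ XT ends(1) component_refl[OF xT]] m' by simp_all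
    have "y 0 \<notin> C" using C(2) ends by (auto simp: T_def apart_def)
    moreover have "x 0 \<in> S" using XT xT by (auto simp: T_def)
    ultimately obtain u w where uw: "u \<in> C" "w \<in> component E S (x 0)" "w \<notin> C" "(u, w) \<in> E"
      using conn_boundary[OF conn_component[OF sym_E] component_refl xC reach] by metis
    have wS: "w \<in> S" using uw(2) component_subset by fast
    have "w \<notin> T" using uw component_closed unfolding C_def by metis
    have "w \<notin> Y" using uw C(2) adj_sym by (fastforce simp: T_def apart_def)
    have "w \<notin> X" using uw(3) C(3) by auto
    obtain y' where y': "y' \<in> Y" "(y', w) \<in> E" using \<open>w \<notin> T\<close> \<open>w \<notin> Y\<close> wS by (auto simp: T_def apart_def)
    note wF = freeD[OF wS \<open>w \<notin> X\<close> \<open>w \<notin> Y\<close>]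
    have wY: "touch E {w} Y" using y' adj_sym by (auto simp: touch_def)
    show False
    proof (cases "touch E {w} X")
      case True
      \<comment> \<open>Here \<open>x 0 \<in> F\<close> matters: \<open>w\<close> is nonadjacent to
        \<open>x 0\<close>, so its neighbour in \<open>X\<close> remains after \<open>x 0\<close>
        has become a leaf, and that leaf is nonadjacent to the new centre \<open>w\<close>.\<close>
      then have "touch E {w} (X - {x 0})" using wF[of "x 0"] by (auto simp: touch_def F_def)
      moreover have "x 0 \<noteq> x (k - 1)" using induced_path_eq_iff[OF x(1), of 0 "k - 1"] x(3) by auto
      then have "touch E {b} (X - {x 0})" "apart E {x 0} {b}"
        using nb[OF ends(3)] nb[OF ends(1)] ends lvX[of b] adj_commute[of "x 0"] by (auto simp: touch_def apart_def)
      moreover have "apart E {x 0} {w}" "apart E {w} {b, c, d}"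
        using wF adj_commute[of "x 0"] by (auto simp: apart_def F_def)
      then have "apart E {x 0} {b, w}" using \<open>apart E {x 0} {b}\<close> by (auto simp: apart_def)
      ultimately have "model (x 0) b c d w (X - {x 0}) Y"
        using ends x(3) bigX[OF m] \<open>apart E {w} {b, c, d}\<close> \<open>w \<notin> X\<close> \<open>w \<notin> Y\<close> wY
        by (intro model_shrink_leaf[OF m _ X1]) auto
      then show False using minimal_no_smaller_side[OF mm ends(1)] by blast
    next
      case False
      \<comment> \<open>The same idea one step earlier: \<open>D\<close> is what \<open>X\<close>
        reaches while also avoiding the closed neighbourhood of \<open>w\<close>. A vertex
        \<open>q\<close> of \<open>C\<close> just outside \<open>D\<close> is a neighbour of
        \<open>w\<close> and becomes the centre between \<open>D\<close> and
        \<open>{w, y'}\<close>.\<close>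
      define T' where "T' = {z \<in> T. z \<noteq> w \<and> (w, z) \<notin> E}"
      have XT': "X \<subseteq> T'" using XT False \<open>w \<notin> X\<close> by (auto simp: T'_def touch_def)
      then have xT': "x 0 \<in> T'" using ends by auto
      define D where "D = component E T' (x 0)"
      have D: "conn E D" "D \<subseteq> T'" "X \<subseteq> D"
        unfolding D_def using conn_component[OF sym_E xT'] component_subset[of E T' "x 0"]
          conn_subset_component[OF _ XT' ends(1) component_refl[OF xT']] m' by simp_all
      have "u \<notin> D" using D(2) uw(4) adj_sym by (auto simp: T'_def)
      then obtain p q where pq: "p \<in> D" "q \<in> C" "q \<notin> D" "(p, q) \<in> E"
        using conn_boundary[OF C(1) xC subsetD[OF D(3) ends(1)] uw(1)] by metis
      have "q \<in> T" "q \<notin> X" using pq C D by auto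
      moreover have "q \<notin> T'" using pq component_closed unfolding D_def by metis
      ultimately have q: "q \<in> S" "q \<notin> X" "q \<notin> Y" "apart E Y {q}" "(w, q) \<in> E"
        using \<open>w \<notin> T\<close> by (auto simp: T_def T'_def apart_def)
      note qF = freeD[OF q(1-3)]
      obtain s where s: "y' = y s" "s < l" using y'(1) y(2) by auto
      \<comment> \<open>The two neighbours of \<open>y'\<close> on the path \<open>Y\<close>
        prolonged by \<open>c\<close> before \<open>y 0\<close> and by \<open>d\<close> after
        \<open>y (l - 1)\<close>. They are the leaves at \<open>{w, y'}\<close>.\<close>
      define L R where "L = (if s = 0 then c else y (s - 1))" and "R = (if s = l - 1 then d else y (s + 1))"
      have LR: "L \<in> insert c (Y - {y'})" "R \<in> insert d (Y - {y'})" "(L, y') \<in> E" "(R, y') \<in> E"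
        "L \<noteq> R" "(L, R) \<notin> E"
      proof -
        note ye = induced_path_eq_iff[OF y(1)] and ya = induced_path_adj_iff[OF y(1)]
        show "L \<in> insert c (Y - {y'})" "(L, y') \<in> E"
          using s ye[of "s - 1" s] ya[of "s - 1" s] nc[OF ends(4)] yY[of "s - 1"] by (auto simp: L_def)
        show "R \<in> insert d (Y - {y'})" "(R, y') \<in> E"
          using s ye[of "s + 1" s] ya[of "s + 1" s] nd[OF ends(5)] yY[of "s + 1"] by (auto simp: R_def)
        have "c \<noteq> d" "(c, d) \<notin> E" using lvs by (auto simp: apart_def)
        consider "s = 0" | "s = l - 1" "s \<noteq> 0" | "s \<noteq> 0" "s \<noteq> l - 1" by blast
        then have "L \<noteq> R \<and> (L, R) \<notin> E"
        proof cases
          case 1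
          have "y 1 \<in> Y" "y 1 \<noteq> y 0" using y(3) yY[of 1] ye[of 1 0] by auto
          then have "c \<noteq> y 1" "(c, y 1) \<notin> E" using nc lvX[of c] by auto
          then show ?thesis using 1 y(3) by (simp add: L_def R_def)
        next
          case 2
          have "s - 1 < l" "s - 1 \<noteq> l - 1" using 2 s y(3) by linarith+
          then have "y (s - 1) \<in> Y" "y (s - 1) \<noteq> y (l - 1)" using y(3) yY[of "s - 1"] ye[of "s - 1" "l - 1"] by auto
          then have "d \<noteq> y (s - 1)" "(d, y (s - 1)) \<notin> E" using nd lvX[of d] by auto
          then show ?thesis using 2 y(3) adj_commute[of d] by (auto simp: L_def R_def)
        next
          case 3
          then have "s - 1 < l" "s + 1 < l" "s - 1 \<noteq> s + 1" "s + 1 \<noteq> Suc (s - 1)" "s - 1 \<noteq> Suc (s + 1)" using s by linarith+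
          then show ?thesis using 3 ye[of "s - 1" "s + 1"] ya[of "s - 1" "s + 1"] by (simp add: L_def R_def)
        qed
        then show "L \<noteq> R" "(L, R) \<notin> E" by auto
      qed
      let ?Y = "{w, y'}"
      have cF: "a \<in> F" "b \<in> F" "c \<in> F" "d \<in> F" by (auto simp: F_def)
      have DS: "z \<in> S" "z \<notin> Y" "z \<noteq> w" "(w, z) \<notin> E" if "z \<in> D" for z
        using that D(2) by (auto simp: T'_def T_def apart_def)
      have DY: "(e, z) \<notin> E" "e \<noteq> z" if "z \<in> D" "e \<in> Y" for z e
        using that D(2) by (auto simp: T'_def T_def apart_def)
      have Dcd: "(c, z) \<notin> E" "(d, z) \<notin> E" "z \<noteq> c" "z \<noteq> d" if "z \<in> D" for z
        using DS[OF that] cdX[of z] freeD[of z] Sneq[of z] cF by auto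
      have DLR: "(L, z) \<notin> E" "(R, z) \<notin> E" "z \<noteq> L" "z \<noteq> R" if "z \<in> D" for z
        using LR(1,2) Dcd[OF that] DY[OF that] by auto
      have Lab: "e \<noteq> a" "e \<noteq> b" "(a, e) \<notin> E" "(b, e) \<notin> E" "q \<noteq> e" "(e, q) \<notin> E" if "e \<in> {L, R}" for e
      proof -
        have "e \<in> insert c (insert d Y)" using that LR(1,2) by auto
        then show "e \<noteq> a" "e \<noteq> b" "(a, e) \<notin> E" "(b, e) \<notin> E" "q \<noteq> e" "(e, q) \<notin> E"
          using lvs lvX[of a] lvX[of b] abY qF[OF cF(3)] qF[OF cF(4)] q(3,4) by (auto simp: apart_def)
      qed
      have "model a b L R q D ?Y"
        unfolding model_def
      proof (intro conjI)
        show "D \<subseteq> V" using DS S(3) by blast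
        show "?Y \<subseteq> V" using wS y' S by auto
        show "conn E D" by fact
        show "conn E ?Y" using y' adj_sym
          by (intro conn_insert[OF sym_E conn_singleton]) (auto simp: touch_def)
        show "apart E D ?Y" using DS DY y'(1) adj_sym by (fastforce simp: apart_def)
        show "apart E {a} {b, L, R, q}" "apart E {b} {L, R, q}"
          using lvs Lab[of L] Lab[of R] qF[of a] qF[of b] cF by (auto simp: apart_def)
        show "apart E {L} {R, q}" "apart E {R} {q}" using LR(5,6) Lab[of L] Lab[of R] by (auto simp: apart_def)
        show "apart E {L, R} D" using DLR by (auto simp: apart_def)
        show "apart E {a, b} ?Y" using abY[OF y'(1)] wF[of a] wF[of b] cF lvX[of a] lvX[of b] y'(1)
          by (auto simp: apart_def)
        show "{a, b, q} \<inter> D = {}" using DS(1) Sneq pq(3) by blast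
        have "w \<noteq> L" "w \<noteq> R" "y' \<noteq> L" "y' \<noteq> R"
          using LR(1,2) \<open>w \<notin> Y\<close> wF[of c] wF[of d] cF y'(1) lvX[of c] lvX[of d] by auto
        moreover have "q \<noteq> w" using q(5) by auto
        ultimately show "{L, R, q} \<inter> ?Y = {}" using q(3) y'(1) by auto
        show "touch E {a} D" "touch E {b} D" using m' D(3) by (auto simp: touch_def)
        show "touch E {q} D" using pq adj_sym by (auto simp: touch_def)
        show "touch E {L} ?Y" "touch E {R} ?Y" using LR(3,4) by (auto simp: touch_def)
        show "touch E {q} ?Y" using q(5) adj_sym by (auto simp: touch_def)
      qed
      then have "3 < card ?Y" by (rule bigY)
      then show False by (simp add: card_insert_if split: if_splits)
    qed
  qed
  have disj: "component E S (x 0) \<inter> component E S (y 0) = {}"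
    using component_apart[OF sep] S ends by (auto simp: apart_def)
  have sub: "X \<subseteq> component E S (x 0)" "Y \<subseteq> component E S (y 0)"
    using conn_subset_component[OF _ S(1) ends(1) component_refl[OF subsetD[OF S(1) ends(1)]]]
      conn_subset_component[OF _ S(2) ends(4) component_refl[OF subsetD[OF S(2) ends(4)]]] m' by simp_all
  have "apart E {c, d} (component E S (x 0))"
  proof -
    have "(c, z) \<notin> E" "(d, z) \<notin> E" "z \<noteq> c" "z \<noteq> d" if "z \<in> component E S (x 0)" for z
    proof -
      have "z \<in> S" "z \<notin> Y" using that component_subset sub disj by fast+
      then show "(c, z) \<notin> E" "(d, z) \<notin> E" "z \<noteq> c" "z \<noteq> d"
        using cdX[of z] freeD[of z c] freeD[of z d] Sneq[of z] by (auto simp: F_def)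
    qed
    then show ?thesis by (auto simp: apart_def)
  qed
  moreover have "apart E {a, b} (component E S (y 0))"
  proof -
    have "(a, z) \<notin> E" "(b, z) \<notin> E" "z \<noteq> a" "z \<noteq> b" if "z \<in> component E S (y 0)" for z
    proof -
      have "z \<in> S" "z \<notin> X" using that component_subset sub disj by fast+
      then show "(a, z) \<notin> E" "(b, z) \<notin> E" "z \<noteq> a" "z \<noteq> b"
        using abY[of z] freeD[of z a] freeD[of z b] Sneq[of z] by (auto simp: F_def)
    qed
    then show ?thesis by (auto simp: apart_def)
  qed
  ultimately have "model a b c d v (component E S (x 0)) (component E S (y 0))"
    by (rule model_component[OF m S ends(1,4) sep])
  moreover have "W \<subseteq> V" "F \<subseteq> V"
    using ends m' model_in_V[OF m] unfolding W_def F_def by blast+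
  moreover have "W \<noteq> {}" "F \<noteq> {}" "card W \<le> 5" "card F \<le> 5"
    by (simp_all add: W_def F_def card_insert_if)
  moreover have "x 0 \<in> S" "y 0 \<in> S" using ends S by auto
  ultimately have criterion
    using sep unfolding criterion_def Let_def S_def by meson
  then show False using no by simp
qed

lemma criterion_iff: "criterion \<longleftrightarrow> (\<exists>a b c d v X Y. model a b c d v X Y)"
  using criterion_if_model by (auto simp: criterion_def Let_def)

end

section \<open>Branch sets of induced minors\<close>

text \<open>Vertices of \<open>G\<close> in no branch set are the deleted ones. That touching is
  equivalent to adjacency, and not merely implied by it, distinguishes induced minors from
  minors.\<close>

definition bags :: "'a pair_pre_digraph \<Rightarrow> 'b pair_pre_digraph \<Rightarrow> ('b \<Rightarrow> 'a set) \<Rightarrow> bool" where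
  "bags G H B \<longleftrightarrow> (\<forall>h\<in>pverts H. B h \<subseteq> pverts G \<and> conn (parcs G) (B h)) \<and>
     (\<forall>h\<in>pverts H. \<forall>k\<in>pverts H. h \<noteq> k \<longrightarrow>
        B h \<inter> B k = {} \<and> (touch (parcs G) (B h) (B k) \<longleftrightarrow> (h, k) \<in> parcs H))"

lemma simple_graph_pair_graph: "pair_graph G \<Longrightarrow> simple_graph (pverts G) (parcs G)"
proof -
  assume "pair_graph G"
  then interpret pair_graph G .
  have "irrefl (parcs G)" using no_loops' by (blast intro: irreflI)
  then show ?thesis
    using pair_finite_verts in_arcsD1 in_arcsD2 pair_sym_arcs
    by unfold_locales (auto simp: symmetric_def)
qed

text \<open>A digraph isomorphism carries a separate arc map; when arcs are pairs of vertices, the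
  vertex map forces it.\<close>

lemma digraph_iso_with_proj_iff:
  assumes "pair_graph G"
  shows "digraph_iso (with_proj G) (with_proj H) \<longleftrightarrow>
    (\<exists>f. inj_on f (pverts G) \<and> pverts H = f ` pverts G \<and> parcs H = map_prod f f ` parcs G)" (is "?L \<longleftrightarrow> ?R")
proof -
  interpret pair_graph G by fact
  show ?thesis
  proof
    assume ?L
    then obtain hom where hom: "digraph_isomorphism hom" and H: "with_proj H = app_iso hom (with_proj G)"
      by (auto simp: digraph_iso_def)
    let ?f = "iso_verts hom"
    have fst: "iso_tail hom = fst" "iso_head hom = snd"
      using H by (simp_all add: with_proj_def app_iso_def)
    have "iso_arcs hom e = map_prod ?f ?f e" if "e \<in> parcs G" for e
      using hom that fst unfolding digraph_isomorphism_def by (auto simp: prod_eq_iff)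
    then have "parcs H = map_prod ?f ?f ` parcs G"
      using H by (simp add: with_proj_def app_iso_def)
    moreover have "pverts H = ?f ` pverts G" using H by (simp add: with_proj_def app_iso_def)
    moreover have "inj_on ?f (pverts G)" using hom by (simp add: digraph_isomorphism_def)
    ultimately show ?R by blast
  next
    assume ?R
    then obtain f where f: "inj_on f (pverts G)" "pverts H = f ` pverts G" "parcs H = map_prod f f ` parcs G"
      by blast
    let ?hom = "\<lparr>iso_verts = f, iso_arcs = map_prod f f, iso_head = snd, iso_tail = fst\<rparr>"
    have "inj_on (map_prod f f) (pverts G \<times> pverts G)" using f(1) by (intro map_prod_inj_on)
    then have "inj_on (map_prod f f) (parcs G)"
      by (rule inj_on_subset) (auto dest: in_arcsD1 in_arcsD2)
    then have "digraph_isomorphism ?hom"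
      using f(1) wf_digraph_axioms unfolding digraph_isomorphism_def by simp
    moreover have "with_proj H = app_iso ?hom (with_proj G)"
      using f by (simp add: with_proj_def app_iso_def)
    ultimately show ?L unfolding digraph_iso_def by blast
  qed
qed

section \<open>Branch sets under deletion and contraction\<close>

lemma conn_cong: "Restr E X = Restr E' X \<Longrightarrow> conn E X = conn E' X"
  by (simp add: conn_def)

lemma bags_delete_vertex:
  assumes "\<And>h. h \<in> pverts H \<Longrightarrow> v \<notin> B h"
  shows "bags (delete_vertex G v) H B \<longleftrightarrow> bags G H B"
proof -
  let ?E' = "parcs (delete_vertex G v)"
  have "conn ?E' (B h) \<longleftrightarrow> conn (parcs G) (B h)" if "h \<in> pverts H" for h
    using assms[OF that] by (intro conn_cong) (auto simp: delete_vertex_def)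
  moreover have "touch ?E' (B h) (B k) \<longleftrightarrow> touch (parcs G) (B h) (B k)" if "h \<in> pverts H" "k \<in> pverts H" for h k
    using assms that by (fastforce simp: delete_vertex_def touch_def)
  moreover have "B h \<subseteq> pverts (delete_vertex G v) \<longleftrightarrow> B h \<subseteq> pverts G" if "h \<in> pverts H" for h
    using assms[OF that] by (auto simp: delete_vertex_def)
  ultimately show ?thesis by (simp add: bags_def)
qed

text \<open>Contracting \<open>uv\<close> is the map \<open>f = id(v := u)\<close>. Sets that contain both or none of
  \<open>u\<close>, \<open>v\<close> correspond to their images.\<close>
context
  fixes G :: "'a pair_pre_digraph" and u v f G'
  assumes G: "pair_graph G" and uv: "(u, v) \<in> parcs G"
  defines "f \<equiv> id(v := u)" and "G' \<equiv> contract_edge G u v"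
begin

lemma contract_arcs: "parcs G' = {(f x, f y) | x y. (x, y) \<in> parcs G \<and> f x \<noteq> f y}"
  by (simp add: G'_def contract_edge_def f_def Let_def)

lemma conn_contract:
  assumes "u \<in> X \<longleftrightarrow> v \<in> X"
  shows "conn (parcs G') (f ` X) \<longleftrightarrow> conn (parcs G) X"
proof -
  interpret simple_graph "pverts G" "parcs G" using G by (rule simple_graph_pair_graph)
  let ?R = "(Restr (parcs G) X)\<^sup>*" and ?R' = "(Restr (parcs G') (f ` X))\<^sup>*"
  have fX: "x \<in> X" if "f x \<in> f ` X" for x using that assms by (auto simp: f_def split: if_splits)
  have 1: "(f x, f y) \<in> ?R'" if "(x, y) \<in> ?R" for x y
    using that
  proof (induction rule: rtrancl_induct)
    case (step y z)
    then have "f y = f z \<or> (f y, f z) \<in> Restr (parcs G') (f ` X)"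
      by (auto simp: contract_arcs)
    then show ?case using step by (auto intro: rtrancl_into_rtrancl)
  qed simp
  \<comment> \<open>The only fibre of \<open>f\<close> with two elements is \<open>{u, v}\<close>,
    and these are joined by the contracted edge.\<close>
  have 2: "(x, y) \<in> ?R" if "f x = f y" "x \<in> X" "y \<in> X" for x y
  proof (cases "x = y")
    case False
    then have "{x, y} = {u, v}" using that by (auto simp: f_def split: if_splits)
    then have "(x, y) \<in> Restr (parcs G) X" using uv adj_sym that by (auto simp: doubleton_eq_iff)
    then show ?thesis by blast
  qed simp
  \<comment> \<open>A walk in the contraction is lifted edge by edge; where consecutive lifts meet
    in different elements of one fibre, \<open>2\<close> bridges the gap.\<close>
  have 3: "(x, y) \<in> ?R" if "(f x, z) \<in> ?R'" "x \<in> X" "f y = z" "y \<in> X" for x y z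
    using that
  proof (induction arbitrary: y rule: rtrancl_induct)
    case base then show ?case using 2 by simp
  next
    case (step z z')
    then have z: "(z, z') \<in> parcs G'" "z \<in> f ` X" "z' \<in> f ` X" by simp_all
    then obtain p q where "(p, q) \<in> parcs G" "z = f p" "z' = f q"
      unfolding contract_arcs by blast
    then have pq: "(p, q) \<in> parcs G" "z = f p" "z' = f q" "p \<in> X" "q \<in> X"
      using z fX[of p] fX[of q] by blast+
    then have "(x, p) \<in> ?R" "(q, y) \<in> ?R" using step 2 by auto
    moreover have "(p, q) \<in> ?R" using pq by auto
    ultimately show ?case by (meson rtrancl_trans)
  qed
  have "(f x, f y) \<in> ?R' \<longleftrightarrow> (x, y) \<in> ?R" if "x \<in> X" "y \<in> X" for x y
    using 1[of x y] 3[of x "f y" y] that by blast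
  then have "(\<forall>x\<in>X. \<forall>y\<in>X. (f x, f y) \<in> ?R') \<longleftrightarrow> (\<forall>x\<in>X. \<forall>y\<in>X. (x, y) \<in> ?R)" by blast
  then show ?thesis unfolding conn_def by (simp only: image_is_empty ball_simps(9))
qed

lemma touch_contract:
  assumes "u \<in> X \<longleftrightarrow> v \<in> X" "u \<in> Y \<longleftrightarrow> v \<in> Y" "X \<inter> Y = {}"
  shows "touch (parcs G') (f ` X) (f ` Y) \<longleftrightarrow> touch (parcs G) X Y"
proof -
  have fX: "x \<in> X" if "f x \<in> f ` X" for x using that assms by (auto simp: f_def split: if_splits)
  have fY: "x \<in> Y" if "f x \<in> f ` Y" for x using that assms by (auto simp: f_def split: if_splits)
  have ne: "f x \<noteq> f y" if "x \<in> X" "y \<in> Y" for x y using that fX assms(3) by (metis disjoint_iff imageI)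
  show ?thesis
  proof
    assume "touch (parcs G') (f ` X) (f ` Y)"
    obtain x y where "(x, y) \<in> parcs G" "f x \<in> f ` X" "f y \<in> f ` Y"
    proof -
      obtain p q where "p \<in> f ` X" "q \<in> f ` Y" "(p, q) \<in> parcs G'"
        using \<open>touch (parcs G') (f ` X) (f ` Y)\<close> unfolding touch_def by blast
      moreover then obtain x y where "(x, y) \<in> parcs G" "p = f x" "q = f y"
        unfolding contract_arcs by blast
      ultimately show ?thesis using that by simp
    qed
    then show "touch (parcs G) X Y" using fX[of x] fY[of y] unfolding touch_def by blast
  next
    assume "touch (parcs G) X Y"
    then obtain x y where "(x, y) \<in> parcs G" "x \<in> X" "y \<in> Y" by (auto simp: touch_def)
    moreover from this have "(f x, f y) \<in> parcs G'" using ne by (auto simp: contract_arcs)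
    ultimately show "touch (parcs G') (f ` X) (f ` Y)" by (auto simp: touch_def)
  qed
qed

lemma bags_contract_iff:
  assumes "\<And>h. h \<in> pverts H \<Longrightarrow> u \<in> B h \<longleftrightarrow> v \<in> B h"
  shows "bags G' H (\<lambda>h. f ` B h) \<longleftrightarrow> bags G H B"
proof -
  interpret simple_graph "pverts G" "parcs G" using G by (rule simple_graph_pair_graph)
  have "u \<noteq> v" using uv by auto
  moreover have "u \<in> pverts G" "v \<in> pverts G" using uv E_subset by auto
  ultimately have "f ` B h \<subseteq> pverts G' \<longleftrightarrow> B h \<subseteq> pverts G" if "h \<in> pverts H" for h
    using assms[OF that] by (fastforce simp: G'_def contract_edge_def f_def Let_def)
  moreover have "f ` B h \<inter> f ` B k = {} \<longleftrightarrow> B h \<inter> B k = {}" if "h \<in> pverts H" "k \<in> pverts H" for h k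
    using assms[OF that(1)] assms[OF that(2)] by (fastforce simp: f_def split: if_splits)
  ultimately show ?thesis
    using assms conn_contract[of "B h" for h] touch_contract[of "B h" "B k" for h k]
    unfolding bags_def by (smt (verit, best))
qed

text \<open>A preimage under \<open>f\<close> contains both or none of \<open>u\<close> and
  \<open>v\<close>, so \<open>bags_contract_iff\<close> applies. Its image is the original branch
  set because \<open>v\<close> is not a vertex of the contraction.\<close>

lemma bags_uncontract:
  assumes "bags G' H B"
  shows "bags G H (\<lambda>h. f -` B h)"
proof -
  have "f ` f -` B h = B h" if "h \<in> pverts H" for h
  proof -
    have "u \<noteq> v" using uv G pair_graph.axioms simple_graph.not_adj_self[OF simple_graph_pair_graph[OF G]] by blast
    moreover have "v \<notin> B h" using assms that by (auto simp: bags_def G'_def contract_edge_def)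
    ultimately show ?thesis by (auto simp: f_def image_iff) 
  qed
  then have "bags G' H (\<lambda>h. f ` f -` B h)" using assms by (simp add: bags_def)
  then show ?thesis using bags_contract_iff[of H "\<lambda>h. f -` B h"] by (simp add: f_def)
qed

end

lemma bags_induced_minor_step:
  assumes "induced_minor_step G G'" "pair_graph G" "bags G' H B"
  shows "\<exists>B. bags G H B"
  using assms(1)
proof cases
  case (delete v)
  then have "v \<notin> B h" if "h \<in> pverts H" for h
    using assms(3) that by (auto simp: bags_def delete_vertex_def)
  then show ?thesis using bags_delete_vertex assms(3) delete by metis
next
  case (contract u v)
  then show ?thesis using bags_uncontract[OF assms(2)] assms(3) by blast
qed

text \<open>At the end of the chain of steps the branch sets are the singleton fibres of the
  isomorphism; they are pulled back through one step at a time.\<close>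

lemma contains_induced_minor_imp_bags:
  assumes "contains_induced_minor G H" "pair_graph G"
  shows "\<exists>B. bags G H B"
proof -
  obtain G' where G': "induced_minor_step\<^sup>*\<^sup>* G G'" "digraph_iso (with_proj G') (with_proj H)"
    using assms(1) by (auto simp: contains_induced_minor_def)
  show ?thesis using G'(1) assms(2)
  proof (induction rule: converse_rtranclp_induct)
    case base
    obtain f where f: "inj_on f (pverts G')" "pverts H = f ` pverts G'" "parcs H = map_prod f f ` parcs G'"
      using digraph_iso_with_proj_iff[OF base, THEN iffD1, OF G'(2)] by blast
    interpret pair_graph G' by fact
    have arc: "(f x, f y) \<in> parcs H \<longleftrightarrow> (x, y) \<in> parcs G'" if "x \<in> pverts G'" "y \<in> pverts G'" for x y
    proof
      assume "(f x, f y) \<in> parcs H"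
      then obtain p q where pq: "(p, q) \<in> parcs G'" "f x = f p" "f y = f q" by (auto simp: f(3))
      then have "x = p" "y = q" using f(1) that in_arcsD1[OF pq(1)] in_arcsD2[OF pq(1)] by (auto dest: inj_onD)
      then show "(x, y) \<in> parcs G'" using pq(1) by simp
    qed (force simp: f(3))
    have single: "{y \<in> pverts G'. f y = f x} = {x}" if "x \<in> pverts G'" for x
      using f(1) that by (auto simp: inj_on_def)
    have "bags G' H (\<lambda>h. {x \<in> pverts G'. f x = h})"
      unfolding bags_def f(2)
    proof (intro conjI ballI impI)
      fix h assume "h \<in> f ` pverts G'"
      then obtain x where "x \<in> pverts G'" "h = f x" by blast
      then show "{x \<in> pverts G'. f x = h} \<subseteq> pverts G'" "conn (parcs G') {x \<in> pverts G'. f x = h}"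
        by (simp_all add: single)
    next
      fix h k assume "h \<in> f ` pverts G'" "k \<in> f ` pverts G'" "h \<noteq> k"
      then obtain x y where "x \<in> pverts G'" "h = f x" "y \<in> pverts G'" "k = f y" "x \<noteq> y" by blast
      then show "{x \<in> pverts G'. f x = h} \<inter> {x \<in> pverts G'. f x = k} = {}"
        "touch (parcs G') {x \<in> pverts G'. f x = h} {x \<in> pverts G'. f x = k} \<longleftrightarrow> (h, k) \<in> parcs H"
        using arc by (simp_all add: single touch_def)
    qed
    then show ?case by blast
  next
    case (step G1 G2)
    then show ?case using bags_induced_minor_step pair_graph_induced_minor_step by metis
  qed
qed

text \<open>Each step loses a vertex: an uncovered vertex is deleted, or an edge inside a branch set
  with two elements is contracted. When neither is possible, the branch sets are singletons that
  cover \<open>G\<close>, and they define an isomorphism.\<close>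

lemma bags_imp_contains_induced_minor:
  assumes "bags G H B" "pair_graph G" "pair_graph H"
  shows "contains_induced_minor G H"
  using assms(1,2)
proof (induction "card (pverts G)" arbitrary: G B rule: less_induct)
  case less
  interpret pair_graph G by fact
  interpret simple_graph "pverts G" "parcs G" using less.prems(2) by (rule simple_graph_pair_graph)
  have next_step: "contains_induced_minor G H" if s: "induced_minor_step G G'" and b: "bags G' H B'"
    and v: "v \<in> pverts G" "pverts G' = pverts G - {v}" for G' B' v
  proof -
    have "card (pverts G') < card (pverts G)" using v pair_finite_verts by (metis card_Diff1_less)
    then have "contains_induced_minor G' H"
      using less.hyps b pair_graph_induced_minor_step[OF s less.prems(2)] by blast
    then show ?thesis
      using s unfolding contains_induced_minor_def by (meson converse_rtranclp_into_rtranclp)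
  qed
  consider (uncovered) v where "v \<in> pverts G" "\<And>h. h \<in> pverts H \<Longrightarrow> v \<notin> B h"
    | (big) h x y where "h \<in> pverts H" "x \<in> B h" "y \<in> B h" "x \<noteq> y"
    | (exact) "pverts G \<subseteq> (\<Union>h\<in>pverts H. B h)" "\<And>h x y. h \<in> pverts H \<Longrightarrow> x \<in> B h \<Longrightarrow> y \<in> B h \<Longrightarrow> x = y"
    by blast
  then show ?case
  proof cases
    case uncovered
    then have "bags (delete_vertex G v) H B"
      using bags_delete_vertex[of H v B G] less.prems(1) by blast
    then show ?thesis
      by (rule next_step[OF delete[OF uncovered(1)] _ uncovered(1)]) (simp add: delete_vertex_def)
  next
    case big
    have "conn (parcs G) (B h)" using less.prems(1) big(1) by (simp add: bags_def)
    from conn_boundary[OF this big(2) singletonI big(3)] big(4)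
    obtain v where v: "v \<in> B h" "(x, v) \<in> parcs G" by (metis singletonD)
    have "x \<in> B k \<longleftrightarrow> v \<in> B k" if "k \<in> pverts H" for k
    proof (cases "k = h")
      case False
      then have "B h \<inter> B k = {}" using less.prems(1) big(1) that by (simp add: bags_def)
      then show ?thesis using big(2) v(1) by blast
    qed (use big(2) v(1) in simp)
    then have "bags (contract_edge G x v) H (\<lambda>h. (id(v := x)) ` B h)"
      using bags_contract_iff[OF less.prems(2) v(2)] less.prems(1) by blast
    moreover have "v \<in> pverts G" using v(2) E_subset by auto
    ultimately show ?thesis
      using next_step[OF contract[OF v(2)]] by (simp add: contract_edge_def Let_def)
  next
    case exact
    define g where "g h = (SOME x. x \<in> B h)" for h
    have B: "B h = {g h}" if "h \<in> pverts H" for h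
    proof -
      have "B h \<noteq> {}" using less.prems(1) that by (simp add: bags_def conn_def)
      then have "g h \<in> B h" by (auto simp: g_def intro: someI)
      then show ?thesis using exact(2) that by blast
    qed
    interpret H: pair_graph H by fact
    have inj: "inj_on g (pverts H)"
      using less.prems(1) B by (fastforce simp: inj_on_def bags_def)
    have V: "pverts G = g ` pverts H"
    proof
      show "pverts G \<subseteq> g ` pverts H" using exact(1) B by auto
      have "B h \<subseteq> pverts G" if "h \<in> pverts H" for h using less.prems(1) that by (simp add: bags_def)
      then show "g ` pverts H \<subseteq> pverts G" using B by auto
    qed
    have arc: "(g h, g k) \<in> parcs G \<longleftrightarrow> (h, k) \<in> parcs H" if "h \<in> pverts H" "k \<in> pverts H" for h k
    proof (cases "h = k")
      case True then show ?thesis using H.no_loops' by auto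
    next
      case False then show ?thesis using less.prems(1) B that by (auto simp: bags_def touch_def)
    qed
    define f where "f = the_inv_into (pverts H) g"
    have fg: "f (g h) = h" if "h \<in> pverts H" for h
      using that inj by (simp add: f_def the_inv_into_f_f)
    have "inj_on f (pverts G)" using V fg by (auto simp: inj_on_def)
    moreover have "pverts H = f ` pverts G" using V fg by (force simp: image_image)
    moreover have "parcs H = map_prod f f ` parcs G"
    proof (intro equalityI subsetI)
      fix e assume e: "e \<in> parcs H"
      then obtain h k where "e = (h, k)" "h \<in> pverts H" "k \<in> pverts H"
        using H.in_arcsD1 H.in_arcsD2 by (cases e) auto
      then show "e \<in> map_prod f f ` parcs G"
        using e arc[of h k] fg by (intro image_eqI[of _ _ "(g h, g k)"]) auto
    next
      fix e assume "e \<in> map_prod f f ` parcs G"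
      then obtain x y where xy: "e = (f x, f y)" "(x, y) \<in> parcs G" by auto
      then obtain h k where "x = g h" "y = g k" "h \<in> pverts H" "k \<in> pverts H"
        using E_subset V by blast
      then show "e \<in> parcs H" using xy arc fg by auto
    qed
    ultimately have "digraph_iso (with_proj G) (with_proj H)"
      using digraph_iso_with_proj_iff[OF less.prems(2)] by blast
    then show ?thesis unfolding contains_induced_minor_def by blast
  qed
qed

section \<open>Branch sets of the tree and models\<close>

lemma pverts_H2: "pverts H2 = {1, 2, 3, 4, 5, 6, 7}"
  by (auto simp: H2_def)

lemma parcs_H2: "parcs H2 = {(1,2),(2,3),(2,4),(4,6),(5,6),(6,7),(2,1),(3,2),(4,2),(6,4),(6,5),(7,6)}"
  by (auto simp: H2_def H2_edges_def)

context simple_graph begin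

lemma touch_sym: "touch E A B \<longleftrightarrow> touch E B A"
  unfolding touch_def using adj_sym by blast

lemma apart_iff: "apart E A B \<longleftrightarrow> A \<inter> B = {} \<and> \<not> touch E A B"
  by (auto simp: apart_def touch_def)

lemma apart_mono: "apart E A B \<Longrightarrow> A' \<subseteq> A \<Longrightarrow> B' \<subseteq> B \<Longrightarrow> apart E A' B'"
  by (auto simp: apart_def)

text \<open>The branch set \<open>Z\<close> of the middle vertex shrinks to one vertex:
  \<open>X\<close> absorbs the part of \<open>Z\<close> that it reaches without coming next to
  \<open>Y\<close>, and a vertex \<open>v\<close> of \<open>Z\<close> just outside touches both
  sides. Absorbing from \<open>Z\<close> is harmless because \<open>Z\<close> is away from all four
  leaves.\<close>

lemma model_if_branch_sets:
  assumes X: "conn E X" "X \<subseteq> V" and Z: "conn E Z" "Z \<subseteq> V" and Y: "conn E Y" "Y \<subseteq> V"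
    and XZ: "touch E X Z" and ZY: "touch E Z Y" and XY: "apart E X Y"
    and leaves: "touch E {a} X" "touch E {b} X" "touch E {c} Y" "touch E {d} Y"
    and "apart E {a} {b, c, d}" "apart E {b} {c, d}" "apart E {c} {d}"
    and out: "apart E {a, b} (Z \<union> Y)" "apart E {c, d} (X \<union> Z)" "{a, b} \<inter> X = {}" "{c, d} \<inter> Y = {}"
    and disj: "X \<inter> Z = {}" "Y \<inter> Z = {}"
  shows "\<exists>v X'. model a b c d v X' Y"
proof -
  define T where "T = {z \<in> X \<union> Z. apart E Y {z}}"
  have "conn E (X \<union> Z)" using X Z XZ conn_Un[OF sym_E] by blast
  moreover have "touch E (X \<union> Z) Y" using ZY by (auto simp: touch_def)
  ultimately have K: "conn E (X \<union> Z \<union> Y)" using Y conn_Un[OF sym_E] by blast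
  obtain x where x: "x \<in> X" using X by (auto simp: conn_def)
  obtain y where y: "y \<in> Y" using Y by (auto simp: conn_def)
  have XT: "X \<subseteq> T" using apart_sym[of X Y] XY by (auto simp: T_def apart_def)
  define C where "C = component E T x"
  have xT: "x \<in> T" using x XT by blast
  have C: "conn E C" "C \<subseteq> T" "X \<subseteq> C" "x \<in> C"
    using conn_component[OF sym_E xT] component_subset[of E T x] component_refl[OF xT]
      conn_subset_component[OF X(1) XT x component_refl[OF xT]] by (simp_all add: C_def)
  have CY: "apart E Y C" using C(2) by (auto simp: T_def apart_def)
  then have "y \<notin> C" using y by (auto simp: apart_def)
  then obtain u v where uv: "u \<in> C" "v \<in> X \<union> Z \<union> Y" "v \<notin> C" "(u, v) \<in> E"
    using conn_boundary[OF K _ C(4), of y] x y by (metis UnCI)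
  have "v \<notin> Y" using CY uv adj_commute[of u v] by (auto simp: apart_def)
  moreover have "v \<notin> X" using C(3) uv(3) by blast
  ultimately have v: "v \<in> Z" using uv(2) by blast
  have "v \<notin> T" using component_closed[of u E T x v] uv unfolding C_def by blast
  then have vY: "touch E {v} Y"
    using v \<open>v \<notin> Y\<close> adj_commute by (auto simp: T_def apart_def touch_def)
  have CXZ: "C \<subseteq> X \<union> Z" using C(2) by (auto simp: T_def)
  have ab: "apart E {a, b} {v}" and cd: "apart E {c, d} {v}" and cdC: "apart E {c, d} C"
    using out(1,2) v CXZ by (auto intro: apart_mono)
  have "apart E {a} {b, c, d, v}" "apart E {b} {c, d, v}" "apart E {c} {d, v}" "apart E {d} {v}"
    using assms(14-16) ab cd by (simp_all add: apart_def)
  moreover have "apart E {a, b} Y" using out(1) by (auto intro: apart_mono)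
  moreover have "a \<notin> Z" "b \<notin> Z" using out(1) by (auto simp: apart_def)
  then have "{a, b, v} \<inter> C = {}" using out(3) uv(3) CXZ by auto
  moreover have "{c, d, v} \<inter> Y = {}" using out(4) \<open>v \<notin> Y\<close> by auto
  moreover have "touch E {a} C" "touch E {b} C" "touch E {v} C"
    using leaves(1,2) C(3) uv(1,4) adj_sym by (auto simp: touch_def)
  moreover have "C \<subseteq> V" using CXZ X Z by blast
  ultimately have "model a b c d v C Y"
    using C(1) Y leaves(3,4) vY cdC CY apart_sym[of C Y] by (simp add: model_def)
  then show ?thesis by blast
qed

end

lemma H2_bags_imp_model:
  assumes "bags G H2 B" "pair_graph G"
  shows "\<exists>a b c d v X Y. simple_graph.model (pverts G) (parcs G) a b c d v X Y"
proof -
  interpret simple_graph "pverts G" "parcs G" using assms(2) by (rule simple_graph_pair_graph)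
  have B: "conn (parcs G) (B h)" "B h \<subseteq> pverts G" if "h \<in> {1, 2, 3, 4, 5, 6, 7}" for h
    using assms(1) that unfolding bags_def pverts_H2 by blast+
  have disj: "B h \<inter> B k = {}" and tch: "touch (parcs G) (B h) (B k) \<longleftrightarrow> (h, k) \<in> parcs H2"
    if "h \<in> {1, 2, 3, 4, 5, 6, 7}" "k \<in> {1, 2, 3, 4, 5, 6, 7}" "h \<noteq> k" for h k
    using assms(1) that unfolding bags_def pverts_H2 by blast+
  have ap: "apart (parcs G) (B h) (B k)"
    if "h \<in> {1, 2, 3, 4, 5, 6, 7}" "k \<in> {1, 2, 3, 4, 5, 6, 7}" "h \<noteq> k" "(h, k) \<notin> parcs H2" for h k
    using that disj tch by (simp add: apart_iff)
  have "touch (parcs G) (B 1) (B 2)" "touch (parcs G) (B 3) (B 2)" "touch (parcs G) (B 5) (B 6)" "touch (parcs G) (B 7) (B 6)"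
    by (subst tch; simp add: parcs_H2)+
  then obtain a b c d where l: "a \<in> B 1" "b \<in> B 3" "c \<in> B 5" "d \<in> B 7"
    "touch (parcs G) {a} (B 2)" "touch (parcs G) {b} (B 2)" "touch (parcs G) {c} (B 6)" "touch (parcs G) {d} (B 6)"
    unfolding touch_def by blast
  have "\<exists>v X'. model a b c d v X' (B 6)"
  proof (rule model_if_branch_sets)
    show "touch (parcs G) (B 2) (B 4)" "touch (parcs G) (B 4) (B 6)" by (subst tch; simp add: parcs_H2)+
    show "apart (parcs G) (B 2) (B 6)" by (rule ap; simp add: parcs_H2)
    have sing: "x \<noteq> y \<and> (x, y) \<notin> parcs G"
      if "x \<in> B h" "y \<in> B k" "h \<in> {1, 2, 3, 4, 5, 6, 7}" "k \<in> {1, 2, 3, 4, 5, 6, 7}" "h \<noteq> k" "(h, k) \<notin> parcs H2" for x y h k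
      using ap[OF that(3-6)] that(1,2) by (simp add: apart_def)
    show "apart (parcs G) {a} {b, c, d}" "apart (parcs G) {b} {c, d}" "apart (parcs G) {c} {d}"
      using sing[OF l(1,2)] sing[OF l(1,3)] sing[OF l(1,4)] sing[OF l(2,3)] sing[OF l(2,4)] sing[OF l(3,4)]
      by (simp_all add: parcs_H2 apart_def)
    show "apart (parcs G) {a, b} (B 4 \<union> B 6)" "apart (parcs G) {c, d} (B 2 \<union> B 4)"
      using sing[OF l(1), of _ 4] sing[OF l(1), of _ 6] sing[OF l(2), of _ 4] sing[OF l(2), of _ 6]
        sing[OF l(3), of _ 2] sing[OF l(3), of _ 4] sing[OF l(4), of _ 2] sing[OF l(4), of _ 4]
      by (simp_all add: parcs_H2 apart_def ball_Un)
    show "{a, b} \<inter> B 2 = {}" "{c, d} \<inter> B 6 = {}"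
      using l(1-4) disj[of 1 2] disj[of 3 2] disj[of 5 6] disj[of 7 6] by auto
    show "B 2 \<inter> B 4 = {}" "B 6 \<inter> B 4 = {}" by (rule disj; simp)+
  qed (use B l in simp_all)
  then show ?thesis by blast
qed

lemma model_imp_H2_bags:
  assumes "pair_graph G" "simple_graph.model (pverts G) (parcs G) a b c d v X Y"
  shows "\<exists>B. bags G H2 B"
proof -
  interpret simple_graph "pverts G" "parcs G" using assms(1) by (rule simple_graph_pair_graph)
  note m = assms(2)
  \<comment> \<open>The vertices of \<open>H2\<close> start at 1; the list entry at position 0 is a
    dummy.\<close>
  let ?B = "\<lambda>h. [{}, {a}, X, {b}, {v}, {c}, Y, {d}] ! h"
  have sing: "touch (parcs G) {p} {q} \<longleftrightarrow> (p, q) \<in> parcs G" for p q by (simp add: touch_def)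
  have 1: "a \<noteq> b" "a \<noteq> c" "a \<noteq> d" "a \<noteq> v" "b \<noteq> c" "b \<noteq> d" "b \<noteq> v" "c \<noteq> d" "c \<noteq> v" "d \<noteq> v"
    "(a, b) \<notin> parcs G" "(a, c) \<notin> parcs G" "(a, d) \<notin> parcs G" "(a, v) \<notin> parcs G" "(b, c) \<notin> parcs G"
    "(b, d) \<notin> parcs G" "(b, v) \<notin> parcs G" "(c, d) \<notin> parcs G" "(c, v) \<notin> parcs G" "(d, v) \<notin> parcs G"
    using m by (auto simp: model_def apart_def)
  have 2: "(q, p) \<notin> parcs G" if "(p, q) \<notin> parcs G" for p q using that adj_sym by blast
  have 3: "touch (parcs G) {a} X" "touch (parcs G) {b} X" "touch (parcs G) {v} X"
    "touch (parcs G) {c} Y" "touch (parcs G) {d} Y" "touch (parcs G) {v} Y"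
    "\<not> touch (parcs G) {c} X" "\<not> touch (parcs G) {d} X" "\<not> touch (parcs G) {a} Y" "\<not> touch (parcs G) {b} Y"
    "\<not> touch (parcs G) X Y" "X \<inter> Y = {}"
    "a \<notin> X" "b \<notin> X" "c \<notin> X" "d \<notin> X" "v \<notin> X" "a \<notin> Y" "b \<notin> Y" "c \<notin> Y" "d \<notin> Y" "v \<notin> Y"
    using m by (auto simp: model_def apart_def touch_def)
  have 4: "touch (parcs G) X {p} \<longleftrightarrow> touch (parcs G) {p} X" "touch (parcs G) Y {p} \<longleftrightarrow> touch (parcs G) {p} Y"
    "touch (parcs G) Y X \<longleftrightarrow> touch (parcs G) X Y" for p by (rule touch_sym)+
  have 5: "Y \<inter> X = {}" using 3(12) by blast
  have "conn (parcs G) X" "conn (parcs G) Y" "X \<subseteq> pverts G" "Y \<subseteq> pverts G" using m by (simp_all add: model_def)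
  then have "bags G H2 ?B"
    using model_in_V[OF m] unfolding bags_def pverts_H2
    by (simp add: parcs_H2 sing 1 1(1-10)[THEN not_sym] 2[OF 1(11)] 2[OF 1(12)] 2[OF 1(13)] 2[OF 1(14)] 2[OF 1(15)]
      2[OF 1(16)] 2[OF 1(17)] 2[OF 1(18)] 2[OF 1(19)] 2[OF 1(20)] 3 4 5)
  then show ?thesis by blast
qed

lemma contains_H2_iff_criterion:
  assumes "pair_graph G"
  shows "contains_induced_minor G H2 \<longleftrightarrow> simple_graph.criterion (pverts G) (parcs G)"
  using contains_induced_minor_imp_bags[OF _ assms] bags_imp_contains_induced_minor[OF _ assms pair_graph_H2]
    H2_bags_imp_model[OF _ assms] model_imp_H2_bags[OF assms]
    simple_graph.criterion_iff[OF simple_graph_pair_graph[OF assms]]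
  by metis

section \<open>Structured programs for the random access machine\<close>

definition code_at :: "instr list \<Rightarrow> nat \<Rightarrow> instr list \<Rightarrow> bool" where
  "code_at P pc is \<longleftrightarrow> (\<exists>pre post. P = pre @ is @ post \<and> length pre = pc)"

definition reaches :: "instr list \<Rightarrow> bool list \<Rightarrow> nat \<Rightarrow> config \<Rightarrow> config \<Rightarrow> bool" where
  "reaches P w T s s' \<longleftrightarrow> (\<exists>t\<le>T. (ram_step P w ^^ t) s = s')"

text \<open>Code fragments are parametrised by their load address because jump targets are absolute.\<close>
type_synonym code = "nat \<Rightarrow> instr list"

text \<open>Quantifying over all surrounding programs and load addresses makes fragments composable.
  Control leaves a fragment just behind its last instruction.\<close>

definition runs :: "code \<Rightarrow> bool list \<Rightarrow> nat \<Rightarrow> (nat \<Rightarrow> nat) \<Rightarrow> (nat \<Rightarrow> nat) \<Rightarrow> bool" where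
  "runs c w T X X' \<longleftrightarrow> (\<forall>P pc. code_at P pc (c pc) \<longrightarrow> reaches P w T (pc, X) (pc + length (c pc), X'))"

lemma code_at_append:
  assumes "code_at P pc (is @ js)"
  shows "code_at P pc is" "code_at P (pc + length is) js"
proof -
  obtain pre post where P: "P = pre @ is @ js @ post" "length pre = pc"
    using assms by (auto simp: code_at_def)
  show "code_at P pc is" using P by (auto simp: code_at_def)
  have "P = (pre @ is) @ js @ post" "length (pre @ is) = pc + length is" using P by auto
  then show "code_at P (pc + length is) js" unfolding code_at_def by blast
qed

lemma code_at_Cons:
  assumes "code_at P pc (i # is)"
  shows "pc < length P" "P ! pc = i" "code_at P (Suc pc) is"
proof -
  show "pc < length P" "P ! pc = i" using assms by (auto simp: code_at_def)
  show "code_at P (Suc pc) is" using code_at_append(2)[of P pc "[i]" "is"] assms by simp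
qed

lemma reaches_refl: "reaches P w T s s"
  by (auto simp: reaches_def intro: exI[of _ 0])

lemma reaches_mono: "reaches P w T s s' \<Longrightarrow> T \<le> T' \<Longrightarrow> reaches P w T' s s'"
  unfolding reaches_def using le_trans by blast

lemma reaches_trans:
  assumes "reaches P w T s s'" "reaches P w T' s' s''"
  shows "reaches P w (T + T') s s''"
proof -
  obtain t t' where "t \<le> T" "(ram_step P w ^^ t) s = s'" "t' \<le> T'" "(ram_step P w ^^ t') s' = s''"
    using assms by (auto simp: reaches_def)
  then have "t' + t \<le> T + T'" "(ram_step P w ^^ (t' + t)) s = s''" by (auto simp: funpow_add)
  then show ?thesis unfolding reaches_def by blast
qed

lemma reaches_step:
  assumes "code_at P pc (i # is)" "reaches P w T (exec_instr w i (pc, X)) s"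
  shows "reaches P w (Suc T) (pc, X) s"
proof -
  have "ram_step P w (pc, X) = exec_instr w i (pc, X)"
    using code_at_Cons[OF assms(1)] by (simp add: ram_step_def halted_def)
  then have "reaches P w 1 (pc, X) (exec_instr w i (pc, X))"
    by (auto simp: reaches_def intro!: exI[of _ 1])
  then show ?thesis using reaches_trans[OF _ assms(2)] by fastforce
qed

lemma runs_mono: "runs c w T X X' \<Longrightarrow> T \<le> T' \<Longrightarrow> runs c w T' X X'"
  unfolding runs_def using reaches_mono by blast

lemma runsD:
  "runs c w T X X' \<Longrightarrow> code_at P pc (c pc) \<Longrightarrow> reaches P w T (pc, X) (pc + length (c pc), X')"
  by (simp add: runs_def)

definition op :: "instr \<Rightarrow> code" where
  "op i = (\<lambda>pc. [i])"

definition seq :: "code \<Rightarrow> code \<Rightarrow> code" (infixr ";;" 60) where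
  "c ;; c' = (\<lambda>pc. c pc @ c' (pc + length (c pc)))"

lemma runs_op:
  assumes "\<And>pc. exec_instr w i (pc, X) = (Suc pc, X')"
  shows "runs (op i) w 1 X X'"
  unfolding runs_def op_def
  using reaches_step[of _ _ i "[]" w 0] assms reaches_refl by fastforce

lemma runs_SET: "runs (op (SET r k)) w 1 X (X(r := k))"
  and runs_ADD: "runs (op (ADD r i j)) w 1 X (X(r := X i + X j))"
  and runs_SUB: "runs (op (SUB r i j)) w 1 X (X(r := X i - X j))"
  and runs_READ: "runs (op (READ r i)) w 1 X (X(r := (if X i < length w \<and> w ! X i then 1 else 0)))"
  and runs_LOAD: "runs (op (LOAD r i)) w 1 X (X(r := X (X i)))"
  and runs_STORE: "runs (op (STORE i r)) w 1 X (X(X i := X r))"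
  by (rule runs_op; simp)+

lemma runs_seq:
  assumes "runs c w T X Y" "runs c' w T' Y Z"
  shows "runs (c ;; c') w (T + T') X Z"
  unfolding runs_def
proof (intro allI impI)
  fix P pc assume "code_at P pc ((c ;; c') pc)"
  from code_at_append[OF this[unfolded seq_def]]
  have "reaches P w T (pc, X) (pc + length (c pc), Y)"
    "reaches P w T' (pc + length (c pc), Y) (pc + length (c pc) + length (c' (pc + length (c pc))), Z)"
    using assms by (auto simp: runs_def)
  from reaches_trans[OF this] show "reaches P w (T + T') (pc, X) (pc + length ((c ;; c') pc), Z)"
    by (simp add: seq_def add.assoc)
qed

text \<open>Register 1 always holds 1, which also makes \<open>JPOS 1\<close> an unconditional jump. Register 2
  holds the number of vertices, register 3 is scratch, register 4 holds truth values.\<close>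

definition guarded :: "nat \<Rightarrow> code \<Rightarrow> code" where
  "guarded r c = (\<lambda>pc. [SUB 3 1 r, JPOS 3 (Suc (Suc (pc + length (c (Suc (Suc pc))))))] @ c (Suc (Suc pc)))"

lemma runs_guarded_true:
  assumes "X 1 = 1" "X r > 0" "runs c w T (X(3 := 0)) X'"
  shows "runs (guarded r c) w (T + 2) X X'"
  unfolding runs_def
proof (intro allI impI)
  fix P pc assume "code_at P pc (guarded r c pc)"
  then have c1: "code_at P pc (SUB 3 1 r # JPOS 3 (Suc (Suc (pc + length (c (Suc (Suc pc)))))) # c (Suc (Suc pc)))"
    by (simp add: guarded_def)
  note c2 = code_at_Cons(3)[OF c1]
  have "reaches P w T (Suc (Suc pc), X(3 := 0)) (Suc (Suc (pc + length (c (Suc (Suc pc))))), X')"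
    using runsD[OF assms(3) code_at_Cons(3)[OF c2]] by simp
  then have "reaches P w (Suc T) (Suc pc, X(3 := 0)) (Suc (Suc (pc + length (c (Suc (Suc pc))))), X')"
    by (intro reaches_step[OF c2]) simp
  then have "reaches P w (Suc (Suc T)) (pc, X) (Suc (Suc (pc + length (c (Suc (Suc pc))))), X')"
    using assms by (intro reaches_step[OF c1]) simp
  then show "reaches P w (T + 2) (pc, X) (pc + length (guarded r c pc), X')"
    by (simp add: guarded_def)
qed

text \<open>The bound is the one for an executed body, so that both outcomes of the test share one
  time bound.\<close>

lemma runs_guarded_false:
  assumes "X 1 = 1" "X r = 0"
  shows "runs (guarded r c) w (T + 2) X (X(3 := 1))"
  unfolding runs_def
proof (intro allI impI)
  fix P pc assume "code_at P pc (guarded r c pc)"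
  then have c1: "code_at P pc (SUB 3 1 r # JPOS 3 (Suc (Suc (pc + length (c (Suc (Suc pc)))))) # c (Suc (Suc pc)))"
    by (simp add: guarded_def)
  note c2 = code_at_Cons(3)[OF c1]
  have "reaches P w (Suc 0) (Suc pc, X(3 := 1)) (Suc (Suc (pc + length (c (Suc (Suc pc))))), X(3 := 1))"
    by (intro reaches_step[OF c2]) (simp add: reaches_refl)
  then have "reaches P w (Suc (Suc 0)) (pc, X) (Suc (Suc (pc + length (c (Suc (Suc pc))))), X(3 := 1))"
    using assms by (intro reaches_step[OF c1]) simp
  from reaches_mono[OF this, of "T + 2"]
  show "reaches P w (T + 2) (pc, X) (pc + length (guarded r c pc), X(3 := 1))"
    by (simp add: guarded_def)
qed

section \<open>Loops and their time bounds\<close>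

definition count_loop :: "nat \<Rightarrow> nat \<Rightarrow> code \<Rightarrow> code" where
  "count_loop r b c = (\<lambda>pc. let body = c (Suc (Suc pc)); l = length body in
     [SET r 0, JPOS 1 (Suc (Suc (Suc (pc + l))))] @ body @ [ADD r r 1, SUB 3 b r, JPOS 3 (Suc (Suc pc))])"

text \<open>\<open>Inv k\<close> describes the state in which the test is reached with counter
  \<open>k\<close>. A round costs two instructions for the test, the body and the increment; the
  additional 4 are the two instructions of the entry and the final failing test. Entering the loop
  at the test covers \<open>N = 0\<close>.\<close>

lemma runs_count_loop:
  assumes one: "X 1 = 1" "r \<noteq> 1" and init: "Inv 0 (X(r := 0))"
    and body: "\<And>k Y. k < N \<Longrightarrow> Inv k Y \<Longrightarrow> \<exists>Y'. runs c w T Y Y' \<and> Inv (Suc k) (Y'(r := Y' r + Y' 1))"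
    and inv: "\<And>k Y. Inv k Y \<Longrightarrow> Y r = k \<and> Y b = N"
    and scratch: "\<And>k Y z. Inv k Y \<Longrightarrow> Inv k (Y(3 := z))"
  shows "\<exists>X'. runs (count_loop r b c) w (N * (T + 3) + 4) X X' \<and> Inv N X'"
proof -
  define test where "test pc = Suc (Suc (Suc (pc + length (c (Suc (Suc pc))))))" for pc
  have loop: "\<exists>X'. Inv N X' \<and> (\<forall>P pc. code_at P pc (count_loop r b c pc) \<longrightarrow>
      reaches P w ((N - k) * (T + 3) + 2) (test pc, Y) (Suc (Suc (test pc)), X'))" if "k \<le> N" "Inv k Y" for k Y
    using that
  proof (induction "N - k" arbitrary: k Y)
    case 0
    then have "k = N" by simp
    let ?X' = "Y(3 := 0)"
    have "reaches P w 2 (test pc, Y) (Suc (Suc (test pc)), ?X')" if "code_at P pc (count_loop r b c pc)" for P pc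
    proof -
      have "code_at P pc ([SET r 0, JPOS 1 (test pc)] @ (c (Suc (Suc pc)) @ [ADD r r 1, SUB 3 b r, JPOS 3 (Suc (Suc pc))]))"
        using that by (simp add: count_loop_def Let_def test_def)
      from code_at_append(2)[OF code_at_append(2)[OF this]]
      have a: "code_at P (Suc (Suc (pc + length (c (Suc (Suc pc)))))) [ADD r r 1, SUB 3 b r, JPOS 3 (Suc (Suc pc))]" by simp
      have t1: "code_at P (test pc) [SUB 3 b r, JPOS 3 (Suc (Suc pc))]"
        using code_at_Cons(3)[OF a] by (simp add: test_def)
      note t2 = code_at_Cons(3)[OF t1]
      have "reaches P w (Suc 0) (Suc (test pc), ?X') (Suc (Suc (test pc)), ?X')"
        by (rule reaches_step[OF t2]) (simp add: reaches_refl)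
      then have "reaches P w (Suc (Suc 0)) (test pc, Y) (Suc (Suc (test pc)), ?X')"
        using inv[OF 0(3)] \<open>k = N\<close> by (intro reaches_step[OF t1]) simp
      then show ?thesis by (simp add: numeral_2_eq_2)
    qed
    then show ?case
      using scratch[OF 0(3)] \<open>k = N\<close> by (intro exI[of _ ?X']) (simp add: numeral_2_eq_2 del: fun_upd_apply)
  next
    case (Suc m)
    then have k: "k < N" "m = N - Suc k" by auto
    obtain Y' where Y': "runs c w T (Y(3 := N - k)) Y'" "Inv (Suc k) (Y'(r := Y' r + Y' 1))"
      using body[OF k(1) scratch[OF Suc.prems(2)]] by blast
    obtain X' where X': "Inv N X'" "\<And>P pc. code_at P pc (count_loop r b c pc) \<Longrightarrow>
        reaches P w (m * (T + 3) + 2) (test pc, Y'(r := Y' r + Y' 1)) (Suc (Suc (test pc)), X')"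
      using Suc.hyps(1)[OF k(2) _ Y'(2)] k by auto
    have "reaches P w ((N - k) * (T + 3) + 2) (test pc, Y) (Suc (Suc (test pc)), X')" if code: "code_at P pc (count_loop r b c pc)" for P pc
    proof -
      have "code_at P pc ([SET r 0, JPOS 1 (test pc)] @ (c (Suc (Suc pc)) @ [ADD r r 1, SUB 3 b r, JPOS 3 (Suc (Suc pc))]))"
        using code by (simp add: count_loop_def Let_def test_def)
      note app = code_at_append[OF code_at_append(2)[OF this], simplified]
      have a: "code_at P (Suc (Suc (pc + length (c (Suc (Suc pc)))))) [ADD r r 1, SUB 3 b r, JPOS 3 (Suc (Suc pc))]"
        using app(2) by simp
      have t1: "code_at P (test pc) [SUB 3 b r, JPOS 3 (Suc (Suc pc))]"
        using code_at_Cons(3)[OF a] by (simp add: test_def)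
      note t2 = code_at_Cons(3)[OF t1]
      have "reaches P w (Suc (m * (T + 3) + 2)) (Suc (Suc (pc + length (c (Suc (Suc pc))))), Y') (Suc (Suc (test pc)), X')"
        using X'(2)[OF code] by (intro reaches_step[OF a]) (simp add: test_def)
      moreover have "reaches P w T (Suc (Suc pc), Y(3 := N - k)) (Suc (Suc (pc + length (c (Suc (Suc pc))))), Y')"
        using runsD[OF Y'(1) app(1)] by simp
      ultimately have "reaches P w (T + Suc (m * (T + 3) + 2)) (Suc (Suc pc), Y(3 := N - k)) (Suc (Suc (test pc)), X')"
        using reaches_trans by blast
      then have "reaches P w (Suc (T + Suc (m * (T + 3) + 2))) (Suc (test pc), Y(3 := N - k)) (Suc (Suc (test pc)), X')"
        using k by (intro reaches_step[OF t2]) simp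
      then have "reaches P w (Suc (Suc (T + Suc (m * (T + 3) + 2)))) (test pc, Y) (Suc (Suc (test pc)), X')"
        using inv[OF Suc.prems(2)] by (intro reaches_step[OF t1]) simp
      moreover have "Suc (Suc (T + Suc (m * (T + 3) + 2))) = (N - k) * (T + 3) + 2"
        using Suc.hyps(2)[symmetric] by simp
      ultimately show ?thesis by simp
    qed
    then show ?case using X'(1) by blast
  qed
  obtain X' where X': "Inv N X'" "\<And>P pc. code_at P pc (count_loop r b c pc) \<Longrightarrow>
      reaches P w (N * (T + 3) + 2) (test pc, X(r := 0)) (Suc (Suc (test pc)), X')"
    using loop[OF _ init] by auto
  have "runs (count_loop r b c) w (N * (T + 3) + 4) X X'"
    unfolding runs_def
  proof (intro allI impI)
    fix P pc assume code: "code_at P pc (count_loop r b c pc)"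
    then have c1: "code_at P pc (SET r 0 # JPOS 1 (test pc) # c (Suc (Suc pc)) @ [ADD r r 1, SUB 3 b r, JPOS 3 (Suc (Suc pc))])"
      by (simp add: count_loop_def Let_def test_def)
    note c2 = code_at_Cons(3)[OF c1]
    have "reaches P w (Suc (N * (T + 3) + 2)) (Suc pc, X(r := 0)) (Suc (Suc (test pc)), X')"
      using X'(2)[OF code] one by (intro reaches_step[OF c2]) simp
    then have "reaches P w (Suc (Suc (N * (T + 3) + 2))) (pc, X) (Suc (Suc (test pc)), X')"
      by (intro reaches_step[OF c1]) simp
    then show "reaches P w (N * (T + 3) + 4) (pc, X) (pc + length (count_loop r b c pc), X')"
      by (simp add: count_loop_def Let_def test_def eval_nat_numeral)
  qed
  then show ?thesis using X'(1) by blast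
qed

definition search :: "nat \<Rightarrow> code \<Rightarrow> code" where
  "search r c = (\<lambda>pc. let body = c (Suc (Suc pc)); l = length body in
     [SET r 0, JPOS 1 (Suc (Suc (Suc (Suc (pc + l)))))] @ body @
     [JPOS 4 (Suc (Suc (Suc (Suc (Suc (Suc (pc + l))))))), ADD r r 1, SUB 4 2 r, JPOS 4 (Suc (Suc pc))])"

text \<open>Register 4 carries both the verdict of the body and the result of the loop test: an
  early exit keeps the 1 of the body, and the failing final test leaves 0, so the answer is right on
  both exits. The final counter is left open for the same reason.\<close>

lemma runs_search:
  assumes one: "X 1 = 1" "r \<noteq> 1" and init: "Inv 0 (X(r := 0))"
    and body: "\<And>k Y. k < N \<Longrightarrow> Inv k Y \<Longrightarrow> \<exists>Y'. runs c w T Y Y' \<and> Inv k Y' \<and> Y' 4 = (if Q k then 1 else 0)"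
    and inv: "\<And>k Y. Inv k Y \<Longrightarrow> Y r = k \<and> Y 2 = N \<and> Y 1 = 1"
    and scratch: "\<And>k Y z. Inv k Y \<Longrightarrow> Inv k (Y(4 := z))"
    and inc: "\<And>k Y. Inv k Y \<Longrightarrow> Inv (Suc k) (Y(r := Suc k))"
  shows "\<exists>X' k. runs (search r c) w (N * (T + 4) + 4) X X' \<and> Inv k X' \<and> X' 4 = (if \<exists>k<N. Q k then 1 else 0)"
proof -
  define test where "test pc = Suc (Suc (Suc (Suc (pc + length (c (Suc (Suc pc)))))))" for pc
  have loop: "\<exists>X' k'. Inv k' X' \<and> X' 4 = (if \<exists>k'<N. k \<le> k' \<and> Q k' then 1 else 0) \<and>
     (\<forall>P pc. code_at P pc (search r c pc) \<longrightarrow>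
      reaches P w ((N - k) * (T + 4) + 2) (test pc, Y) (Suc (Suc (test pc)), X'))" if "k \<le> N" "Inv k Y" for k Y
    using that
  proof (induction "N - k" arbitrary: k Y)
    case 0
    then have "k = N" by simp
    let ?X' = "Y(4 := 0)"
    have "reaches P w 2 (test pc, Y) (Suc (Suc (test pc)), ?X')" if "code_at P pc (search r c pc)" for P pc
    proof -
      have "code_at P pc ([SET r 0, JPOS 1 (test pc)] @ (c (Suc (Suc pc)) @ [JPOS 4 (Suc (Suc (test pc))), ADD r r 1, SUB 4 2 r, JPOS 4 (Suc (Suc pc))]))"
        using that by (simp add: search_def Let_def test_def)
      from code_at_append(2)[OF code_at_append(2)[OF this]]
      have a: "code_at P (Suc (Suc (pc + length (c (Suc (Suc pc)))))) [JPOS 4 (Suc (Suc (test pc))), ADD r r 1, SUB 4 2 r, JPOS 4 (Suc (Suc pc))]" by simp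
      have t1: "code_at P (test pc) [SUB 4 2 r, JPOS 4 (Suc (Suc pc))]"
        using code_at_Cons(3)[OF code_at_Cons(3)[OF a]] by (simp add: test_def)
      note t2 = code_at_Cons(3)[OF t1]
      have "reaches P w (Suc 0) (Suc (test pc), ?X') (Suc (Suc (test pc)), ?X')"
        by (rule reaches_step[OF t2]) (simp add: reaches_refl)
      then have "reaches P w (Suc (Suc 0)) (test pc, Y) (Suc (Suc (test pc)), ?X')"
        using inv[OF 0(3)] \<open>k = N\<close> by (intro reaches_step[OF t1]) simp
      then show ?thesis by (simp add: numeral_2_eq_2)
    qed
    moreover have "?X' 4 = 0" by simp
    ultimately show ?case
      using scratch[OF 0(3)] \<open>k = N\<close> by (intro exI[of _ ?X'] exI[of _ k]) (simp add: numeral_2_eq_2 del: fun_upd_apply)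
  next
    case (Suc m)
    then have k: "k < N" "m = N - Suc k" by auto
    obtain Y' where Y': "runs c w T (Y(4 := N - k)) Y'" "Inv k Y'" "Y' 4 = (if Q k then 1 else 0)"
      using body[OF k(1) scratch[OF Suc.prems(2)]] by blast
    have pre: "reaches P w (T + Suc T') (Suc (test pc), Y(4 := N - k)) s"
      if code: "code_at P pc (search r c pc)" and "reaches P w T' (Suc (Suc (pc + length (c (Suc (Suc pc))))), Y') s" for P pc s T'
    proof -
      have "code_at P pc ([SET r 0, JPOS 1 (test pc)] @ (c (Suc (Suc pc)) @ [JPOS 4 (Suc (Suc (test pc))), ADD r r 1, SUB 4 2 r, JPOS 4 (Suc (Suc pc))]))"
        using code by (simp add: search_def Let_def test_def)
      note app = code_at_append[OF code_at_append(2)[OF this], simplified]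
      have a: "code_at P (Suc (Suc (pc + length (c (Suc (Suc pc)))))) [JPOS 4 (Suc (Suc (test pc))), ADD r r 1, SUB 4 2 r, JPOS 4 (Suc (Suc pc))]"
        using app(2) by simp
      have t1: "code_at P (test pc) [SUB 4 2 r, JPOS 4 (Suc (Suc pc))]"
        using code_at_Cons(3)[OF code_at_Cons(3)[OF a]] by (simp add: test_def)
      have "reaches P w T (Suc (Suc pc), Y(4 := N - k)) (Suc (Suc (pc + length (c (Suc (Suc pc))))), Y')"
        using runsD[OF Y'(1) app(1)] by simp
      then have "reaches P w (T + T') (Suc (Suc pc), Y(4 := N - k)) s" using that(2) reaches_trans by blast
      then have "reaches P w (Suc (T + T')) (Suc (test pc), Y(4 := N - k)) s"
        using k by (intro reaches_step[OF code_at_Cons(3)[OF t1]]) simp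
      then show ?thesis by simp
    qed
    have first: "reaches P w (Suc T') (test pc, Y) s"
      if code: "code_at P pc (search r c pc)" and "reaches P w T' (Suc (test pc), Y(4 := N - k)) s" for P pc s T'
    proof -
      have "code_at P pc ([SET r 0, JPOS 1 (test pc)] @ (c (Suc (Suc pc)) @ [JPOS 4 (Suc (Suc (test pc))), ADD r r 1, SUB 4 2 r, JPOS 4 (Suc (Suc pc))]))"
        using code by (simp add: search_def Let_def test_def)
      from code_at_append(2)[OF code_at_append(2)[OF this]]
      have a: "code_at P (Suc (Suc (pc + length (c (Suc (Suc pc)))))) [JPOS 4 (Suc (Suc (test pc))), ADD r r 1, SUB 4 2 r, JPOS 4 (Suc (Suc pc))]" by simp
      have t1: "code_at P (test pc) [SUB 4 2 r, JPOS 4 (Suc (Suc pc))]"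
        using code_at_Cons(3)[OF code_at_Cons(3)[OF a]] by (simp add: test_def)
      show ?thesis using that(2) inv[OF Suc.prems(2)] by (intro reaches_step[OF t1]) simp
    qed
    have tail: "code_at P (Suc (Suc (pc + length (c (Suc (Suc pc)))))) [JPOS 4 (Suc (Suc (test pc))), ADD r r 1, SUB 4 2 r, JPOS 4 (Suc (Suc pc))]"
      if "code_at P pc (search r c pc)" for P pc
    proof -
      have "code_at P pc ([SET r 0, JPOS 1 (test pc)] @ (c (Suc (Suc pc)) @ [JPOS 4 (Suc (Suc (test pc))), ADD r r 1, SUB 4 2 r, JPOS 4 (Suc (Suc pc))]))"
        using that by (simp add: search_def Let_def test_def)
      from code_at_append(2)[OF code_at_append(2)[OF this]] show ?thesis by simp
    qed
    show ?case
    proof (cases "Q k")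
      case True
      have "reaches P w ((N - k) * (T + 4) + 2) (test pc, Y) (Suc (Suc (test pc)), Y')" if code: "code_at P pc (search r c pc)" for P pc
      proof -
        have "reaches P w (Suc 0) (Suc (Suc (pc + length (c (Suc (Suc pc))))), Y') (Suc (Suc (test pc)), Y')"
          using True Y'(3) by (intro reaches_step[OF tail[OF code]]) (simp add: reaches_refl)
        from first[OF code pre[OF code this]]
        show ?thesis by (rule reaches_mono) (use Suc.hyps(2)[symmetric] in simp)
      qed
      then show ?thesis using Y' True k by (intro exI[of _ Y'] exI[of _ k]) auto
    next
      case False
      have Y'': "Inv (Suc k) (Y'(r := Suc k))" using inc[OF Y'(2)] .
      obtain X' k' where X': "Inv k' X'" "X' 4 = (if \<exists>k'<N. Suc k \<le> k' \<and> Q k' then 1 else 0)"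
        "\<And>P pc. code_at P pc (search r c pc) \<Longrightarrow>
          reaches P w (m * (T + 4) + 2) (test pc, Y'(r := Suc k)) (Suc (Suc (test pc)), X')"
        using Suc.hyps(1)[OF k(2) _ Y''] k by auto
      have "reaches P w ((N - k) * (T + 4) + 2) (test pc, Y) (Suc (Suc (test pc)), X')" if code: "code_at P pc (search r c pc)" for P pc
      proof -
        have "reaches P w (Suc (m * (T + 4) + 2)) (Suc (Suc (Suc (pc + length (c (Suc (Suc pc)))))), Y') (Suc (Suc (test pc)), X')"
          using X'(3)[OF code] inv[OF Y'(2)]
          by (intro reaches_step[OF code_at_Cons(3)[OF tail[OF code]]]) (simp add: test_def eval_nat_numeral)
        then have "reaches P w (Suc (Suc (m * (T + 4) + 2))) (Suc (Suc (pc + length (c (Suc (Suc pc))))), Y') (Suc (Suc (test pc)), X')"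
          using False Y'(3) by (intro reaches_step[OF tail[OF code]]) simp
        from first[OF code pre[OF code this]]
        show ?thesis by (rule reaches_mono) (use Suc.hyps(2)[symmetric] in simp)
      qed
      moreover have "(\<exists>k'<N. Suc k \<le> k' \<and> Q k') \<longleftrightarrow> (\<exists>k'<N. k \<le> k' \<and> Q k')"
        using False by (metis Suc_leD Suc_leI le_neq_implies_less)
      ultimately show ?thesis using X'(1,2) by (intro exI[of _ X'] exI[of _ k']) auto
    qed
  qed
  obtain X' k' where X': "Inv k' X'" "X' 4 = (if \<exists>k'<N. Q k' then 1 else 0)"
    "\<And>P pc. code_at P pc (search r c pc) \<Longrightarrow>
      reaches P w (N * (T + 4) + 2) (test pc, X(r := 0)) (Suc (Suc (test pc)), X')"
    using loop[OF _ init] by auto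
  have "runs (search r c) w (N * (T + 4) + 4) X X'"
    unfolding runs_def
  proof (intro allI impI)
    fix P pc assume code: "code_at P pc (search r c pc)"
    then have c1: "code_at P pc (SET r 0 # JPOS 1 (test pc) # c (Suc (Suc pc)) @ [JPOS 4 (Suc (Suc (test pc))), ADD r r 1, SUB 4 2 r, JPOS 4 (Suc (Suc pc))])"
      by (simp add: search_def Let_def test_def)
    note c2 = code_at_Cons(3)[OF c1]
    have "reaches P w (Suc (N * (T + 4) + 2)) (Suc pc, X(r := 0)) (Suc (Suc (test pc)), X')"
      using X'(3)[OF code] one by (intro reaches_step[OF c2]) simp
    then have "reaches P w (Suc (Suc (N * (T + 4) + 2))) (pc, X) (Suc (Suc (test pc)), X')"
      by (intro reaches_step[OF c1]) simp
    then show "reaches P w (N * (T + 4) + 4) (pc, X) (pc + length (search r c pc), X')"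
      by (simp add: search_def Let_def test_def eval_nat_numeral)
  qed
  then show ?thesis using X'(1,2) by blast
qed

section \<open>First-order logic with reachability\<close>

datatype fm = Adj nat nat | Eq nat nat | Neg fm | Conj fm fm | Exists fm | Reach fm nat nat

text \<open>Variables are de Bruijn levels: at depth \<open>d\<close> the variables below \<open>d\<close> are bound, and a
  binder (\<open>Exists\<close> or \<open>Reach\<close>) binds variable \<open>d\<close>.\<close>
fun sat :: "'a set \<Rightarrow> 'a rel \<Rightarrow> nat \<Rightarrow> (nat \<Rightarrow> 'a) \<Rightarrow> fm \<Rightarrow> bool" where
  "sat V E d e (Adj i j) \<longleftrightarrow> (e i, e j) \<in> E"
| "sat V E d e (Eq i j) \<longleftrightarrow> e i = e j"
| "sat V E d e (Neg \<phi>) \<longleftrightarrow> \<not> sat V E d e \<phi>"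
| "sat V E d e (Conj \<phi> \<psi>) \<longleftrightarrow> sat V E d e \<phi> \<and> sat V E d e \<psi>"
| "sat V E d e (Exists \<phi>) \<longleftrightarrow> (\<exists>u\<in>V. sat V E (Suc d) (e(d := u)) \<phi>)"
| "sat V E d e (Reach \<phi> i j) \<longleftrightarrow> e j \<in> component E {u \<in> V. sat V E (Suc d) (e(d := u)) \<phi>} (e i)"

text \<open>Reachability operators are not nested, because all searches share the same marks and the
  registers 7, 8 and 9.\<close>

fun reach_free :: "fm \<Rightarrow> bool" where
  "reach_free (Neg \<phi>) \<longleftrightarrow> reach_free \<phi>"
| "reach_free (Conj \<phi> \<psi>) \<longleftrightarrow> reach_free \<phi> \<and> reach_free \<psi>"
| "reach_free (Exists \<phi>) \<longleftrightarrow> reach_free \<phi>"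
| "reach_free (Reach \<phi> i j) \<longleftrightarrow> False"
| "reach_free _ \<longleftrightarrow> True"

fun wf_fm :: "nat \<Rightarrow> fm \<Rightarrow> bool" where
  "wf_fm d (Adj i j) \<longleftrightarrow> i < d \<and> j < d"
| "wf_fm d (Eq i j) \<longleftrightarrow> i < d \<and> j < d"
| "wf_fm d (Neg \<phi>) \<longleftrightarrow> wf_fm d \<phi>"
| "wf_fm d (Conj \<phi> \<psi>) \<longleftrightarrow> wf_fm d \<phi> \<and> wf_fm d \<psi>"
| "wf_fm d (Exists \<phi>) \<longleftrightarrow> wf_fm (Suc d) \<phi>"
| "wf_fm d (Reach \<phi> i j) \<longleftrightarrow> reach_free \<phi> \<and> wf_fm (Suc d) \<phi> \<and> i < d \<and> j < d"

section \<open>Compilation of formulas\<close>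

text \<open>Variables live in the even registers from 12 on, the marks of the reachability search in the
  odd registers from 13 on.\<close>

definition var :: "nat \<Rightarrow> nat" where "var i = 2 * i + 12"
definition mark :: "nat \<Rightarrow> nat" where "mark i = 2 * i + 13"

lemma var_mark_simps [simp]:
  "var i = var j \<longleftrightarrow> i = j" "mark i = mark j \<longleftrightarrow> i = j" "var i \<noteq> mark j" "mark j \<noteq> var i"
  by (simp_all add: var_def mark_def) presburger+

lemma small_neq_var_mark [simp]:
  assumes "k < 12"
  shows "k \<noteq> var i" "k \<noteq> mark i" "var i \<noteq> k" "mark i \<noteq> k"
  using assms by (simp_all add: var_def mark_def)

lemma less_var [simp]: "k < 12 \<Longrightarrow> k < var i"
  by (simp add: var_def)

lemma not_var_le [simp]: "k < 12 \<Longrightarrow> \<not> var i \<le> k"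
  by (simp add: var_def)

definition unchanged :: "nat set \<Rightarrow> (nat \<Rightarrow> nat) \<Rightarrow> (nat \<Rightarrow> nat) \<Rightarrow> bool" where
  "unchanged D X X' \<longleftrightarrow> (\<forall>r. r \<notin> D \<longrightarrow> X' r = X r)"

text \<open>The machine cannot multiply, so the position of the matrix entry is built by adding the
  number of vertices to the column index once per preceding row.\<close>

definition adj_code :: "nat \<Rightarrow> nat \<Rightarrow> code" where
  "adj_code a b = op (SET 6 0) ;; op (ADD 6 6 b) ;; count_loop 5 a (op (ADD 6 6 2)) ;; op (READ 4 6)"

text \<open>Subtraction is truncated, so the two differences vanish together exactly when the
  contents agree.\<close>

definition eq_code :: "nat \<Rightarrow> nat \<Rightarrow> code" where
  "eq_code a b = op (SUB 3 a b) ;; op (SUB 4 b a) ;; op (ADD 3 3 4) ;; op (SUB 4 1 3)"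

definition mark_addr :: "nat \<Rightarrow> code" where
  "mark_addr r = op (ADD 9 r r) ;; op (SET 3 13) ;; op (ADD 9 9 3)"

definition expand_code :: "nat \<Rightarrow> code \<Rightarrow> code" where
  "expand_code z c = mark_addr 8 ;; op (LOAD 4 9) ;;
     guarded 4 (adj_code 8 z ;; guarded 4 (c ;; guarded 4 (mark_addr z ;; op (STORE 9 1))))"

text \<open>The start vertex is marked if it satisfies the formula, and each round then examines all
  ordered pairs of vertices. The number of rounds is \<open>n * n\<close>, which is at hand in
  register 0 and bounds the number of edges, hence the number of steps needed to reach a
  vertex.\<close>

definition reach_code :: "nat \<Rightarrow> code \<Rightarrow> nat \<Rightarrow> nat \<Rightarrow> code" where
  "reach_code z c i j =
     count_loop z 2 (mark_addr z ;; op (SET 3 0) ;; op (STORE 9 3)) ;;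
     op (SET z 0) ;; op (ADD z z i) ;; c ;; guarded 4 (mark_addr z ;; op (STORE 9 1)) ;;
     count_loop 7 0 (count_loop 8 2 (count_loop z 2 (expand_code z c))) ;;
     mark_addr j ;; op (LOAD 4 9)"

fun compile :: "nat \<Rightarrow> fm \<Rightarrow> code" where
  "compile d (Adj i j) = adj_code (var i) (var j)"
| "compile d (Eq i j) = eq_code (var i) (var j)"
| "compile d (Neg \<phi>) = compile d \<phi> ;; op (SUB 4 1 4)"
| "compile d (Conj \<phi> \<psi>) = compile d \<phi> ;; guarded 4 (compile d \<psi>)"
| "compile d (Exists \<phi>) = search (var d) (compile (Suc d) \<phi>)"
| "compile d (Reach \<phi> i j) = reach_code (var d) (compile (Suc d) \<phi>) (var i) (var j)"

fun time :: "fm \<Rightarrow> nat \<Rightarrow> nat" where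
  "time (Adj i j) n = 4 * n + 7"
| "time (Eq i j) n = 4"
| "time (Neg \<phi>) n = time \<phi> n + 1"
| "time (Conj \<phi> \<psi>) n = time \<phi> n + (time \<psi> n + 2)"
| "time (Exists \<phi>) n = n * (time \<phi> n + 4) + 4"
| "time (Reach \<phi> i j) n = (n * 8 + 4) + (time \<phi> n + 8) +
     (n * n * (n * (n * (time \<phi> n + 4 * n + 24) + 7) + 7) + 4) + 4"

lemma runs_mark_addr:
  assumes "r \<noteq> 3" "r \<noteq> 9"
  shows "runs (mark_addr r) w 3 X (X(3 := 13, 9 := mark (X r)))"
proof -
  have "runs (mark_addr r) w (1 + (1 + 1)) X ((((X(9 := X r + X r))(3 := 13))(9 := (X r + X r) + 13)))"
    unfolding mark_addr_def
    by (intro runs_seq, rule runs_ADD, rule runs_SET, rule runs_op) simp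
  moreover have "((X(9 := X r + X r))(3 := 13))(9 := (X r + X r) + 13) = X(3 := 13, 9 := mark (X r))"
    by (auto simp: mark_def fun_eq_iff)
  ultimately show ?thesis by (simp add: eval_nat_numeral)
qed

lemma runs_store_mark:
  assumes "r \<noteq> 3" "r \<noteq> 9" "X 1 = 1"
  shows "runs (mark_addr r ;; op (STORE 9 1)) w 4 X (X(3 := 13, 9 := mark (X r), mark (X r) := 1))"
proof -
  have "runs (op (STORE 9 1)) w 1 (X(3 := 13, 9 := mark (X r))) (X(3 := 13, 9 := mark (X r), mark (X r) := 1))"
    using runs_STORE[of 9 1 w "X(3 := 13, 9 := mark (X r))"] assms(3) by simp
  from runs_seq[OF runs_mark_addr[OF assms(1,2)] this] show ?thesis by simp
qed

locale matrix_input =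
  fixes w :: "bool list" and vs :: "'a list" and E :: "'a rel" and n :: nat
  assumes n: "n = length vs" and distinct: "distinct vs" and length_w: "length w = n * n"
    and bit: "\<And>i j. i < n \<Longrightarrow> j < n \<Longrightarrow> w ! (i * n + j) \<longleftrightarrow> (vs ! i, vs ! j) \<in> E"
begin

definition ready :: "(nat \<Rightarrow> nat) \<Rightarrow> bool" where
  "ready X \<longleftrightarrow> X 0 = n * n \<and> X 1 = 1 \<and> X 2 = n"

lemma runs_adj_code:
  assumes "ready X" "X a < n" "X b < n" "a > 6" "b > 6"
  shows "\<exists>X'. runs (adj_code a b) w (4 * n + 7) X X' \<and>
    X' 4 = (if (vs ! X a, vs ! X b) \<in> E then 1 else 0) \<and> unchanged {3, 4, 5, 6} X X'"
proof -
  let ?X = "X(6 := 0, 6 := X b)"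
  let ?Inv = "\<lambda>k Y. Y 5 = k \<and> Y 6 = X b + k * n \<and> unchanged {3, 4, 5, 6} X Y"
  have X: "X 1 = 1" "X 2 = n" using assms(1) by (auto simp: ready_def)
  have init: "runs (op (SET 6 0)) w 1 X (X(6 := 0))" "runs (op (ADD 6 6 b)) w 1 (X(6 := 0)) ?X"
    using runs_SET[of 6 0] runs_ADD[of 6 6 b w "X(6 := 0)"] assms(5) by auto
  have "\<exists>Y. runs (count_loop 5 a (op (ADD 6 6 2))) w (X a * (1 + 3) + 4) ?X Y \<and> ?Inv (X a) Y"
  proof (rule runs_count_loop[where Inv = ?Inv])
    show "?X 1 = 1" using X by simp
    show "?Inv 0 (?X(5 := 0))" by (auto simp: unchanged_def)
    fix k Y assume Y: "?Inv k Y"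
    have Y12: "Y 1 = 1" "Y 2 = n" "Y a = X a" using Y X assms(4) by (auto simp: unchanged_def)
    then show "Y 5 = k \<and> Y a = X a" using Y by simp
    show "?Inv k (Y(3 := z))" for z using Y by (auto simp: unchanged_def)
    have "runs (op (ADD 6 6 2)) w 1 Y (Y(6 := Y 6 + Y 2))" by (rule runs_ADD)
    then show "\<exists>Y'. runs (op (ADD 6 6 2)) w 1 Y Y' \<and> ?Inv (Suc k) (Y'(5 := Y' 5 + Y' 1))"
      using Y Y12 by (intro exI[of _ "Y(6 := Y 6 + Y 2)"]) (auto simp: unchanged_def)
  qed simp
  then obtain Y where Y: "runs (count_loop 5 a (op (ADD 6 6 2))) w (X a * (1 + 3) + 4) ?X Y" "?Inv (X a) Y"
    by blast
  let ?X' = "Y(4 := (if Y 6 < length w \<and> w ! Y 6 then 1 else 0))"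
  have "runs (adj_code a b) w (1 + (1 + (X a * (1 + 3) + 4 + 1))) X ?X'"
    unfolding adj_code_def by (rule runs_seq[OF init(1) runs_seq[OF init(2) runs_seq[OF Y(1) runs_READ]]])
  then have "runs (adj_code a b) w (4 * n + 7) X ?X'"
    by (rule runs_mono) (use assms(2) in simp)
  moreover have "X a * n + X b < n * n"
  proof -
    have "X a * n + X b < Suc (X a) * n" using assms(3) by simp
    also have "\<dots> \<le> n * n" using assms(2) by (intro mult_right_mono) auto
    finally show ?thesis .
  qed
  then have "?X' 4 = (if (vs ! X a, vs ! X b) \<in> E then 1 else 0)"
    using Y(2) bit[OF assms(2,3)] length_w by (simp add: add.commute)
  moreover have "unchanged {3, 4, 5, 6} X ?X'" using Y(2) by (auto simp: unchanged_def)
  ultimately show ?thesis by blast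
qed

lemma runs_eq_code:
  assumes "ready X" "X a < n" "X b < n" "a > 6" "b > 6"
  shows "\<exists>X'. runs (eq_code a b) w 4 X X' \<and>
    X' 4 = (if vs ! X a = vs ! X b then 1 else 0) \<and> unchanged {3, 4, 5, 6} X X'"
proof -
  let ?X1 = "X(3 := X a - X b)"
  let ?X2 = "?X1(4 := ?X1 b - ?X1 a)"
  let ?X3 = "?X2(3 := ?X2 3 + ?X2 4)"
  let ?X4 = "?X3(4 := ?X3 1 - ?X3 3)"
  have "runs (eq_code a b) w (1 + (1 + (1 + 1))) X ?X4"
    unfolding eq_code_def by (rule runs_seq[OF runs_SUB runs_seq[OF runs_SUB runs_seq[OF runs_ADD runs_SUB]]])
  moreover have "vs ! X a = vs ! X b \<longleftrightarrow> X a = X b"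
    using assms(2,3) distinct n by (simp add: nth_eq_iff_index_eq)
  then have "?X4 4 = (if vs ! X a = vs ! X b then 1 else 0)"
    using assms(1,4,5) by (auto simp: ready_def)
  moreover have "unchanged {3, 4, 5, 6} X ?X4" by (auto simp: unchanged_def)
  ultimately show ?thesis by (intro exI[of _ ?X4]) (simp add: eval_nat_numeral)
qed

end

section \<open>Reachability by repeated scanning\<close>

definition level :: "'a rel \<Rightarrow> 'a \<Rightarrow> nat \<Rightarrow> 'a set" where
  "level R i k = {z. \<exists>m\<le>k. (i, z) \<in> R ^^ m}"

lemma level_0: "level R i 0 = {i}"
  by (auto simp: level_def)

lemma level_Suc:
  assumes "z \<in> level R i (Suc k)"
  shows "z \<in> level R i k \<or> (\<exists>u\<in>level R i k. (u, z) \<in> R)"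
proof -
  obtain m where m: "m \<le> Suc k" "(i, z) \<in> R ^^ m" using assms by (auto simp: level_def)
  show ?thesis
  proof (cases "m \<le> k")
    case False
    then have "m = Suc k" using m by simp
    then obtain u where "(i, u) \<in> R ^^ k" "(u, z) \<in> R" using m by auto
    then show ?thesis by (auto simp: level_def)
  qed (use m in \<open>auto simp: level_def\<close>)
qed

lemma level_finite:
  assumes "finite R" "card R \<le> k"
  shows "level R i k = {z. (i, z) \<in> R\<^sup>*}"
proof -
  have "level R i k \<subseteq> {z. (i, z) \<in> R\<^sup>*}" by (auto simp: level_def relpow_imp_rtrancl)
  moreover have "z \<in> level R i k" if z: "(i, z) \<in> R\<^sup>*" for z
  proof -
    obtain m where "m \<le> card R" "(i, z) \<in> R ^^ m"
      using z unfolding rtrancl_finite_eq_relpow[OF assms(1)] by blast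
    then show ?thesis using assms(2) unfolding level_def by (blast intro: le_trans)
  qed
  ultimately show ?thesis by blast
qed

definition marked :: "nat \<Rightarrow> (nat \<Rightarrow> nat) \<Rightarrow> nat set \<Rightarrow> bool" where
  "marked n X M \<longleftrightarrow> (\<forall>z<n. X (mark z) = (if z \<in> M then 1 else 0))"

context matrix_input
begin

definition agree_on :: "nat set \<Rightarrow> (nat \<Rightarrow> nat) \<Rightarrow> (nat \<Rightarrow> nat) \<Rightarrow> bool" where
  "agree_on K X0 X \<longleftrightarrow> (\<forall>r\<in>K. X r = X0 r)"

definition index_edges :: "nat set \<Rightarrow> nat rel" where
  "index_edges S = {(u, z). u \<in> S \<and> z \<in> S \<and> (vs ! u, vs ! z) \<in> E}"

text \<open>The counterpart of \<open>component\<close> for positions in \<open>vs\<close>, which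
  are what the registers hold.\<close>

definition reachable :: "nat set \<Rightarrow> nat \<Rightarrow> nat set" where
  "reachable S s = {z. s \<in> S \<and> (s, z) \<in> (index_edges S)\<^sup>*}"

text \<open>The search behind \<open>Reach\<close>, for any code \<open>c\<close> that decides whether the vertex with index \<open>z\<close>
  belongs to \<open>S\<close>. The search keeps the registers in \<open>K\<close>, which include everything \<open>c\<close> relies on.\<close>
context
  fixes c :: code and T :: nat and S K :: "nat set" and d i j :: nat and X0 :: "nat \<Rightarrow> nat"
  assumes K: "{0, 1, 2} \<subseteq> K" "{3, 4, 5, 6, 7, 8, 9} \<inter> K = {}" "var d \<notin> K" "\<And>z. mark z \<notin> K"
    and ready0: "ready X0"
    and c: "\<And>X. (\<And>r. r \<in> K \<Longrightarrow> X r = X0 r) \<Longrightarrow> X (var d) < n \<Longrightarrow>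
      \<exists>X'. runs c w T X X' \<and> X' 4 = (if X (var d) \<in> S then 1 else 0) \<and>
        unchanged ({3, 4, 5, 6} \<union> {var l | l. d < l}) X X'"
    and Kvar: "\<And>l. d < l \<Longrightarrow> var l \<notin> K"
    and S: "S \<subseteq> {..<n}"
    and i: "i \<in> K" "X0 i < n" and j: "j \<in> K" "X0 j < n" and ij: "i > 9" "j > 9"
begin

abbreviation base where "base \<equiv> agree_on K X0"

abbreviation R where "R \<equiv> index_edges S"

abbreviation closure where "closure \<equiv> reachable S"

lemma base_ready: "base X \<Longrightarrow> ready X"
  using ready0 K(1) by (auto simp: agree_on_def ready_def)

lemma base_upd: "base X \<Longrightarrow> r \<notin> K \<Longrightarrow> base (X(r := x))"
  by (auto simp: agree_on_def)

lemma base_unchanged: "base X \<Longrightarrow> unchanged D X X' \<Longrightarrow> D \<inter> K = {} \<Longrightarrow> base X'"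
  by (auto simp: agree_on_def unchanged_def)

lemma small_notin_K: "r \<in> {3, 4, 5, 6, 7, 8, 9} \<Longrightarrow> r \<notin> K"
  using K(2) by blast

lemma base_upd_mark: "base X \<Longrightarrow> base (X(3 := x, 9 := y, mark z := u))"
  using K(4) small_notin_K by (intro base_upd) auto

lemma c_clobber: "({3, 4, 5, 6} \<union> {var l | l. d < l}) \<inter> K = {}"
  using small_notin_K Kvar by auto

lemma runs_c:
  assumes "base X" "X (var d) < n" "marked n X M"
  shows "\<exists>X'. runs c w T X X' \<and> X' 4 = (if X (var d) \<in> S then 1 else 0) \<and> base X' \<and> marked n X' M \<and>
    X' 7 = X 7 \<and> X' 8 = X 8 \<and> X' (var d) = X (var d)"
proof -
  obtain X' where X': "runs c w T X X'" "X' 4 = (if X (var d) \<in> S then 1 else 0)"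
    "unchanged ({3, 4, 5, 6} \<union> {var l | l. d < l}) X X'"
    using c[of X] assms(1,2) unfolding agree_on_def by blast
  have "base X'" using base_unchanged[OF assms(1) X'(3) c_clobber] .
  moreover have "X' (mark z) = X (mark z)" for z using X'(3) by (simp add: unchanged_def)
  then have "marked n X' M" using assms(3) by (simp add: marked_def)
  moreover have "X' 7 = X 7" "X' 8 = X 8" "X' (var d) = X (var d)"
    using X'(3) by (auto simp: unchanged_def)
  ultimately show ?thesis using X'(1,2) by blast
qed

lemma runs_visit:
  assumes "base X" "X (var d) < n" "marked n X M"
  shows "\<exists>X'. runs (c ;; guarded 4 (mark_addr (var d) ;; op (STORE 9 1))) w (T + 6) X X' \<and> base X' \<and>
    marked n X' (if X (var d) \<in> S then insert (X (var d)) M else M) \<and>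
    X' 7 = X 7 \<and> X' 8 = X 8 \<and> X' (var d) = X (var d)"
proof -
  obtain X' where X': "runs c w T X X'" "X' 4 = (if X (var d) \<in> S then 1 else 0)" "base X'" "marked n X' M"
    "X' 7 = X 7" "X' 8 = X 8" "X' (var d) = X (var d)"
    using runs_c[OF assms] by blast
  have one: "X' 1 = 1" using base_ready[OF X'(3)] by (simp add: ready_def)
  show ?thesis
  proof (cases "X (var d) \<in> S")
    case True
    let ?Y = "(X'(3 := 0))(3 := 13, 9 := mark (X (var d)), mark (X (var d)) := 1)"
    have "runs (mark_addr (var d) ;; op (STORE 9 1)) w 4 (X'(3 := 0)) ?Y"
      using runs_store_mark[of "var d" "X'(3 := 0)" w] one X'(7) by simp
    then have "runs (guarded 4 (mark_addr (var d) ;; op (STORE 9 1))) w (4 + 2) X' ?Y"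
      using one X'(2) True by (intro runs_guarded_true) auto
    from runs_seq[OF X'(1) this]
    have "runs (c ;; guarded 4 (mark_addr (var d) ;; op (STORE 9 1))) w (T + 6) X ?Y" by simp
    moreover have "base ?Y" by (intro base_upd_mark base_upd X'(3) small_notin_K) simp
    moreover have "marked n ?Y (insert (X (var d)) M)"
      using X'(4) by (auto simp: marked_def)
    ultimately show ?thesis using True X' by (intro exI[of _ ?Y]) simp
  next
    case False
    let ?Y = "X'(3 := 1)"
    have "runs (guarded 4 (mark_addr (var d) ;; op (STORE 9 1))) w (4 + 2) X' ?Y"
      using one X'(2) False by (intro runs_guarded_false) auto
    from runs_seq[OF X'(1) this]
    have "runs (c ;; guarded 4 (mark_addr (var d) ;; op (STORE 9 1))) w (T + 6) X ?Y" by simp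
    moreover have "base ?Y" by (intro base_upd X'(3) small_notin_K) simp
    moreover have "marked n ?Y M" using X'(4) by (auto simp: marked_def)
    ultimately show ?thesis using False X' by (intro exI[of _ ?Y]) simp
  qed
qed

lemma runs_expand:
  assumes b: "base X" and u: "X 8 < n" and z: "X (var d) < n" and M: "marked n X M"
  shows "\<exists>X'. runs (expand_code (var d) c) w (T + 4 * n + 21) X X' \<and> base X' \<and>
    marked n X' (if X 8 \<in> M \<and> (vs ! X 8, vs ! X (var d)) \<in> E \<and> X (var d) \<in> S then insert (X (var d)) M else M) \<and>
    X' 7 = X 7 \<and> X' 8 = X 8 \<and> X' (var d) = X (var d)"
proof -
  let ?visit = "c ;; guarded 4 (mark_addr (var d) ;; op (STORE 9 1))"
  let ?Y1 = "X(3 := 13, 9 := mark (X 8))"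
  let ?Y2 = "?Y1(4 := ?Y1 (?Y1 9))"
  have r12: "runs (mark_addr 8 ;; op (LOAD 4 9)) w (3 + 1) X ?Y2"
    by (rule runs_seq[OF runs_mark_addr runs_LOAD]) simp_all
  have Y2: "base ?Y2" by (intro base_upd b small_notin_K) simp_all
  have one: "?Y2 1 = 1" using base_ready[OF Y2] by (simp add: ready_def)
  have Y24: "?Y2 4 = (if X 8 \<in> M then 1 else 0)" using M u by (simp add: marked_def)
  have split: "runs (expand_code (var d) c) w (T + 4 * n + 21) X X'"
    if "runs (guarded 4 (adj_code 8 (var d) ;; guarded 4 ?visit)) w (T + 4 * n + 17) ?Y2 X'" for X'
  proof -
    from runs_seq[OF r12 that] have "runs (expand_code (var d) c) w (3 + 1 + (T + 4 * n + 17)) X X'"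
      unfolding expand_code_def seq_def by (simp add: add.assoc)
    then show ?thesis by (rule runs_mono) simp
  qed
  show ?thesis
  proof (cases "X 8 \<in> M")
    case False
    let ?Z = "?Y2(3 := 1)"
    have "runs (guarded 4 (adj_code 8 (var d) ;; guarded 4 ?visit)) w (T + 4 * n + 15 + 2) ?Y2 ?Z"
      using one Y24 False by (intro runs_guarded_false) auto
    then have "runs (expand_code (var d) c) w (T + 4 * n + 21) X ?Z"
      by (intro split, rule runs_mono) simp
    moreover have "base ?Z" by (intro base_upd Y2 small_notin_K) simp
    moreover have "marked n ?Z M" using M by (auto simp: marked_def)
    ultimately show ?thesis using False by (intro exI[of _ ?Z]) simp
  next
    case True
    let ?Y3 = "?Y2(3 := 0)"
    have Y3: "base ?Y3" by (intro base_upd Y2 small_notin_K) simp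
    obtain Y4 where Y4: "runs (adj_code 8 (var d)) w (4 * n + 7) ?Y3 Y4"
      "Y4 4 = (if (vs ! X 8, vs ! X (var d)) \<in> E then 1 else 0)" "unchanged {3, 4, 5, 6} ?Y3 Y4"
      using runs_adj_code[OF base_ready[OF Y3], of 8 "var d"] u z by auto
    have b4: "base Y4" using base_unchanged[OF Y3 Y4(3)] small_notin_K by blast
    have Y4eq: "Y4 7 = X 7" "Y4 8 = X 8" "Y4 (var d) = X (var d)" "Y4 (mark l) = X (mark l)" for l
      using Y4(3) by (auto simp: unchanged_def)
    have M4: "marked n Y4 M" using M Y4eq(4) by (simp add: marked_def)
    have one4: "Y4 1 = 1" using base_ready[OF b4] by (simp add: ready_def)
    show ?thesis
    proof (cases "(vs ! X 8, vs ! X (var d)) \<in> E")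
      case edge: True
      let ?Y5 = "Y4(3 := 0)"
      have yv: "?Y5 (var d) = X (var d)" "?Y5 7 = X 7" "?Y5 8 = X 8" using Y4eq by simp_all
      have "base ?Y5" by (intro base_upd b4 small_notin_K) simp
      moreover have "marked n ?Y5 M" using M4 by (auto simp: marked_def)
      ultimately obtain Z where Z: "runs ?visit w (T + 6) ?Y5 Z" "base Z"
        "marked n Z (if X (var d) \<in> S then insert (X (var d)) M else M)"
        "Z 7 = X 7" "Z 8 = X 8" "Z (var d) = X (var d)"
        using runs_visit[of ?Y5 M, unfolded yv] z by blast
      have "runs (guarded 4 ?visit) w (T + 6 + 2) Y4 Z"
        using one4 Y4(2) edge Z(1) by (intro runs_guarded_true) auto
      from runs_guarded_true[OF one _ runs_seq[OF Y4(1) this], of 4]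
      have "runs (guarded 4 (adj_code 8 (var d) ;; guarded 4 ?visit)) w (4 * n + 7 + (T + 6 + 2) + 2) ?Y2 Z"
        using Y24 True by simp
      then have "runs (expand_code (var d) c) w (T + 4 * n + 21) X Z"
        by (intro split, rule runs_mono) simp
      then show ?thesis using True edge Z by (intro exI[of _ Z]) simp
    next
      case no_edge: False
      let ?Z = "Y4(3 := 1)"
      have "runs (guarded 4 ?visit) w (T + 6 + 2) Y4 ?Z"
        using one4 Y4(2) no_edge by (intro runs_guarded_false) auto
      from runs_guarded_true[OF one _ runs_seq[OF Y4(1) this], of 4]
      have "runs (guarded 4 (adj_code 8 (var d) ;; guarded 4 ?visit)) w (4 * n + 7 + (T + 6 + 2) + 2) ?Y2 ?Z"
        using Y24 True by simp
      then have "runs (expand_code (var d) c) w (T + 4 * n + 21) X ?Z"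
        by (intro split, rule runs_mono) simp
      moreover have "base ?Z" by (intro base_upd b4 small_notin_K) simp
      moreover have "marked n ?Z M" using M4 by (auto simp: marked_def)
      ultimately show ?thesis using no_edge Y4eq by (intro exI[of _ ?Z]) simp
    qed
  qed
qed

lemma closure_subset: "closure s \<subseteq> S"
proof
  fix z assume "z \<in> closure s"
  then have "(s, z) \<in> R\<^sup>*" "s \<in> S" by (auto simp: reachable_def)
  then show "z \<in> S" by (induction rule: rtrancl_induct) (auto simp: index_edges_def)
qed

definition lev where "lev k = (if X0 i \<in> S then level R (X0 i) k else {})"

lemma lev_Suc: "z \<in> lev (Suc k) \<Longrightarrow> z \<in> lev k \<or> (\<exists>u\<in>lev k. (u, z) \<in> R)"
  using level_Suc[of z R "X0 i" k] by (simp add: lev_def split: if_splits)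

lemma lev_final: "lev (n * n) = closure (X0 i)"
proof -
  have "R \<subseteq> {..<n} \<times> {..<n}" using S by (auto simp: index_edges_def)
  then have "finite R" "card R \<le> n * n"
    using finite_subset card_mono[of "{..<n} \<times> {..<n}" R] by (auto simp: card_cartesian_product)
  from level_finite[OF this, of "X0 i"] show ?thesis by (simp add: lev_def reachable_def)
qed

lemma closure_step: "u \<in> closure s \<Longrightarrow> z \<in> S \<Longrightarrow> (vs ! u, vs ! z) \<in> E \<Longrightarrow> z \<in> closure s"
proof -
  assume u: "u \<in> closure s" and z: "z \<in> S" "(vs ! u, vs ! z) \<in> E"
  have "(u, z) \<in> R" using u z closure_subset[of s] by (auto simp: index_edges_def)
  moreover have "s \<in> S" "(s, u) \<in> R\<^sup>*" using u by (simp_all add: reachable_def)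
  ultimately show "z \<in> closure s" unfolding reachable_def by (blast intro: rtrancl_into_rtrancl)
qed

text \<open>Invariant of round \<open>k\<close> before the pair \<open>(u, z)\<close> is examined:
  edges out of \<open>lev k\<close> at earlier pairs have marked their ends. The marks are only
  enclosed between \<open>lev k\<close> and the closure, because a vertex marked in a round may
  spread further in the same round.\<close>

definition frontier where
  "frontier k u z X \<longleftrightarrow> base X \<and> (\<exists>M. marked n X M \<and> lev k \<subseteq> M \<and> M \<subseteq> closure (X0 i) \<and>
     (\<forall>u' z'. (u', z') \<in> R \<longrightarrow> u' \<in> lev k \<longrightarrow> (u' < u \<or> u' = u \<and> z' < z) \<longrightarrow> z' \<in> M))"

lemma frontier_upd:
  assumes "frontier k u z X" "r \<notin> K" "\<And>l. r \<noteq> mark l"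
  shows "frontier k u z (X(r := x))"
proof -
  have "marked n (X(r := x)) M \<longleftrightarrow> marked n X M" for M
    using assms(3) assms(3)[THEN not_sym] by (simp add: marked_def)
  then show ?thesis using assms(1,2) base_upd unfolding frontier_def by simp
qed

lemma frontier_row: "frontier k u n X \<Longrightarrow> frontier k (Suc u) 0 X"
proof -
  have "z' < n" if "(u', z') \<in> R" for u' z' using that S by (auto simp: index_edges_def)
  moreover assume "frontier k u n X"
  ultimately show ?thesis unfolding frontier_def less_Suc_eq by blast
qed

lemma frontier_round: "frontier k n 0 X \<Longrightarrow> frontier (Suc k) 0 0 X"
proof -
  assume "frontier k n 0 X"
  then obtain M where M: "base X" "marked n X M" "lev k \<subseteq> M" "M \<subseteq> closure (X0 i)"
    "\<And>u' z'. (u', z') \<in> R \<Longrightarrow> u' \<in> lev k \<Longrightarrow> u' < n \<Longrightarrow> z' \<in> M"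
    unfolding frontier_def by blast
  have "lev (Suc k) \<subseteq> M"
  proof
    fix z assume "z \<in> lev (Suc k)"
    then show "z \<in> M" using lev_Suc[of z k] M(3,5) S by (auto simp: index_edges_def)
  qed
  then show ?thesis using M unfolding frontier_def by auto
qed

lemma frontier_final:
  assumes "frontier (n * n) 0 0 X"
  shows "base X" "marked n X (closure (X0 i))"
  using assms unfolding frontier_def lev_final by auto

lemma runs_expand_frontier:
  assumes f: "frontier k u z X" and X: "X 7 = k" "X 8 = u" "X (var d) = z" and uz: "u < n" "z < n"
  shows "\<exists>X'. runs (expand_code (var d) c) w (T + 4 * n + 21) X X' \<and> frontier k u (Suc z) X' \<and>
    X' 7 = k \<and> X' 8 = u \<and> X' (var d) = z"
proof -
  obtain M where M: "base X" "marked n X M" "lev k \<subseteq> M" "M \<subseteq> closure (X0 i)"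
    "\<And>u' z'. (u', z') \<in> R \<Longrightarrow> u' \<in> lev k \<Longrightarrow> u' < u \<or> u' = u \<and> z' < z \<Longrightarrow> z' \<in> M"
    using f unfolding frontier_def by blast
  let ?M = "if u \<in> M \<and> (vs ! u, vs ! z) \<in> E \<and> z \<in> S then insert z M else M"
  obtain X' where X': "runs (expand_code (var d) c) w (T + 4 * n + 21) X X'" "base X'"
    "marked n X' ?M" "X' 7 = k" "X' 8 = u" "X' (var d) = z"
    using runs_expand[OF M(1) _ _ M(2)] X uz by auto
  have "?M \<subseteq> closure (X0 i)" using M(4) closure_step by auto
  moreover have "z' \<in> ?M" if "(u', z') \<in> R" "u' \<in> lev k" "u' < u \<or> u' = u \<and> z' < Suc z" for u' z'
  proof (cases "u' = u \<and> z' = z")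
    case True
    then show ?thesis using that M(3) by (auto simp: index_edges_def)
  next
    case False
    then have "z' \<in> M" using that M(5)[of u' z'] by (auto simp: less_Suc_eq)
    then show ?thesis by simp
  qed
  moreover have "lev k \<subseteq> ?M" using M(3) by auto
  ultimately have "frontier k u (Suc z) X'" unfolding frontier_def using X'(2,3) by blast
  then show ?thesis using X' by blast
qed

lemma runs_row:
  assumes f: "frontier k u 0 X" and X: "X 7 = k" "X 8 = u" and u: "u < n"
  shows "\<exists>X'. runs (count_loop (var d) 2 (expand_code (var d) c)) w (n * (T + 4 * n + 21 + 3) + 4) X X' \<and>
    frontier k (Suc u) 0 X' \<and> X' 7 = k \<and> X' 8 = u"
proof -
  have b: "base X" using f by (simp add: frontier_def)
  let ?Inv = "\<lambda>z Y. frontier k u z Y \<and> Y 7 = k \<and> Y 8 = u \<and> Y (var d) = z"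
  have "\<exists>X'. runs (count_loop (var d) 2 (expand_code (var d) c)) w (n * (T + 4 * n + 21 + 3) + 4) X X' \<and> ?Inv n X'"
  proof (rule runs_count_loop[where Inv = ?Inv])
    show "X 1 = 1" using base_ready[OF b] by (simp add: ready_def)
    show "?Inv 0 (X(var d := 0))" using frontier_upd[OF f K(3)] X by simp
    fix z Y assume Y: "?Inv z Y"
    then have bY: "base Y" by (simp add: frontier_def)
    show "Y (var d) = z \<and> Y 2 = n" using Y base_ready[OF bY] by (simp add: ready_def)
    show "?Inv z (Y(3 := a))" for a using Y frontier_upd[of k u z Y 3] small_notin_K[of 3] by simp
    assume z: "z < n"
    obtain Y' where Y': "runs (expand_code (var d) c) w (T + 4 * n + 21) Y Y'" "frontier k u (Suc z) Y'"
      "Y' 7 = k" "Y' 8 = u" "Y' (var d) = z"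
      using runs_expand_frontier[of k u z Y] Y u z by blast
    have "Y' 1 = 1" using Y'(2) base_ready[of Y'] by (simp add: frontier_def ready_def)
    then have "?Inv (Suc z) (Y'(var d := Y' (var d) + Y' 1))"
      using Y' frontier_upd[OF Y'(2) K(3)] by simp
    then show "\<exists>Y'. runs (expand_code (var d) c) w (T + 4 * n + 21) Y Y' \<and>
        ?Inv (Suc z) (Y'(var d := Y' (var d) + Y' 1))"
      using Y'(1) by blast
  qed simp
  then show ?thesis using frontier_row by blast
qed

lemma runs_round:
  assumes f: "frontier k 0 0 X" and X: "X 7 = k"
  shows "\<exists>X'. runs (count_loop 8 2 (count_loop (var d) 2 (expand_code (var d) c))) w
      (n * (n * (T + 4 * n + 21 + 3) + 4 + 3) + 4) X X' \<and> frontier (Suc k) 0 0 X' \<and> X' 7 = k"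
proof -
  let ?row = "count_loop (var d) 2 (expand_code (var d) c)"
  have b: "base X" using f by (simp add: frontier_def)
  let ?Inv = "\<lambda>u Y. frontier k u 0 Y \<and> Y 7 = k \<and> Y 8 = u"
  have "\<exists>X'. runs (count_loop 8 2 ?row) w (n * (n * (T + 4 * n + 21 + 3) + 4 + 3) + 4) X X' \<and> ?Inv n X'"
  proof (rule runs_count_loop[where Inv = ?Inv])
    show "X 1 = 1" using base_ready[OF b] by (simp add: ready_def)
    show "?Inv 0 (X(8 := 0))" using frontier_upd[OF f small_notin_K, of 8] X by simp
    fix u Y assume Y: "?Inv u Y"
    then have bY: "base Y" by (simp add: frontier_def)
    show "Y 8 = u \<and> Y 2 = n" using Y base_ready[OF bY] by (simp add: ready_def)
    show "?Inv u (Y(3 := a))" for a using Y frontier_upd[of k u 0 Y 3] small_notin_K[of 3] by simp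
    assume u: "u < n"
    obtain Y' where Y': "runs ?row w (n * (T + 4 * n + 21 + 3) + 4) Y Y'" "frontier k (Suc u) 0 Y'"
      "Y' 7 = k" "Y' 8 = u"
      using runs_row[of k u Y] Y u by blast
    have "Y' 1 = 1" using Y'(2) base_ready[of Y'] by (simp add: frontier_def ready_def)
    then have "?Inv (Suc u) (Y'(8 := Y' 8 + Y' 1))"
      using Y' frontier_upd[OF Y'(2) small_notin_K, of 8] by simp
    then show "\<exists>Y'. runs ?row w (n * (T + 4 * n + 21 + 3) + 4) Y Y' \<and> ?Inv (Suc u) (Y'(8 := Y' 8 + Y' 1))"
      using Y'(1) by blast
  qed simp
  then show ?thesis using frontier_round by blast
qed

lemma runs_rounds:
  assumes f: "frontier 0 0 0 X"
  shows "\<exists>X'. runs (count_loop 7 0 (count_loop 8 2 (count_loop (var d) 2 (expand_code (var d) c)))) w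
      (n * n * (n * (n * (T + 4 * n + 21 + 3) + 4 + 3) + 4 + 3) + 4) X X' \<and>
      base X' \<and> marked n X' (closure (X0 i))"
proof -
  let ?round = "count_loop 8 2 (count_loop (var d) 2 (expand_code (var d) c))"
  have b: "base X" using f by (simp add: frontier_def)
  let ?Inv = "\<lambda>k Y. frontier k 0 0 Y \<and> Y 7 = k"
  have "\<exists>X'. runs (count_loop 7 0 ?round) w (n * n * (n * (n * (T + 4 * n + 21 + 3) + 4 + 3) + 4 + 3) + 4) X X' \<and> ?Inv (n * n) X'"
  proof (rule runs_count_loop[where Inv = ?Inv])
    show "X 1 = 1" using base_ready[OF b] by (simp add: ready_def)
    show "?Inv 0 (X(7 := 0))" using frontier_upd[OF f small_notin_K, of 7] by simp
    fix k Y assume Y: "?Inv k Y"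
    then have bY: "base Y" by (simp add: frontier_def)
    show "Y 7 = k \<and> Y 0 = n * n" using Y base_ready[OF bY] by (simp add: ready_def)
    show "?Inv k (Y(3 := a))" for a using Y frontier_upd[of k 0 0 Y 3] small_notin_K[of 3] by simp
    obtain Y' where Y': "runs ?round w (n * (n * (T + 4 * n + 21 + 3) + 4 + 3) + 4) Y Y'" "frontier (Suc k) 0 0 Y'" "Y' 7 = k"
      using runs_round[of k Y] Y by blast
    have "Y' 1 = 1" using Y'(2) base_ready[of Y'] by (simp add: frontier_def ready_def)
    then have "?Inv (Suc k) (Y'(7 := Y' 7 + Y' 1))"
      using Y' frontier_upd[OF Y'(2) small_notin_K, of 7] by simp
    then show "\<exists>Y'. runs ?round w (n * (n * (T + 4 * n + 21 + 3) + 4 + 3) + 4) Y Y' \<and> ?Inv (Suc k) (Y'(7 := Y' 7 + Y' 1))"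
      using Y'(1) by blast
  qed simp
  then show ?thesis using frontier_final by blast
qed

lemma runs_clear:
  assumes b: "base X"
  shows "\<exists>X'. runs (count_loop (var d) 2 (mark_addr (var d) ;; op (SET 3 0) ;; op (STORE 9 3))) w
      (n * (5 + 3) + 4) X X' \<and> base X' \<and> marked n X' {}"
proof -
  let ?body = "mark_addr (var d) ;; op (SET 3 0) ;; op (STORE 9 3)"
  let ?Inv = "\<lambda>z Y. base Y \<and> Y (var d) = z \<and> (\<forall>l<z. Y (mark l) = 0)"
  have "\<exists>X'. runs (count_loop (var d) 2 ?body) w (n * (5 + 3) + 4) X X' \<and> ?Inv n X'"
  proof (rule runs_count_loop[where Inv = ?Inv])
    show "X 1 = 1" using base_ready[OF b] by (simp add: ready_def)
    show "?Inv 0 (X(var d := 0))" using base_upd[OF b K(3)] by simp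
    fix z Y assume Y: "?Inv z Y"
    show "Y (var d) = z \<and> Y 2 = n" using Y base_ready[of Y] by (simp add: ready_def)
    show "?Inv z (Y(3 := a))" for a using Y base_upd[of Y 3] small_notin_K[of 3] by simp
    let ?Y1 = "Y(3 := 13, 9 := mark (Y (var d)))"
    let ?Y2 = "?Y1(3 := 0)"
    let ?Y3 = "?Y2(?Y2 9 := ?Y2 3)"
    have "runs ?body w (3 + (1 + 1)) Y ?Y3"
      by (rule runs_seq[OF runs_mark_addr runs_seq[OF runs_SET runs_STORE]]) simp_all
    then have "runs ?body w 5 Y ?Y3" by (rule runs_mono) simp
    moreover have "base ?Y3"
    proof -
      have "base ?Y2" using Y by (intro base_upd small_notin_K) simp_all
      then have "base (?Y2(mark (Y (var d)) := ?Y2 3))" using K(4) by (rule base_upd)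
      then show ?thesis by simp
    qed
    then have "?Y3 1 = 1" using base_ready[of ?Y3] by (simp add: ready_def)
    then have "?Inv (Suc z) (?Y3(var d := ?Y3 (var d) + ?Y3 1))"
      using base_upd[OF \<open>base ?Y3\<close> K(3)] Y by (auto simp: less_Suc_eq)
    ultimately show "\<exists>Y'. runs ?body w 5 Y Y' \<and> ?Inv (Suc z) (Y'(var d := Y' (var d) + Y' 1))"
      by blast
  qed simp
  then show ?thesis by (auto simp: marked_def)
qed

lemma runs_reach:
  assumes b: "base X"
  shows "\<exists>X'. runs (reach_code (var d) c i j) w ((n * 8 + 4) + (T + 8) +
      (n * n * (n * (n * (T + 4 * n + 24) + 7) + 7) + 4) + 4) X X' \<and>
    X' 4 = (if X0 j \<in> closure (X0 i) then 1 else 0) \<and> base X'"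
proof -
  obtain X1 where X1: "runs (count_loop (var d) 2 (mark_addr (var d) ;; op (SET 3 0) ;; op (STORE 9 3))) w
      (n * (5 + 3) + 4) X X1" "base X1" "marked n X1 {}"
    using runs_clear[OF b] by blast
  let ?X2 = "X1(var d := 0)"
  let ?X3 = "?X2(var d := ?X2 (var d) + ?X2 i)"
  have i_ne: "i \<noteq> var d" using i K(3) by auto
  have X3: "base ?X3" by (intro base_upd X1 K(3))
  have X3i: "?X3 (var d) = X0 i" using X1(2) i i_ne by (simp add: agree_on_def)
  obtain X4 where X4: "runs (c ;; guarded 4 (mark_addr (var d) ;; op (STORE 9 1))) w (T + 6) ?X3 X4" "base X4"
    "marked n X4 (if X0 i \<in> S then insert (X0 i) {} else {})"
    using runs_visit[OF X3, of "{}"] X3i i X1(3) by (auto simp: marked_def)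
  have "frontier 0 0 0 X4"
    using X4 unfolding frontier_def by (auto simp: lev_def level_0 reachable_def)
  then obtain X5 where X5: "runs (count_loop 7 0 (count_loop 8 2 (count_loop (var d) 2 (expand_code (var d) c)))) w
      (n * n * (n * (n * (T + 4 * n + 21 + 3) + 4 + 3) + 4 + 3) + 4) X4 X5"
      "base X5" "marked n X5 (closure (X0 i))"
    using runs_rounds by blast
  let ?X6 = "X5(3 := 13, 9 := mark (X5 j))"
  let ?X7 = "?X6(4 := ?X6 (?X6 9))"
  have end_code: "runs (mark_addr j ;; op (LOAD 4 9)) w (3 + 1) X5 ?X7"
    by (rule runs_seq[OF runs_mark_addr runs_LOAD]) (use ij in simp_all)
  have "runs (reach_code (var d) c i j) w ((n * (5 + 3) + 4) + (1 + (1 + ((T + 6) +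
      ((n * n * (n * (n * (T + 4 * n + 21 + 3) + 4 + 3) + 4 + 3) + 4) + (3 + 1)))))) X ?X7"
    using runs_seq[OF X1(1) runs_seq[OF runs_SET runs_seq[OF runs_ADD runs_seq[OF X4(1) runs_seq[OF X5(1) end_code]]]]]
    unfolding reach_code_def seq_def by (simp add: add.assoc)
  moreover have "base ?X7" by (intro base_upd X5 small_notin_K) simp_all
  moreover have "X5 j = X0 j" using X5(2) j by (simp add: agree_on_def)
  then have "?X7 4 = (if X0 j \<in> closure (X0 i) then 1 else 0)"
    using X5(3) j by (simp add: marked_def)
  ultimately show ?thesis
    by (intro exI[of _ ?X7]) (simp add: add.assoc)
qed

end

end

context matrix_input
begin

text \<open>As \<open>vs\<close> has no repetitions, positions below \<open>n\<close> and vertices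
  correspond, and walks translate edge by edge in both directions.\<close>

lemma component_nth:
  assumes S: "S \<subseteq> {..<n}" and s: "s < n" and z: "z < n"
  shows "vs ! z \<in> component E ((!) vs ` S) (vs ! s) \<longleftrightarrow> z \<in> reachable S s"
proof
  assume "z \<in> reachable S s"
  then have "s \<in> S" and path: "(s, z) \<in> (index_edges S)\<^sup>*" by (simp_all add: reachable_def)
  from path have "(vs ! s, vs ! z) \<in> (Restr E ((!) vs ` S))\<^sup>*"
  proof (induction rule: rtrancl_induct)
    case (step p q)
    then have "(vs ! p, vs ! q) \<in> Restr E ((!) vs ` S)" by (auto simp: index_edges_def)
    then show ?case using step(3) by (rule rtrancl_into_rtrancl[rotated])
  qed simp
  then show "vs ! z \<in> component E ((!) vs ` S) (vs ! s)" using \<open>s \<in> S\<close> by (simp add: component_def)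
next
  have inj: "p = q" if "vs ! p = vs ! q" "p < n" "q < n" for p q
    using that distinct n by (simp add: nth_eq_iff_index_eq)
  assume c: "vs ! z \<in> component E ((!) vs ` S) (vs ! s)"
  then have "vs ! s \<in> (!) vs ` S" by (simp add: component_def)
  then obtain s' where "s' \<in> S" "vs ! s = vs ! s'" by blast
  then have "s \<in> S" using inj[of s s'] s S by auto
  have "(vs ! s, vs ! z) \<in> (Restr E ((!) vs ` S))\<^sup>*" using c by (simp add: component_def)
  then have "\<exists>q<n. vs ! z = vs ! q \<and> (s, q) \<in> (index_edges S)\<^sup>*"
  proof (induction rule: rtrancl_induct)
    case (step x y)
    then obtain p where p: "p < n" "x = vs ! p" "(s, p) \<in> (index_edges S)\<^sup>*" by blast
    from step(2) obtain p' q where q: "p' \<in> S" "q \<in> S" "vs ! p' = x" "y = vs ! q" "(x, y) \<in> E" by auto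
    then have "p' = p" using inj[of p' p] p S by auto
    then have "(p, q) \<in> index_edges S" using q by (auto simp: index_edges_def)
    then have "(s, q) \<in> (index_edges S)\<^sup>*" using p(3) by (rule rtrancl_into_rtrancl[rotated])
    moreover have "q < n" using q(2) S by auto
    ultimately show ?case using q(4) by blast
  qed (use s in blast)
  then show "z \<in> reachable S s" using inj z \<open>s \<in> S\<close> by (auto simp: reachable_def)
qed

text \<open>The registers that the code for \<open>\<phi>\<close> may change at depth
  \<open>d\<close>. Without \<open>Reach\<close>, the marks and the registers 7 to 11 survive, so a
  search can run such code inside its own loops.\<close>

definition clobber :: "nat \<Rightarrow> fm \<Rightarrow> nat set" where
  "clobber d \<phi> = {3, 4, 5, 6} \<union> {var l | l. d \<le> l} \<union> (if reach_free \<phi> then {} else {7..11} \<union> range mark)"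

lemma unchanged_mono: "unchanged D X X' \<Longrightarrow> D \<subseteq> D' \<Longrightarrow> unchanged D' X X'"
  by (auto simp: unchanged_def)

lemma unchanged_trans: "unchanged D X Y \<Longrightarrow> unchanged D Y Z \<Longrightarrow> unchanged D X Z"
  by (auto simp: unchanged_def)

lemma unchanged_upd: "unchanged D X Y \<Longrightarrow> r \<in> D \<Longrightarrow> unchanged D X (Y(r := x))"
  by (auto simp: unchanged_def)

lemma notin_clobber: "r \<in> {0, 1, 2} \<Longrightarrow> r \<notin> clobber d \<phi>" "l < d \<Longrightarrow> var l \<notin> clobber d \<phi>"
  by (auto simp: clobber_def)

lemma unchanged_clobber:
  assumes "unchanged (clobber d \<phi>) X Y"
  shows "ready X \<Longrightarrow> ready Y" "l < d \<Longrightarrow> Y (var l) = X (var l)"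
  using assms notin_clobber(1)[of 0] notin_clobber(1)[of 1] notin_clobber(1)[of 2] notin_clobber(2)[of l d \<phi>]
  by (auto simp: unchanged_def ready_def)

lemma runs_compile:
  assumes "wf_fm d \<phi>" "ready X" "\<And>l. l < d \<Longrightarrow> X (var l) < n \<and> e l = vs ! X (var l)"
  shows "\<exists>X'. runs (compile d \<phi>) w (time \<phi> n) X X' \<and>
    X' 4 = (if sat (set vs) E d e \<phi> then 1 else 0) \<and> unchanged (clobber d \<phi>) X X'"
  using assms
proof (induction \<phi> arbitrary: d X e)
  case (Adj i j)
  then obtain X' where "runs (adj_code (var i) (var j)) w (4 * n + 7) X X'"
    "X' 4 = (if (vs ! X (var i), vs ! X (var j)) \<in> E then 1 else 0)" "unchanged {3, 4, 5, 6} X X'"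
    using runs_adj_code[of X "var i" "var j"] by auto
  then show ?case using Adj.prems by (intro exI[of _ X']) (auto simp: clobber_def elim: unchanged_mono)
next
  case (Eq i j)
  then obtain X' where "runs (eq_code (var i) (var j)) w 4 X X'"
    "X' 4 = (if vs ! X (var i) = vs ! X (var j) then 1 else 0)" "unchanged {3, 4, 5, 6} X X'"
    using runs_eq_code[of X "var i" "var j"] by auto
  then show ?case using Eq.prems by (intro exI[of _ X']) (auto simp: clobber_def elim: unchanged_mono)
next
  case (Neg \<phi>)
  then obtain Y where Y: "runs (compile d \<phi>) w (time \<phi> n) X Y"
    "Y 4 = (if sat (set vs) E d e \<phi> then 1 else 0)" "unchanged (clobber d \<phi>) X Y"
    by (metis wf_fm.simps(3))
  let ?X' = "Y(4 := Y 1 - Y 4)"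
  have "Y 1 = 1" using unchanged_clobber(1)[OF Y(3)] Neg.prems(2) by (simp add: ready_def)
  then have "?X' 4 = (if sat (set vs) E d e (Neg \<phi>) then 1 else 0)" using Y(2) by simp
  moreover have "clobber d (Neg \<phi>) = clobber d \<phi>" by (simp add: clobber_def)
  then have "unchanged (clobber d (Neg \<phi>)) X ?X'"
    using unchanged_upd[OF Y(3)] by (simp add: clobber_def)
  moreover have "runs (compile d (Neg \<phi>)) w (time (Neg \<phi>) n) X ?X'"
    using runs_seq[OF Y(1) runs_SUB] by simp
  ultimately show ?case by blast
next
  case (Conj \<phi> \<psi>)
  have sub: "clobber d \<phi> \<subseteq> clobber d (Conj \<phi> \<psi>)" "clobber d \<psi> \<subseteq> clobber d (Conj \<phi> \<psi>)"
    by (auto simp: clobber_def)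
  obtain Y where Y: "runs (compile d \<phi>) w (time \<phi> n) X Y"
    "Y 4 = (if sat (set vs) E d e \<phi> then 1 else 0)" "unchanged (clobber d \<phi>) X Y"
    using Conj.IH(1)[of d X e] Conj.prems by auto
  note Yu = unchanged_clobber[OF Y(3)]
  have one: "Y 1 = 1" using Yu(1) Conj.prems(2) by (simp add: ready_def)
  show ?case
  proof (cases "sat (set vs) E d e \<phi>")
    case True
    define Y' where "Y' = Y(3 := 0)"
    have "ready Y'" using Yu(1)[OF Conj.prems(2)] by (simp add: ready_def Y'_def)
    moreover have "Y' (var l) < n \<and> e l = vs ! Y' (var l)" if "l < d" for l
      using Yu(2)[OF that] Conj.prems(3)[OF that] by (simp add: Y'_def)
    ultimately obtain Z where Z: "runs (compile d \<psi>) w (time \<psi> n) Y' Z"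
      "Z 4 = (if sat (set vs) E d e \<psi> then 1 else 0)" "unchanged (clobber d \<psi>) Y' Z"
      using Conj.IH(2)[of d Y' e] Conj.prems(1) by auto
    have "unchanged (clobber d (Conj \<phi> \<psi>)) X Y'"
      using unchanged_upd[OF unchanged_mono[OF Y(3) sub(1)], of 3] by (simp add: clobber_def Y'_def)
    then have "unchanged (clobber d (Conj \<phi> \<psi>)) X Z"
      using unchanged_trans unchanged_mono[OF Z(3) sub(2)] by blast
    moreover
    have "runs (guarded 4 (compile d \<psi>)) w (time \<psi> n + 2) Y Z"
      using one Y(2) True Z(1) unfolding Y'_def by (intro runs_guarded_true) auto
    from runs_seq[OF Y(1) this] have "runs (compile d (Conj \<phi> \<psi>)) w (time (Conj \<phi> \<psi>) n) X Z"
      by simp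
    moreover have "Z 4 = (if sat (set vs) E d e (Conj \<phi> \<psi>) then 1 else 0)" using True Z(2) by simp
    ultimately show ?thesis by blast
  next
    case False
    let ?Z = "Y(3 := 1)"
    have "unchanged (clobber d (Conj \<phi> \<psi>)) X ?Z"
      using unchanged_upd[OF unchanged_mono[OF Y(3) sub(1)], of 3] by (simp add: clobber_def)
    moreover
    have "runs (guarded 4 (compile d \<psi>)) w (time \<psi> n + 2) Y ?Z"
      using one Y(2) False by (intro runs_guarded_false) auto
    from runs_seq[OF Y(1) this] have "runs (compile d (Conj \<phi> \<psi>)) w (time (Conj \<phi> \<psi>) n) X ?Z"
      by simp
    moreover have "?Z 4 = (if sat (set vs) E d e (Conj \<phi> \<psi>) then 1 else 0)" using False Y(2) by simp
    ultimately show ?thesis by blast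
  qed
next
  case (Exists \<phi>)
  let ?D = "clobber d (Exists \<phi>)"
  have sub: "clobber (Suc d) \<phi> \<subseteq> ?D" by (auto simp: clobber_def)
  have vd: "var d \<in> ?D" "4 \<in> ?D" by (auto simp: clobber_def)
  let ?Inv = "\<lambda>k Y. unchanged ?D X Y \<and> Y (var d) = k"
  let ?Q = "\<lambda>k. sat (set vs) E (Suc d) (e(d := vs ! k)) \<phi>"
  have "\<exists>X' k. runs (search (var d) (compile (Suc d) \<phi>)) w (n * (time \<phi> n + 4) + 4) X X' \<and> ?Inv k X' \<and>
      X' 4 = (if \<exists>k<n. ?Q k then 1 else 0)"
  proof (rule runs_search[where Inv = ?Inv])
    show "X 1 = 1" using Exists.prems by (simp add: ready_def)
    show "?Inv 0 (X(var d := 0))" using vd by (auto simp: unchanged_def)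
    fix k Y assume Y: "?Inv k Y"
    then have r: "ready Y" and l: "l < d \<Longrightarrow> Y (var l) = X (var l)" for l
      using unchanged_clobber Exists.prems(2) by blast+
    show "Y (var d) = k \<and> Y 2 = n \<and> Y 1 = 1" using Y r by (simp add: ready_def)
    show "?Inv k (Y(4 := z))" for z using Y vd by (auto simp: unchanged_def)
    show "?Inv (Suc k) (Y(var d := Suc k))" using Y vd by (auto simp: unchanged_def)
    assume k: "k < n"
    define e' where "e' = e(d := vs ! k)"
    have "Y (var l) < n \<and> e' l = vs ! Y (var l)" if "l < Suc d" for l
      using Y k l[of l] Exists.prems(3)[of l] that by (auto simp: less_Suc_eq e'_def)
    then obtain Y' where Y': "runs (compile (Suc d) \<phi>) w (time \<phi> n) Y Y'" "Y' 4 = (if ?Q k then 1 else 0)"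
      "unchanged (clobber (Suc d) \<phi>) Y Y'"
      using Exists.IH[of "Suc d" Y e'] r Exists.prems(1) unfolding e'_def[symmetric] by auto
    have "?Inv k Y'"
      using Y unchanged_trans[OF _ unchanged_mono[OF Y'(3) sub]] unchanged_clobber(2)[OF Y'(3)] by simp
    then show "\<exists>Y'. runs (compile (Suc d) \<phi>) w (time \<phi> n) Y Y' \<and> ?Inv k Y' \<and> Y' 4 = (if ?Q k then 1 else 0)"
      using Y'(1,2) by blast
  qed simp
  moreover have "(\<exists>k<n. ?Q k) \<longleftrightarrow> sat (set vs) E d e (Exists \<phi>)"
    using n by (auto simp: in_set_conv_nth) (metis nth_mem)
  ultimately show ?case unfolding compile.simps time.simps by metis
next
  case (Reach \<phi> i j)
  \<comment> \<open>The registers that the search must preserve: the three constants and the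
    variables bound further out.\<close>
  define K where "K = {0, 1, 2} \<union> var ` {..<d}"
  define S where "S = {z. z < n \<and> sat (set vs) E (Suc d) (e(d := vs ! z)) \<phi>}"
  have wf: "reach_free \<phi>" "wf_fm (Suc d) \<phi>" "i < d" "j < d" using Reach.prems(1) by auto
  have cl: "clobber (Suc d) \<phi> = {3, 4, 5, 6} \<union> {var l | l. d < l}"
    using wf(1) by (auto simp: clobber_def Suc_le_eq)
  have c: "\<exists>X'. runs (compile (Suc d) \<phi>) w (time \<phi> n) Y X' \<and> X' 4 = (if Y (var d) \<in> S then 1 else 0) \<and>
      unchanged ({3, 4, 5, 6} \<union> {var l | l. d < l}) Y X'"
    if Y: "\<And>r. r \<in> K \<Longrightarrow> Y r = X r" "Y (var d) < n" for Y
  proof -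
    have "ready Y" using Reach.prems(2) Y(1) by (simp add: ready_def K_def)
    moreover define e' where "e' = e(d := vs ! Y (var d))"
    have "Y (var l) < n \<and> e' l = vs ! Y (var l)" if "l < Suc d" for l
      using that Y Reach.prems(3)[of l] by (auto simp: less_Suc_eq K_def e'_def)
    moreover have "Y (var d) \<in> S \<longleftrightarrow> sat (set vs) E (Suc d) e' \<phi>" using Y(2) by (simp add: S_def e'_def)
    ultimately show ?thesis
      using Reach.IH[of "Suc d" Y e'] wf(2) unfolding cl by simp
  qed
  have S: "S \<subseteq> {..<n}" by (auto simp: S_def)
  have "\<exists>X'. runs (reach_code (var d) (compile (Suc d) \<phi>) (var i) (var j)) w
      ((n * 8 + 4) + (time \<phi> n + 8) + (n * n * (n * (n * (time \<phi> n + 4 * n + 24) + 7) + 7) + 4) + 4) X X' \<and>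
    X' 4 = (if X (var j) \<in> reachable S (X (var i)) then 1 else 0) \<and> agree_on K X X'"
    by (rule runs_reach[of K d X "compile (Suc d) \<phi>" "time \<phi> n" S])
      (use c S Reach.prems wf in \<open>auto simp: K_def agree_on_def\<close>)
  then obtain X' where X': "runs (compile d (Reach \<phi> i j)) w (time (Reach \<phi> i j) n) X X'"
    "X' 4 = (if X (var j) \<in> reachable S (X (var i)) then 1 else 0)" "agree_on K X X'"
    by auto
  have "{u \<in> set vs. sat (set vs) E (Suc d) (e(d := u)) \<phi>} = (!) vs ` S"
    using n by (auto simp: S_def in_set_conv_nth)
  then have "sat (set vs) E d e (Reach \<phi> i j) \<longleftrightarrow> X (var j) \<in> reachable S (X (var i))"
    using component_nth[OF S, of "X (var i)" "X (var j)"] Reach.prems(3)[OF wf(3)] Reach.prems(3)[OF wf(4)] by simp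
  moreover have "unchanged (clobber d (Reach \<phi> i j)) X X'"
    unfolding unchanged_def
  proof (intro allI impI)
    fix r assume r: "r \<notin> clobber d (Reach \<phi> i j)"
    have "r \<in> K"
    proof (cases "r < 12")
      case True
      then show ?thesis using r by (auto simp: clobber_def K_def)
    next
      case False
      \<comment> \<open>From 12 on, the parity of a register decides whether it is a variable or a
        mark.\<close>
      then have "r = var ((r - 12) div 2) \<or> r = mark ((r - 13) div 2)"
        by (auto simp: var_def mark_def) presburger
      then have "r = var ((r - 12) div 2)" using r by (auto simp: clobber_def)
      then obtain l where "r = var l" by blast
      then show ?thesis using r by (auto simp: clobber_def K_def not_le)
    qed
    then show "X' r = X r" using X'(3) by (simp add: agree_on_def)
  qed
  ultimately show ?case using X'(1,2) by (intro exI[of _ X']) simp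
qed

end

section \<open>The complete program and its running time\<close>

text \<open>Recovers \<open>n\<close> from the input length \<open>n * n\<close>: register 6 runs through the squares.\<close>
definition size_code :: code where
  "size_code = op (SET 2 0) ;; op (SET 6 0) ;; count_loop 5 0 (op (SUB 4 0 6) ;;
     guarded 4 (op (ADD 6 6 2) ;; op (ADD 6 6 2) ;; op (ADD 6 6 1) ;; op (ADD 2 2 1)))"

lemma runs_size_code:
  fixes X :: "nat \<Rightarrow> nat"
  assumes "X 0 = n * n" "X 1 = 1"
  shows "\<exists>X'. runs size_code w (n * n * 10 + 6) X X' \<and> X' 0 = n * n \<and> X' 1 = 1 \<and> X' 2 = n"
proof -
  let ?inc = "op (ADD 6 6 2) ;; op (ADD 6 6 2) ;; op (ADD 6 6 1) ;; op (ADD 2 2 1)"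
  let ?body = "op (SUB 4 0 6) ;; guarded 4 ?inc"
  let ?X = "X(2 := 0, 6 := 0)"
  \<comment> \<open>Register 2 counts up to \<open>n\<close> and then stays; register 6 holds its
    square, updated by \<open>(m + 1) * (m + 1) = m * m + 2 * m + 1\<close>. The
    \<open>n * n\<close> rounds suffice since \<open>n \<le> n * n\<close>.\<close>
  let ?Inv = "\<lambda>k (Y :: nat \<Rightarrow> nat). Y 0 = n * n \<and> Y 1 = 1 \<and> Y 5 = k \<and> Y 2 = min k n \<and> Y 6 = min k n * min k n"
  have "\<exists>Y. runs (count_loop 5 0 ?body) w (n * n * (7 + 3) + 4) ?X Y \<and> ?Inv (n * n) Y"
  proof (rule runs_count_loop[where Inv = ?Inv])
    show "?X 1 = 1" "?Inv 0 (?X(5 := 0))" using assms by simp_all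
    fix k Y assume Y: "?Inv k Y"
    then show "Y 5 = k \<and> Y 0 = n * n" by simp
    show "?Inv k (Y(3 := z))" for z using Y by simp
    let ?Y = "Y(4 := Y 0 - Y 6)"
    show "\<exists>Y'. runs ?body w 7 Y Y' \<and> ?Inv (Suc k) (Y'(5 := Y' 5 + Y' 1))"
    proof (cases "k < n")
      case True
      then have "k * k < n * n" by (simp add: mult_strict_mono')
      then have pos: "?Y 4 > 0" using Y True by simp
      let ?Ya = "?Y(3 := 0)"
      let ?Y1 = "?Ya(6 := ?Ya 6 + ?Ya 2)"
      let ?Y2 = "?Y1(6 := ?Y1 6 + ?Y1 2)"
      let ?Y3 = "?Y2(6 := ?Y2 6 + ?Y2 1)"
      let ?Z = "?Y3(2 := ?Y3 2 + ?Y3 1)"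
      have "runs ?inc w (1 + (1 + (1 + 1))) ?Ya ?Z"
        by (rule runs_seq[OF runs_ADD runs_seq[OF runs_ADD runs_seq[OF runs_ADD runs_ADD]]])
      then have "runs (guarded 4 ?inc) w (1 + (1 + (1 + 1)) + 2) ?Y ?Z"
        using pos Y by (intro runs_guarded_true) simp_all
      from runs_seq[OF runs_SUB[of 4 0 6 w Y] this] have "runs ?body w 7 Y ?Z" by (rule runs_mono) simp
      moreover have "?Inv (Suc k) (?Z(5 := ?Z 5 + ?Z 1))" using Y True by simp
      ultimately show ?thesis by blast
    next
      case False
      let ?Z = "?Y(3 := 1)"
      have "runs (guarded 4 ?inc) w (4 + 2) ?Y ?Z" using Y False by (intro runs_guarded_false) simp_all
      from runs_seq[OF runs_SUB[of 4 0 6 w Y] this] have "runs ?body w 7 Y ?Z" by (rule runs_mono) simp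
      moreover have "?Inv (Suc k) (?Z(5 := ?Z 5 + ?Z 1))" using Y False by simp
      ultimately show ?thesis by blast
    qed
  qed simp
  then obtain Y where Y: "runs (count_loop 5 0 ?body) w (n * n * (7 + 3) + 4) ?X Y" "?Inv (n * n) Y"
    by blast
  have "runs size_code w (1 + (1 + (n * n * (7 + 3) + 4))) X Y"
    unfolding size_code_def by (rule runs_seq[OF runs_SET runs_seq[OF runs_SET Y(1)]])
  then have "runs size_code w (n * n * 10 + 6) X Y" by (rule runs_mono) simp
  moreover have "Y 2 = n" using Y(2) by (cases n) auto
  ultimately show ?thesis using Y(2) by blast
qed

definition program :: "fm \<Rightarrow> instr list" where
  "program \<phi> = (op (SET 1 1) ;; size_code ;; compile 0 \<phi> ;; op (SET 0 0) ;; op (ADD 0 0 4)) 0"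

lemma (in matrix_input) answers_program:
  assumes "wf_fm 0 \<phi>"
  shows "answers_within (program \<phi>) w (n * n * 10 + time \<phi> n + 9) (sat (set vs) E 0 e \<phi>)"
proof -
  let ?c = "op (SET 1 1) ;; size_code ;; compile 0 \<phi> ;; op (SET 0 0) ;; op (ADD 0 0 4)"
  let ?X0 = "(\<lambda>_. 0)(0 := length w)"
  let ?X1 = "?X0(1 := 1)"
  obtain X2 where X2: "runs size_code w (n * n * 10 + 6) ?X1 X2" "X2 0 = n * n" "X2 1 = 1" "X2 2 = n"
    using runs_size_code[of ?X1 n w] length_w by auto
  then obtain X3 where X3: "runs (compile 0 \<phi>) w (time \<phi> n) X2 X3" "X3 4 = (if sat (set vs) E 0 e \<phi> then 1 else 0)"
    using runs_compile[OF assms, of X2 e] by (auto simp: ready_def)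
  let ?X4 = "X3(0 := 0)"
  let ?X5 = "?X4(0 := ?X4 0 + ?X4 4)"
  have "runs ?c w (1 + ((n * n * 10 + 6) + (time \<phi> n + (1 + 1)))) ?X0 ?X5"
    by (rule runs_seq[OF runs_SET runs_seq[OF X2(1) runs_seq[OF X3(1) runs_seq[OF runs_SET runs_ADD]]]])
  moreover have "code_at (program \<phi>) 0 (?c 0)" by (auto simp: code_at_def program_def)
  ultimately have "reaches (program \<phi>) w (1 + ((n * n * 10 + 6) + (time \<phi> n + (1 + 1)))) (0, ?X0) (0 + length (?c 0), ?X5)"
    by (rule runsD)
  then obtain t where "t \<le> 1 + ((n * n * 10 + 6) + (time \<phi> n + (1 + 1)))"
    "(ram_step (program \<phi>) w ^^ t) (0, ?X0) = (length (program \<phi>), ?X5)"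
    by (auto simp: reaches_def program_def)
  then show ?thesis
    unfolding answers_within_def initial_config_def using X3(2)
    by (intro exI[of _ t]) (simp add: halted_def Let_def)
qed

definition poly_fun :: "(nat \<Rightarrow> nat) \<Rightarrow> bool" where
  "poly_fun f \<longleftrightarrow> (\<exists>p :: nat poly. \<forall>n. f n = poly p n)"

lemma poly_fun_intros:
  "poly_fun (\<lambda>n. k)" "poly_fun (\<lambda>n. n)"
  "poly_fun f \<Longrightarrow> poly_fun g \<Longrightarrow> poly_fun (\<lambda>n. f n + g n)"
  "poly_fun f \<Longrightarrow> poly_fun g \<Longrightarrow> poly_fun (\<lambda>n. f n * g n)"
proof -
  show "poly_fun (\<lambda>n. k)" unfolding poly_fun_def by (intro exI[of _ "[:k:]"]) simp
  show "poly_fun (\<lambda>n. n)" unfolding poly_fun_def by (intro exI[of _ "[:0, 1:]"]) simp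
  assume "poly_fun f" "poly_fun g"
  then obtain p q where "\<And>n. f n = poly p n" "\<And>n. g n = poly q n" by (auto simp: poly_fun_def)
  then show "poly_fun (\<lambda>n. f n + g n)" "poly_fun (\<lambda>n. f n * g n)"
    unfolding poly_fun_def by (intro exI[of _ "p + q"] exI[of _ "p * q"]; simp)+
qed

lemma poly_fun_time: "poly_fun (time \<phi>)"
  by (induction \<phi>) (simp only: time.simps[abs_def]; intro poly_fun_intros; assumption?)+

lemma poly_nat_mono: "m \<le> n \<Longrightarrow> poly (p :: nat poly) m \<le> poly p n"
  by (induction p) (auto intro!: mult_mono add_mono)

lemma nth_concat_map_eq_length:
  assumes "\<And>u. length (f u) = m" "i < length us" "j < m"
  shows "concat (map f us) ! (i * m + j) = f (us ! i) ! j"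
  using assms(2)
proof (induction us arbitrary: i)
  case (Cons u us)
  then show ?case using assms(1,3) by (cases i) (auto simp: nth_append)
qed simp

lemma matrix_input_adjacency_matrix:
  assumes "pair_graph G"
  shows "matrix_input (adjacency_matrix G) (sorted_list_of_set (pverts G)) (parcs G) (card (pverts G))"
proof -
  interpret pair_graph G by fact
  let ?vs = "sorted_list_of_set (pverts G)"
  let ?row = "\<lambda>u. map (\<lambda>v. (u, v) \<in> parcs G) ?vs"
  have eq: "adjacency_matrix G = concat (map ?row ?vs)" by (simp add: adjacency_matrix_def Let_def)
  show ?thesis
  proof
    show "length (adjacency_matrix G) = card (pverts G) * card (pverts G)"
      by (simp add: eq length_concat comp_def sum_list_triv)
    fix i j assume "i < card (pverts G)" "j < card (pverts G)"
    then show "adjacency_matrix G ! (i * card (pverts G) + j) \<longleftrightarrow> (?vs ! i, ?vs ! j) \<in> parcs G"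
      unfolding eq by (subst nth_concat_map_eq_length) auto
  qed simp_all
qed

text \<open>For a fixed formula, \<open>time\<close> is a polynomial in the number of vertices. The
  input length is the square of that number and hence not smaller, and polynomials with natural
  coefficients are monotone, so the same polynomial bounds the time in terms of the input
  length.\<close>

lemma solvable_if_definable:
  assumes "wf_fm 0 \<phi>"
  shows "solvable_in_polynomial_time {G :: nat pair_pre_digraph. pair_graph G} adjacency_matrix
    (\<lambda>G. sat (pverts G) (parcs G) 0 e \<phi>)"
proof -
  have "poly_fun (\<lambda>n. n * n * 10 + time \<phi> n + 9)"
    by (intro poly_fun_intros poly_fun_time)
  then obtain p where p: "\<And>n. n * n * 10 + time \<phi> n + 9 = poly p n" by (auto simp: poly_fun_def)
  have "answers_within (program \<phi>) (adjacency_matrix G) (poly p (length (adjacency_matrix G)))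
      (sat (pverts G) (parcs G) 0 e \<phi>)" if G: "pair_graph G" for G :: "nat pair_pre_digraph"
  proof -
    interpret pair_graph G by fact
    interpret matrix_input "adjacency_matrix G" "sorted_list_of_set (pverts G)" "parcs G" "card (pverts G)"
      using G by (rule matrix_input_adjacency_matrix)
    have "card (pverts G) \<le> length (adjacency_matrix G)" using length_w by (cases "card (pverts G)") auto
    then have "n * n * 10 + time \<phi> n + 9 \<le> poly p (length (adjacency_matrix G))" if "n = card (pverts G)" for n
      using poly_nat_mono that unfolding p by blast
    then show ?thesis
      using answers_program[OF assms, of e] pair_finite_verts unfolding answers_within_def
      by (auto intro: le_trans)
  qed
  then show ?thesis unfolding solvable_in_polynomial_time_def by blast
qed

section \<open>A formula for \<open>\<H>\<^sub>2\<close>\<close>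

text \<open>Isolates the clauses that a formula has to express. Connectedness, separation of the
  components and their disjointness from the five single vertices hold automatically.\<close>

lemma (in simple_graph) model_component_iff:
  assumes S: "S \<subseteq> V" "{a, b, c, d, v} \<inter> S = {}" and xy: "x \<in> S" "y \<in> S" "y \<notin> component E S x"
  shows "model a b c d v (component E S x) (component E S y) \<longleftrightarrow>
    apart E {a} {b, c, d, v} \<and> apart E {b} {c, d, v} \<and> apart E {c} {d, v} \<and> apart E {d} {v} \<and>
    apart E {c, d} (component E S x) \<and> apart E {a, b} (component E S y) \<and>
    touch E {a} (component E S x) \<and> touch E {b} (component E S x) \<and> touch E {v} (component E S x) \<and>
    touch E {c} (component E S y) \<and> touch E {d} (component E S y) \<and> touch E {v} (component E S y)"
proof -
  have "conn E (component E S x)" "conn E (component E S y)"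
    using conn_component[OF sym_E] xy by auto
  moreover have "apart E (component E S x) (component E S y)" using component_apart xy by blast
  moreover have "component E S x \<subseteq> S" "component E S y \<subseteq> S" by (rule component_subset)+
  moreover from this have "{a, b, v} \<inter> component E S x = {}" "{c, d, v} \<inter> component E S y = {}"
    "component E S x \<subseteq> V" "component E S y \<subseteq> V"
    using S by auto
  ultimately show ?thesis unfolding model_def by simp
qed

text \<open>The empty conjunction is an equation between a variable and itself, so it is well formed
  at positive depth only.\<close>
definition conjs :: "fm list \<Rightarrow> fm" where
  "conjs \<phi>s = foldr Conj \<phi>s (Eq 0 0)"

definition disjs :: "fm list \<Rightarrow> fm" where
  "disjs \<phi>s = Neg (conjs (map Neg \<phi>s))"

lemma sat_conjs [simp]: "sat V E d e (conjs \<phi>s) \<longleftrightarrow> (\<forall>\<phi>\<in>set \<phi>s. sat V E d e \<phi>)"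
  by (induction \<phi>s) (auto simp: conjs_def)

lemma sat_disjs [simp]: "sat V E d e (disjs \<phi>s) \<longleftrightarrow> (\<exists>\<phi>\<in>set \<phi>s. sat V E d e \<phi>)"
  by (auto simp: disjs_def)

lemma wf_conjs [simp]: "0 < d \<Longrightarrow> wf_fm d (conjs \<phi>s) \<longleftrightarrow> (\<forall>\<phi>\<in>set \<phi>s. wf_fm d \<phi>)"
  by (induction \<phi>s) (auto simp: conjs_def)

lemma wf_disjs [simp]: "0 < d \<Longrightarrow> wf_fm d (disjs \<phi>s) \<longleftrightarrow> (\<forall>\<phi>\<in>set \<phi>s. wf_fm d \<phi>)"
  by (auto simp: disjs_def)

lemma reach_free_conjs [simp]: "reach_free (conjs \<phi>s) \<longleftrightarrow> (\<forall>\<phi>\<in>set \<phi>s. reach_free \<phi>)"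
  by (induction \<phi>s) (auto simp: conjs_def)

lemma reach_free_disjs [simp]: "reach_free (disjs \<phi>s) \<longleftrightarrow> (\<forall>\<phi>\<in>set \<phi>s. reach_free \<phi>)"
  by (auto simp: disjs_def)

lemma wf_Exists_funpow: "wf_fm d ((Exists ^^ k) \<phi>) \<longleftrightarrow> wf_fm (d + k) \<phi>"
  by (induction k arbitrary: d) auto

text \<open>Lets a block of quantifiers be treated as the choice of one assignment that agrees with
  \<open>e\<close> outside the block.\<close>

lemma sat_Exists_funpow:
  "sat V E d e ((Exists ^^ k) \<phi>) \<longleftrightarrow>
    (\<exists>e'. (\<forall>i. i \<notin> {d..<d + k} \<longrightarrow> e' i = e i) \<and> (\<forall>i\<in>{d..<d + k}. e' i \<in> V) \<and> sat V E (d + k) e' \<phi>)"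
proof (induction k arbitrary: d e)
  case 0
  have "e' = e" if "\<forall>i. e' i = e i" for e' :: "nat \<Rightarrow> 'a" using that by auto
  then show ?case by auto
next
  case (Suc k)
  have "sat V E d e ((Exists ^^ Suc k) \<phi>) \<longleftrightarrow> (\<exists>u\<in>V. \<exists>e'. (\<forall>i. i \<notin> {Suc d..<Suc d + k} \<longrightarrow> e' i = (e(d := u)) i) \<and>
      (\<forall>i\<in>{Suc d..<Suc d + k}. e' i \<in> V) \<and> sat V E (Suc d + k) e' \<phi>)" (is "_ \<longleftrightarrow> (\<exists>u\<in>V. \<exists>e'. ?P u e')")
    using Suc.IH by simp
  also have "\<dots> \<longleftrightarrow> (\<exists>e'. (\<forall>i. i \<notin> {d..<d + Suc k} \<longrightarrow> e' i = e i) \<and> (\<forall>i\<in>{d..<d + Suc k}. e' i \<in> V) \<and>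
      sat V E (d + Suc k) e' \<phi>)" (is "_ \<longleftrightarrow> (\<exists>e'. ?Q e')")
  proof -
    have split: "{d..<d + Suc k} = insert d {Suc d..<Suc d + k}" by auto
    have d: "d \<notin> {Suc d..<Suc d + k}" by simp
    have "?Q e'" if "u \<in> V" "?P u e'" for u e'
    proof -
      have "e' d = u" using that(2) d by (metis fun_upd_same)
      then show ?thesis using that unfolding split by (auto simp del: atLeastLessThan_iff)
    qed
    moreover have "?P (e' d) e' \<and> e' d \<in> V" if "?Q e'" for e'
      using that unfolding split by (auto simp del: atLeastLessThan_iff)
    ultimately show ?thesis by blast
  qed
  finally show ?case .
qed

section \<open>Expressing the criterion\<close>

definition far_fm :: "nat \<Rightarrow> nat \<Rightarrow> fm" where
  "far_fm i j = Conj (Neg (Eq i j)) (Neg (Adj i j))"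

text \<open>The first 17 variables stand for \<open>a, b, c, d, v\<close>, the five elements of \<open>W\<close>, the five
  elements of \<open>F\<close>, and \<open>x, y\<close>.\<close>

definition free_fm :: "nat \<Rightarrow> fm" where
  "free_fm z = conjs (map (\<lambda>i. Neg (Eq z i)) [0..<5] @
     [disjs (map (Eq z) [5..<10] @ [conjs (map (\<lambda>i. far_fm i z) [10..<15])])])"

text \<open>\<open>d\<close> is the current depth, hence the variable that \<open>Reach\<close>
  binds; this is why \<open>free_fm\<close> speaks about it.\<close>

definition in_component_fm :: "nat \<Rightarrow> nat \<Rightarrow> nat \<Rightarrow> fm" where
  "in_component_fm d r z = Reach (free_fm d) r z"

text \<open>Variable 17 is the first one after the seventeen guessed vertices, so the membership
  test inside the quantifier takes place at depth 18.\<close>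

definition touch_fm :: "nat \<Rightarrow> nat \<Rightarrow> fm" where
  "touch_fm t r = Exists (Conj (in_component_fm 18 r 17) (Adj t 17))"

definition apart_fm :: "nat \<Rightarrow> nat \<Rightarrow> fm" where
  "apart_fm t r = Neg (Exists (Conj (in_component_fm 18 r 17) (Neg (far_fm t 17))))"

definition criterion_fm :: fm where
  "criterion_fm = conjs ([far_fm 0 1, far_fm 0 2, far_fm 0 3, far_fm 0 4, far_fm 1 2, far_fm 1 3, far_fm 1 4,
     far_fm 2 3, far_fm 2 4, far_fm 3 4, free_fm 15, free_fm 16, Neg (in_component_fm 17 15 16),
     apart_fm 2 15, apart_fm 3 15, apart_fm 0 16, apart_fm 1 16,
     touch_fm 0 15, touch_fm 1 15, touch_fm 4 15, touch_fm 2 16, touch_fm 3 16, touch_fm 4 16])"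

definition H2_fm :: fm where
  "H2_fm = (Exists ^^ 17) criterion_fm"

lemma wf_H2_fm: "wf_fm 0 H2_fm"
proof -
  have [simp]: "wf_fm d (free_fm z)" if "z < d" "15 < d" for z d
    using that by (auto simp: free_fm_def far_fm_def)
  have [simp]: "reach_free (free_fm z)" for z
    by (auto simp: free_fm_def far_fm_def)
  have "wf_fm 17 criterion_fm"
    unfolding criterion_fm_def
    by (simp add: far_fm_def touch_fm_def apart_fm_def in_component_fm_def)
  then show ?thesis by (simp add: H2_fm_def wf_Exists_funpow)
qed

text \<open>Repetitions of one element pad the list. Thus five variables can represent any nonempty
  set of at most five vertices.\<close>

lemma ex_list_length:
  assumes "finite A" "A \<noteq> {}" "card A \<le> k"
  obtains xs where "length xs = k" "set xs = A"
proof -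
  obtain xs where xs: "set xs = A" "distinct xs" using finite_distinct_list[OF assms(1)] by blast
  obtain a where "a \<in> A" using assms(2) by blast
  then have "length (xs @ replicate (k - length xs) a) = k" "set (xs @ replicate (k - length xs) a) = A"
    using xs assms(3) distinct_card[OF xs(2)] by auto
  then show ?thesis using that by blast
qed

context simple_graph
begin

lemma sat_free_fm:
  "sat V E d e (free_fm z) \<longleftrightarrow> e z \<notin> e ` {0..<5} \<and> (e z \<in> e ` {5..<10} \<or> apart E (e ` {10..<15}) {e z})"
  by (auto simp: free_fm_def far_fm_def apart_def simp del: upt_rec_numeral)

lemma sat_in_component_fm:
  assumes "15 \<le> d" "e ` {5..<10} \<subseteq> V"
  shows "sat V E d e (in_component_fm d r z) \<longleftrightarrow>
    e z \<in> component E (free_set (e ` {5..<10}) (e ` {10..<15}) (e ` {0..<5})) (e r)"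
proof -
  have "(e(d := u)) ` A = e ` A" if "d \<notin> A" for u A using that by auto
  then have im: "(e(d := u)) ` {0..<5} = e ` {0..<5}" "(e(d := u)) ` {5..<10} = e ` {5..<10}"
    "(e(d := u)) ` {10..<15} = e ` {10..<15}" for u
    using assms(1) by simp_all
  have "{u \<in> V. sat V E (Suc d) (e(d := u)) (free_fm d)} = free_set (e ` {5..<10}) (e ` {10..<15}) (e ` {0..<5})"
    using assms(2) unfolding sat_free_fm im by (auto simp: free_set_def)
  then show ?thesis by (simp add: in_component_fm_def)
qed

lemma sat_criterion_fm:
  assumes V: "\<And>i. i < 17 \<Longrightarrow> e i \<in> V"
  defines "S \<equiv> free_set (e ` {5..<10}) (e ` {10..<15}) (e ` {0..<5})"
  shows "sat V E 17 e criterion_fm \<longleftrightarrow> e 15 \<in> S \<and> e 16 \<in> S \<and> e 16 \<notin> component E S (e 15) \<and>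
    model (e 0) (e 1) (e 2) (e 3) (e 4) (component E S (e 15)) (component E S (e 16))"
proof -
  have W: "e ` {5..<10} \<subseteq> V" using V by auto
  have leaves: "e ` {0..<5} = {e 0, e 1, e 2, e 3, e 4}"
    by (auto simp: numeral_eq_Suc atLeastLessThanSuc)
  have SV: "S \<subseteq> V" "{e 0, e 1, e 2, e 3, e 4} \<inter> S = {}"
    using W unfolding S_def free_set_def leaves by auto
  have sub: "component E S r \<subseteq> V" for r using component_subset[of E S r] SV by blast
  have inc: "sat V E 18 (e(17 := u)) (in_component_fm 18 r 17) \<longleftrightarrow> u \<in> component E S (e r)" if "r < 17" for u r
  proof -
    have "(e(17 := u)) ` A = e ` A" if "17 \<notin> A" for A using that by auto
    then have im: "(e(17 := u)) ` {0..<5} = e ` {0..<5}" "(e(17 := u)) ` {5..<10} = e ` {5..<10}"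
      "(e(17 := u)) ` {10..<15} = e ` {10..<15}" by simp_all
    show ?thesis using sat_in_component_fm[of 18 "e(17 := u)" r 17] W that unfolding im S_def by simp
  qed
  have touch: "sat V E 17 e (touch_fm t r) \<longleftrightarrow> touch E {e t} (component E S (e r))" if "r < 17" "t < 17" for t r
    using inc[OF that(1)] sub[of "e r"] that by (auto simp: touch_fm_def touch_def)
  have apart: "sat V E 17 e (apart_fm t r) \<longleftrightarrow> apart E {e t} (component E S (e r))" if "r < 17" "t < 17" for t r
    using inc[OF that(1)] sub[of "e r"] that by (auto simp: apart_fm_def far_fm_def apart_def)
  have far: "sat V E 17 e (far_fm i j) \<longleftrightarrow> apart E {e i} {e j}" for i j
    by (simp add: far_fm_def apart_def)
  have free: "sat V E 17 e (free_fm z) \<longleftrightarrow> e z \<in> S" if "z < 17" for z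
    using V[OF that] unfolding sat_free_fm S_def free_set_def by auto
  have comp: "sat V E 17 e (in_component_fm 17 r z) \<longleftrightarrow> e z \<in> component E S (e r)" for r z
    using sat_in_component_fm[of 17 e r z] W unfolding S_def by simp
  have ins: "apart E {p} (insert q (insert q' A)) \<longleftrightarrow> apart E {p} {q} \<and> apart E {p} (insert q' A)"
    "apart E {p, q} B \<longleftrightarrow> apart E {p} B \<and> apart E {q} B" for p q q' A B
    by (auto simp: apart_def)
  show ?thesis
  \<comment> \<open>These three conditions are the hypotheses of \<open>model_component_iff\<close>;
    when they fail, both sides are false.\<close>
  proof (cases "e 15 \<in> S \<and> e 16 \<in> S \<and> e 16 \<notin> component E S (e 15)")
    case True
    then show ?thesis
      using model_component_iff[OF SV, of "e 15" "e 16"]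
      by (simp add: criterion_fm_def touch apart far free comp ins)
  next
    case False
    then show ?thesis by (auto simp: criterion_fm_def free comp)
  qed
qed

lemma sat_H2_fm: "sat V E 0 e0 H2_fm \<longleftrightarrow> criterion"
proof
  assume "sat V E 0 e0 H2_fm"
  then obtain e where "\<forall>i\<in>{0..<17}. e i \<in> V" "sat V E 17 e criterion_fm"
    by (auto simp: H2_fm_def sat_Exists_funpow)
  then have e: "\<And>i. i < 17 \<Longrightarrow> e i \<in> V" "sat V E 17 e criterion_fm" by simp_all
  have leaves: "e ` {0..<5} = {e 0, e 1, e 2, e 3, e 4}"
    by (auto simp: numeral_eq_Suc atLeastLessThanSuc)
  have card: "card (e ` {5..<10}) \<le> 5" "card (e ` {10..<15}) \<le> 5"
    using card_image_le[of "{5..<10}" e] card_image_le[of "{10..<15}" e] by simp_all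
  have ne: "e ` {5..<10} \<noteq> {}" "e ` {10..<15} \<noteq> {}" by simp_all
  have sub: "e ` {5..<10} \<subseteq> V" "e ` {10..<15} \<subseteq> V" using e(1) by auto
  from sat_criterion_fm[THEN iffD1, OF e] card ne sub show criterion
    unfolding criterion_def Let_def leaves by meson
next
  assume criterion
  then obtain a b c d v x y W F where WF: "W \<subseteq> V" "F \<subseteq> V" "W \<noteq> {}" "F \<noteq> {}" "card W \<le> 5" "card F \<le> 5"
    and S: "x \<in> free_set W F {a, b, c, d, v}" "y \<in> free_set W F {a, b, c, d, v}"
      "y \<notin> component E (free_set W F {a, b, c, d, v}) x"
      "model a b c d v (component E (free_set W F {a, b, c, d, v}) x) (component E (free_set W F {a, b, c, d, v}) y)"
    unfolding criterion_def Let_def by blast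
  have fin: "finite W" "finite F" using WF(1,2) finite_V finite_subset by blast+
  obtain ws where ws: "length ws = 5" "set ws = W" using ex_list_length[OF fin(1) WF(3,5)] .
  obtain fs where fs: "length fs = 5" "set fs = F" using ex_list_length[OF fin(2) WF(4,6)] .
  \<comment> \<open>Beyond the seventeen variables the assignment falls back to \<open>e0\<close>,
    as \<open>sat_Exists_funpow\<close> demands.\<close>
  define e where "e i = (if i < 5 then [a, b, c, d, v] ! i else if i < 10 then ws ! (i - 5)
     else if i < 15 then fs ! (i - 10) else if i = 15 then x else if i = 16 then y else e0 i)" for i
  have e5: "e 0 = a" "e 1 = b" "e 2 = c" "e 3 = d" "e 4 = v" "e 15 = x" "e 16 = y" by (simp_all add: e_def)
  have "e ` {0..<5} = {e 0, e 1, e 2, e 3, e 4}"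
    by (auto simp: numeral_eq_Suc atLeastLessThanSuc)
  then have L: "e ` {0..<5} = {a, b, c, d, v}" by (simp only: e5)
  have "(\<lambda>i. e (i + 5)) ` {0..<5} = W" "(\<lambda>i. e (i + 10)) ` {0..<5} = F"
    using ws fs by (force simp: e_def in_set_conv_nth)+
  moreover have "(\<lambda>i. i + 5) ` {0..<5} = {5..<10 :: nat}" "(\<lambda>i. i + 10) ` {0..<5} = {10..<15 :: nat}"
    using image_add_atLeastLessThan'[of 5 0 5] image_add_atLeastLessThan'[of 10 0 5] by simp_all
  ultimately have WF': "e ` {5..<10} = W" "e ` {10..<15} = F"
    by (metis image_image)+
  have xyV: "x \<in> V" "y \<in> V" using S(1,2) WF(1) by (auto simp: free_set_def)
  have eV: "e i \<in> V" if "i < 17" for i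
  proof -
    consider "i \<in> {0..<5}" | "i \<in> {5..<10}" | "i \<in> {10..<15}" | "i = 15" | "i = 16" using \<open>i < 17\<close> by force
    then show ?thesis
    proof cases
      case 1 then have "e i \<in> e ` {0..<5}" by (rule imageI)
      then show ?thesis using L model_in_V[OF S(4)] by blast
    next
      case 2 then have "e i \<in> e ` {5..<10}" by (rule imageI)
      then show ?thesis using WF'(1) WF(1) by blast
    next
      case 3 then have "e i \<in> e ` {10..<15}" by (rule imageI)
      then show ?thesis using WF'(2) WF(2) by blast
    qed (use xyV e5 in simp_all)
  qed
  have "sat V E 17 e criterion_fm"
    using sat_criterion_fm[of e, OF eV] S unfolding L WF' e5 by simp
  moreover have "e i = e0 i" if "\<not> i < 17" for i using that by (simp add: e_def)
  ultimately show "sat V E 0 e0 H2_fm"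
    unfolding H2_fm_def sat_Exists_funpow using eV by (intro exI[of _ e]) auto
qed

end

theorem theorem17:
  shows "induced_minor_problem_in_polynomial_time H2"
proof -
  have "contains_induced_minor G H2 \<longleftrightarrow> sat (pverts G) (parcs G) 0 e H2_fm" if "pair_graph G"
    for G :: "nat pair_pre_digraph" and e
    using contains_H2_iff_criterion[OF that] simple_graph.sat_H2_fm[OF simple_graph_pair_graph[OF that]] by blast
  then show ?thesis
    using solvable_if_definable[OF wf_H2_fm]
    unfolding induced_minor_problem_in_polynomial_time_def solvable_in_polynomial_time_def by simp
qed

end
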